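(* Let $(M,g)$ be an oriented Riemannian manifold of dimension $4$ with curvature tensor $R^M$, Ricci tensor $Ricci^M$ and scalar curvature $s^M$. Let $f:M\to\mathbb{R}$ be a smooth map and $\hat g=e^f g$, with Levi-Civita curvature tensor $\hat R^M$. Set $$P(\nabla f)=\big(2\Delta f+\|\nabla f\|^2-2s^M\big)\nabla f+4(Ricci^M)^{\sharp}(\nabla f)-\nabla(\|\nabla f\|^2).$$ Then, as $4$-forms on $M$, $$\mathcal{X}(\hat R^M)=\mathcal{X}(R^M)+\frac{1}{32\pi^2}\,\mathrm{div}_g\big(P(\nabla f)\big)\,Vol_M,\qquad p_1(\hat R^M)=p_1(R^M).$$
   Context: Gradient, norm, divergence, and $\Delta f=\mathrm{div}(\nabla f)=\mathrm{tr}(Hess f)$ are taken with respect to $g$; $Vol_M$ is the volume form of $g$; $(Ricci^M)^\sharp$ is the endomorphism of $TM$ with $g((Ricci^M)^\sharp X,Y)=Ricci^M(X,Y)$. Curvature sign convention: $R(X,Y)=-\nabla_X\nabla_Y+\nabla_Y\nabla_X+\nabla_{[X,Y]}$, $R(X,Y,Z,W)=g(R(X,Y)Z,W)$, so the sectional curvature of an orthonormal pair is $R(X,Y,X,Y)$, and $Ricci(X,Y)=\mathrm{tr}\{Z\mapsto R(X,Z)Y\}$, $s=\mathrm{tr}\,Ricci$ (positive on round spheres). For the curvature $R$ of a metric connection (metric $g$ on $TM$, or $\hat g$ for $\hat R^M$) and a local oriented orthonormal frame $e_1,\dots,e_4$ for that metric, put $R_{ij}(X,Y)=R(X,Y,e_i,e_j)$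 (2-forms). The Euler and Pontrjagin forms are $$4\pi^2\mathcal{X}(R)=R_{12}\wedge R_{34}-R_{13}\wedge R_{24}+R_{14}\wedge R_{23},\qquad 4\pi^2p_1(R)=\sum_{i<j}R_{ij}\wedge R_{ij}.$$ *)

theory Defs
  imports "HOL-Analysis.Analysis"
begin

section \<open>Generalities\<close>

text \<open>Smoothness of maps on an open subset of a normed space: all iterated directional derivatives
  exist and are continuous.\<close>

fun Ck_on :: "nat \<Rightarrow> 'a::real_normed_vector set \<Rightarrow> ('a \<Rightarrow> 'b::real_normed_vector) \<Rightarrow> bool" where
  "Ck_on 0 S h \<longleftrightarrow> continuous_on S h"
| "Ck_on (Suc k) S h \<longleftrightarrow>
     (\<forall>x\<in>S. h differentiable (at x)) \<and> (\<forall>v. Ck_on k S (\<lambda>x. frechet_derivative h (at x) v))"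

definition smooth_on :: "'a::real_normed_vector set \<Rightarrow> ('a \<Rightarrow> 'b::real_normed_vector) \<Rightarrow> bool" where
  "smooth_on S h \<longleftrightarrow> (\<forall>k. Ck_on k S h)"

text \<open>The value that \<open>F\<close> takes on all \<open>x\<close> with \<open>P x\<close>. It is used for quantities that are computed
  from an auxiliary choice (a basis, an orthonormal frame, local extensions of tangent vectors) and
  do not depend on it; were they to depend on it, the value would be unspecified.\<close>

definition common_value :: "('a \<Rightarrow> bool) \<Rightarrow> ('a \<Rightarrow> 'b) \<Rightarrow> 'b" where
  "common_value P F = (THE t. \<forall>x. P x \<longrightarrow> F x = t)"


section \<open>Oriented smooth 4-manifolds\<close>

text \<open>An atlas is a set of charts \<open>(V, \<phi>)\<close>, where \<open>\<phi>\<close> is relevant on \<open>V\<close> only, so that the inverse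
  of the chart is \<open>inv_into V \<phi>\<close>. The orientation is the one for which all charts of the atlas are
  positively oriented.\<close>

record 'm manifold =
  topo :: "'m topology"
  atlas :: "('m set \<times> ('m \<Rightarrow> real^4)) set"

definition points :: "'m manifold \<Rightarrow> 'm set" where
  "points M = topspace (topo M)"

definition oriented_4_manifold :: "'m manifold \<Rightarrow> bool" where
  "oriented_4_manifold M \<longleftrightarrow>
     Hausdorff_space (topo M) \<and> second_countable (topo M) \<and>
     (\<Union>(V, \<phi>)\<in>atlas M. V) = points M \<and>
     (\<forall>(V, \<phi>)\<in>atlas M. openin (topo M) V \<and> open (\<phi> ` V) \<and>
        homeomorphic_map (subtopology (topo M) V) (top_of_set (\<phi> ` V)) \<phi>) \<and>
     (\<forall>(V, \<phi>)\<in>atlas M. \<forall>(W, \<psi>)\<in>atlas M.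
        smooth_on (\<phi> ` (V \<inter> W)) (\<psi> \<circ> inv_into V \<phi>) \<and>
        (\<forall>x\<in>\<phi> ` (V \<inter> W). det (matrix (frechet_derivative (\<psi> \<circ> inv_into V \<phi>) (at x))) > 0))"

definition smooth_fun :: "'m manifold \<Rightarrow> 'm set \<Rightarrow> ('m \<Rightarrow> real) \<Rightarrow> bool" where
  "smooth_fun M U h \<longleftrightarrow> (\<forall>(V, \<phi>)\<in>atlas M. smooth_on (\<phi> ` (U \<inter> V)) (h \<circ> inv_into V \<phi>))"

definition smooth_near :: "'m manifold \<Rightarrow> 'm \<Rightarrow> ('m \<Rightarrow> real) \<Rightarrow> bool" where
  "smooth_near M p h \<longleftrightarrow> (\<exists>U. openin (topo M) U \<and> p \<in> U \<and> smooth_fun M U h)"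


section \<open>Tangent vectors and vector fields\<close>

text \<open>A tangent vector is identified with the derivative in its direction, an operator on the
  functions that are smooth near the base point. It is set to 0 on all other functions, so that two
  tangent vectors are equal iff they differentiate smooth functions in the same way. The linear
  structure of the tangent space is the pointwise one.\<close>

type_synonym 'm tvec = "('m \<Rightarrow> real) \<Rightarrow> real"

definition chart_vector ::
    "'m manifold \<Rightarrow> 'm set \<Rightarrow> ('m \<Rightarrow> real^4) \<Rightarrow> 'm \<Rightarrow> real^4 \<Rightarrow> 'm tvec" where
  "chart_vector M V \<phi> p w =
     (\<lambda>h. if smooth_near M p h then frechet_derivative (h \<circ> inv_into V \<phi>) (at (\<phi> p)) w else 0)"

definition tangent_space :: "'m manifold \<Rightarrow> 'm \<Rightarrow> 'm tvec set" where
  "tangent_space M p = {chart_vector M V \<phi> p w | V \<phi> w. (V, \<phi>) \<in> atlas M \<and> p \<in> V}"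

definition tzero :: "'m tvec" where
  "tzero = (\<lambda>h. 0)"

definition tadd :: "'m tvec \<Rightarrow> 'm tvec \<Rightarrow> 'm tvec" where
  "tadd u v = (\<lambda>h. u h + v h)"

definition tscale :: "real \<Rightarrow> 'm tvec \<Rightarrow> 'm tvec" where
  "tscale a v = (\<lambda>h. a * v h)"

definition tangent_basis :: "'m manifold \<Rightarrow> 'm \<Rightarrow> (4 \<Rightarrow> 'm tvec) \<Rightarrow> bool" where
  "tangent_basis M p b \<longleftrightarrow>
     (\<forall>i. b i \<in> tangent_space M p) \<and>
     (\<forall>v\<in>tangent_space M p. \<exists>!a::real^4. v = (\<lambda>h. \<Sum>i\<in>UNIV. a $ i * b i h))"

text \<open>Trace of an endomorphism \<open>L\<close> of the tangent space: the trace of its matrix \<open>a\<close> in any basis.\<close>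

definition tangent_trace :: "'m manifold \<Rightarrow> 'm \<Rightarrow> ('m tvec \<Rightarrow> 'm tvec) \<Rightarrow> real" where
  "tangent_trace M p L =
     common_value (\<lambda>(b, a::real^4^4). tangent_basis M p b \<and>
                      (\<forall>i. L (b i) = (\<lambda>h. \<Sum>j\<in>UNIV. a $ i $ j * b j h)))
                  (\<lambda>(b, a). trace a)"

text \<open>Vector fields are total functions of which only the values on \<open>U\<close> matter.\<close>

definition vector_field :: "'m manifold \<Rightarrow> 'm set \<Rightarrow> ('m \<Rightarrow> 'm tvec) \<Rightarrow> bool" where
  "vector_field M U X \<longleftrightarrow>
     (\<forall>p\<in>U. X p \<in> tangent_space M p) \<and>
     (\<forall>V h. openin (topo M) V \<and> V \<subseteq> U \<and> smooth_fun M V h \<longrightarrow> smooth_fun M V (\<lambda>p. X p h))"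

definition lie_bracket ::
    "'m manifold \<Rightarrow> ('m \<Rightarrow> 'm tvec) \<Rightarrow> ('m \<Rightarrow> 'm tvec) \<Rightarrow> 'm \<Rightarrow> 'm tvec" where
  "lie_bracket M X Y p =
     (\<lambda>h. if smooth_near M p h then X p (\<lambda>q. Y q h) - Y p (\<lambda>q. X q h) else 0)"


section \<open>Riemannian metrics and the Levi-Civita connection\<close>

type_synonym 'm metric = "'m \<Rightarrow> 'm tvec \<Rightarrow> 'm tvec \<Rightarrow> real"

definition riemannian_metric :: "'m manifold \<Rightarrow> 'm metric \<Rightarrow> bool" where
  "riemannian_metric M g \<longleftrightarrow>
     (\<forall>p\<in>points M. \<forall>u\<in>tangent_space M p. \<forall>v\<in>tangent_space M p. \<forall>w\<in>tangent_space M p. \<forall>a.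
        g p u v = g p v u \<and>
        g p (tadd u v) w = g p u w + g p v w \<and>
        g p (tscale a u) v = a * g p u v \<and>
        (u \<noteq> tzero \<longrightarrow> g p u u > 0)) \<and>
     (\<forall>U X Y. openin (topo M) U \<and> vector_field M U X \<and> vector_field M U Y \<longrightarrow>
        smooth_fun M U (\<lambda>p. g p (X p) (Y p)))"

definition conformal :: "('m \<Rightarrow> real) \<Rightarrow> 'm metric \<Rightarrow> 'm metric" where
  "conformal f g = (\<lambda>p u v. exp (f p) * g p u v)"

text \<open>\<open>D p v Y\<close> is the covariant derivative of the vector field \<open>Y\<close>, defined near \<open>p\<close>, in the
  direction of the tangent vector \<open>v\<close> at \<open>p\<close>. The axioms are required for fields on arbitrary open
  sets, i.e. for the connection as an operator on local sections; since the function \<open>h\<close> in the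
  Leibniz rule may be the indicator function of a neighbourhood of \<open>p\<close>, they imply that \<open>D p v Y\<close>
  depends on the germ of \<open>Y\<close> at \<open>p\<close> only.\<close>

type_synonym 'm connection = "'m \<Rightarrow> 'm tvec \<Rightarrow> ('m \<Rightarrow> 'm tvec) \<Rightarrow> 'm tvec"

definition affine_connection :: "'m manifold \<Rightarrow> 'm connection \<Rightarrow> bool" where
  "affine_connection M D \<longleftrightarrow>
     (\<forall>U Y. openin (topo M) U \<and> vector_field M U Y \<longrightarrow>
        (\<forall>X. vector_field M U X \<longrightarrow> vector_field M U (\<lambda>p. D p (X p) Y)) \<and>
        (\<forall>p\<in>U. \<forall>u\<in>tangent_space M p. \<forall>v\<in>tangent_space M p. \<forall>a.
           D p (tadd u v) Y = tadd (D p u Y) (D p v Y) \<and>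
           D p (tscale a v) Y = tscale a (D p v Y)) \<and>
        (\<forall>Z. vector_field M U Z \<longrightarrow>
           (\<forall>p\<in>U. \<forall>v\<in>tangent_space M p.
              D p v (\<lambda>q. tadd (Y q) (Z q)) = tadd (D p v Y) (D p v Z))) \<and>
        (\<forall>h. smooth_fun M U h \<longrightarrow>
           (\<forall>p\<in>U. \<forall>v\<in>tangent_space M p.
              D p v (\<lambda>q. tscale (h q) (Y q)) = tadd (tscale (v h) (Y p)) (tscale (h p) (D p v Y)))))"

definition levi_civita :: "'m manifold \<Rightarrow> 'm metric \<Rightarrow> 'm connection \<Rightarrow> bool" where
  "levi_civita M g D \<longleftrightarrow>
     affine_connection M D \<and>
     (\<forall>U X Y. openin (topo M) U \<and> vector_field M U X \<and> vector_field M U Y \<longrightarrow>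
        (\<forall>p\<in>U. D p (X p) Y = tadd (D p (Y p) X) (lie_bracket M X Y p))) \<and>
     (\<forall>U X Y Z. openin (topo M) U \<and> vector_field M U X \<and> vector_field M U Y \<and> vector_field M U Z \<longrightarrow>
        (\<forall>p\<in>U. X p (\<lambda>q. g q (Y q) (Z q)) = g p (D p (X p) Y) (Z p) + g p (Y p) (D p (X p) Z)))"


section \<open>Curvature\<close>

text \<open>Sign convention: \<open>R(X,Y) = - \<nabla>\<^sub>X \<nabla>\<^sub>Y + \<nabla>\<^sub>Y \<nabla>\<^sub>X + \<nabla>\<^bsub>[X,Y]\<^esub>\<close>.\<close>

definition curvature_op ::
    "'m manifold \<Rightarrow> 'm connection \<Rightarrow> ('m \<Rightarrow> 'm tvec) \<Rightarrow> ('m \<Rightarrow> 'm tvec) \<Rightarrow> ('m \<Rightarrow> 'm tvec) \<Rightarrow> 'm \<Rightarrow> 'm tvec"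
  where
  "curvature_op M D X Y Z p =
     (\<lambda>h. - D p (X p) (\<lambda>q. D q (Y q) Z) h + D p (Y p) (\<lambda>q. D q (X q) Z) h
          + D p (lie_bracket M X Y p) Z h)"

text \<open>The curvature tensor at a point, by extending the tangent vectors \<open>u\<close>, \<open>v\<close>, \<open>w\<close> to vector
  fields near \<open>p\<close>.\<close>

definition curvature ::
    "'m manifold \<Rightarrow> 'm connection \<Rightarrow> 'm \<Rightarrow> 'm tvec \<Rightarrow> 'm tvec \<Rightarrow> 'm tvec \<Rightarrow> 'm tvec" where
  "curvature M D p u v w =
     common_value (\<lambda>(X, Y, Z). \<exists>U. openin (topo M) U \<and> p \<in> U \<and>
                      vector_field M U X \<and> vector_field M U Y \<and> vector_field M U Z \<and>
                      X p = u \<and> Y p = v \<and> Z p = w)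
                  (\<lambda>(X, Y, Z). curvature_op M D X Y Z p)"

definition ricci :: "'m manifold \<Rightarrow> 'm connection \<Rightarrow> 'm \<Rightarrow> 'm tvec \<Rightarrow> 'm tvec \<Rightarrow> real" where
  "ricci M D p u v = tangent_trace M p (\<lambda>z. curvature M D p u z v)"

definition sharp :: "'m manifold \<Rightarrow> 'm metric \<Rightarrow> 'm \<Rightarrow> ('m tvec \<Rightarrow> real) \<Rightarrow> 'm tvec" where
  "sharp M g p \<alpha> = (THE v. v \<in> tangent_space M p \<and> (\<forall>w\<in>tangent_space M p. g p v w = \<alpha> w))"

definition ricci_sharp :: "'m manifold \<Rightarrow> 'm metric \<Rightarrow> 'm connection \<Rightarrow> 'm \<Rightarrow> 'm tvec \<Rightarrow> 'm tvec" where
  "ricci_sharp M g D p u = sharp M g p (ricci M D p u)"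

definition scalar_curvature :: "'m manifold \<Rightarrow> 'm metric \<Rightarrow> 'm connection \<Rightarrow> 'm \<Rightarrow> real" where
  "scalar_curvature M g D p = tangent_trace M p (ricci_sharp M g D p)"


section \<open>Gradient, divergence, Laplacian\<close>

definition gradient :: "'m manifold \<Rightarrow> 'm metric \<Rightarrow> ('m \<Rightarrow> real) \<Rightarrow> 'm \<Rightarrow> 'm tvec" where
  "gradient M g f p = sharp M g p (\<lambda>w. w f)"

definition sq_norm :: "'m metric \<Rightarrow> ('m \<Rightarrow> 'm tvec) \<Rightarrow> 'm \<Rightarrow> real" where
  "sq_norm g X p = g p (X p) (X p)"

definition divergence :: "'m manifold \<Rightarrow> 'm connection \<Rightarrow> ('m \<Rightarrow> 'm tvec) \<Rightarrow> 'm \<Rightarrow> real" where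
  "divergence M D X p = tangent_trace M p (\<lambda>v. D p v X)"

definition laplacian :: "'m manifold \<Rightarrow> 'm metric \<Rightarrow> 'm connection \<Rightarrow> ('m \<Rightarrow> real) \<Rightarrow> 'm \<Rightarrow> real" where
  "laplacian M g D f = divergence M D (gradient M g f)"

definition P_field :: "'m manifold \<Rightarrow> 'm metric \<Rightarrow> 'm connection \<Rightarrow> ('m \<Rightarrow> real) \<Rightarrow> 'm \<Rightarrow> 'm tvec" where
  "P_field M g D f p =
     (let df = gradient M g f in
      tadd (tscale (2 * laplacian M g D f p + sq_norm g df p - 2 * scalar_curvature M g D p) (df p))
        (tadd (tscale 4 (ricci_sharp M g D p (df p)))
              (tscale (-1) (gradient M g (sq_norm g df) p))))"


section \<open>Volume form, Euler form and Pontrjagin form\<close>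

text \<open>Frames are indexed by the type \<open>4\<close>, in which the numeral \<open>4\<close> denotes the same element as
  \<open>0\<close>; thus \<open>e 1, e 2, e 3, e 4\<close> are the four members of a frame \<open>e\<close>. A frame is oriented if its
  matrix of components (obtained by differentiating the coordinate functions) has positive
  determinant; this determinant is unaffected by the order in which the indices are listed.\<close>

definition oriented_orthonormal ::
    "'m manifold \<Rightarrow> 'm metric \<Rightarrow> 'm \<Rightarrow> (4 \<Rightarrow> 'm tvec) \<Rightarrow> bool" where
  "oriented_orthonormal M g p e \<longleftrightarrow>
     (\<forall>i. e i \<in> tangent_space M p) \<and>
     (\<forall>i j. g p (e i) (e j) = (if i = j then 1 else 0)) \<and>
     (\<forall>(V, \<phi>)\<in>atlas M. p \<in> V \<longrightarrow> det (\<chi> i j. e i (\<lambda>q. \<phi> q $ j)) > 0)"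

text \<open>The value of a 4-form on \<open>X 1, X 2, X 3, X 4\<close> is written as its value on \<open>X\<close>. The wedge
  product of two 2-forms is the sum over (2,2)-shuffles.\<close>

definition wedge :: "('v \<Rightarrow> 'v \<Rightarrow> real) \<Rightarrow> ('v \<Rightarrow> 'v \<Rightarrow> real) \<Rightarrow> (4 \<Rightarrow> 'v) \<Rightarrow> real" where
  "wedge \<alpha> \<beta> X =
       \<alpha> (X 1) (X 2) * \<beta> (X 3) (X 4) - \<alpha> (X 1) (X 3) * \<beta> (X 2) (X 4) + \<alpha> (X 1) (X 4) * \<beta> (X 2) (X 3)
     + \<alpha> (X 2) (X 3) * \<beta> (X 1) (X 4) - \<alpha> (X 2) (X 4) * \<beta> (X 1) (X 3) + \<alpha> (X 3) (X 4) * \<beta> (X 1) (X 2)"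

text \<open>The volume form is \<open>e\<^sup>1 \<and> e\<^sup>2 \<and> e\<^sup>3 \<and> e\<^sup>4\<close> for the coframe dual to \<open>e\<close>.\<close>

definition volume_form :: "'m manifold \<Rightarrow> 'm metric \<Rightarrow> 'm \<Rightarrow> (4 \<Rightarrow> 'm tvec) \<Rightarrow> real" where
  "volume_form M g p X =
     common_value (oriented_orthonormal M g p) (\<lambda>e. det (\<chi> i j. g p (X i) (e j)))"

definition curvature_form ::
    "'m manifold \<Rightarrow> 'm metric \<Rightarrow> 'm connection \<Rightarrow> 'm \<Rightarrow> (4 \<Rightarrow> 'm tvec) \<Rightarrow> 4 \<Rightarrow> 4 \<Rightarrow> 'm tvec \<Rightarrow> 'm tvec \<Rightarrow> real"
  where
  "curvature_form M g D p e i j u v = g p (curvature M D p u v (e i)) (e j)"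

definition euler_form ::
    "'m manifold \<Rightarrow> 'm metric \<Rightarrow> 'm connection \<Rightarrow> 'm \<Rightarrow> (4 \<Rightarrow> 'm tvec) \<Rightarrow> real" where
  "euler_form M g D p X =
     common_value (oriented_orthonormal M g p)
       (\<lambda>e. let R = curvature_form M g D p e in
          1 / (4 * pi\<^sup>2) *
            (wedge (R 1 2) (R 3 4) X - wedge (R 1 3) (R 2 4) X + wedge (R 1 4) (R 2 3) X))"

definition pontrjagin_form ::
    "'m manifold \<Rightarrow> 'm metric \<Rightarrow> 'm connection \<Rightarrow> 'm \<Rightarrow> (4 \<Rightarrow> 'm tvec) \<Rightarrow> real" where
  "pontrjagin_form M g D p X =
     common_value (oriented_orthonormal M g p)
       (\<lambda>e. let R = curvature_form M g D p e in
          1 / (4 * pi\<^sup>2) *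
            (wedge (R 1 2) (R 1 2) X + wedge (R 1 3) (R 1 3) X + wedge (R 1 4) (R 1 4) X
             + wedge (R 2 3) (R 2 3) X + wedge (R 2 4) (R 2 4) X + wedge (R 3 4) (R 3 4) X))"

end

theory Submission
  imports Defs
begin

text \<open>Everything is computed at one point \<open>p\<close>, in a \<open>g\<close>-orthonormal frame near \<open>p\<close> that is parallel at
  \<open>p\<close>; it is obtained by the Gram-Schmidt process from fields that are parallel at \<open>p\<close>. By the Koszul
  argument the connections of \<open>g\<close> and \<open>exp f * g\<close> differ by a tensor that is linear in \<open>df\<close>, and their
  curvatures at \<open>p\<close> by the Kulkarni-Nomizu product of \<open>g\<close> with
  \<open>\<sigma> = - Hess f / 2 + df \<otimes> df / 4 - |df|\<^sup>2 g / 8\<close>. The Euler form is quadratic in the curvature, and its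
  increment is \<open>(s tr \<sigma> - 2 <Ric, \<sigma>>) / 2 + (tr \<sigma>)\<^sup>2 - |\<sigma>|\<^sup>2\<close> times the volume form, up to \<open>4 pi\<^sup>2\<close>. In
  \<open>div P(grad f)\<close> the derivatives of the curvature cancel by the contracted second Bianchi identity,
  and the third derivatives of \<open>f\<close> by the Ricci identity; what remains is 8 times this increment. In the
  Pontrjagin form the terms with \<open>\<sigma>\<close> vanish by the first Bianchi identity.\<close>

text \<open>Curvature, traces and the characteristic forms are defined as values common to all
  auxiliary choices, so each is first computed in a frame and shown not to depend on the choice. The
  frame is parallel at \<open>p\<close> only, yet the divergence of P differentiates curvature and
  Hessian; hence all components carry their connection terms on a neighbourhood, and these terms are
  dropped only at \<open>p\<close>, after differentiating. Both connections are expanded in one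
  \<open>g\<close>-orthonormal frame, although that of \<open>exp f * g\<close> is not compatible
  with \<open>g\<close>. The frame is rescaled at the very end, where the weights cancel: lowered
  curvature components scale by \<open>exp (- f)\<close>, their products by
  \<open>exp (- 2 * f)\<close>, the volume form by \<open>exp (2 * f)\<close>. The shape of P:
  \<open>- 2 s grad f + 4 Ric (grad f)\<close> is four times the Einstein tensor applied to the
  gradient; that tensor is divergence-free, and it is also what the cross term of the Euler form
  pairs with \<sigma>. The constant \<open>1 / (32 pi\<^sup>2)\<close> is the factor 1/8 of this
  comparison times the normalisation \<open>1 / (4 pi\<^sup>2)\<close>.\<close>

abbreviation (input) sum_UNIV :: "('i \<Rightarrow> 'a::comm_monoid_add) \<Rightarrow> 'a" (binder "\<Oplus>" 10) where
  "sum_UNIV a \<equiv> sum a UNIV"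

section \<open>Smooth functions on normed spaces\<close>

lemma Ck_on_subset: "Ck_on k S h \<Longrightarrow> T \<subseteq> S \<Longrightarrow> Ck_on k T h"
  by (induction k arbitrary: h) (auto intro: continuous_on_subset)

lemma Ck_on_cong:
  assumes "open S" "\<And>x. x \<in> S \<Longrightarrow> h x = h' x" "Ck_on k S h"
  shows "Ck_on k S h'"
  using assms(2,3)
proof (induction k arbitrary: h h')
  case 0
  then show ?case using continuous_on_cong by fastforce
next
  case (Suc k)
  have d: "h differentiable (at x)" if "x \<in> S" for x using Suc.prems(2) that by simp
  have eq: "frechet_derivative h (at x) = frechet_derivative h' (at x)" if "x \<in> S" for x
    using frechet_derivative_transform_within_open[OF d assms(1)] that Suc.prems(1) by blast
  have "h' differentiable (at x)" if x: "x \<in> S" for x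
  proof -
    have "(h has_derivative frechet_derivative h (at x)) (at x)"
      using d x frechet_derivative_works by blast
    then have "(h' has_derivative frechet_derivative h (at x)) (at x)"
      using has_derivative_transform_within_open[OF _ assms(1) x] Suc.prems(1) by blast
    then show ?thesis by (auto simp: differentiable_def)
  qed
  moreover have "Ck_on k S (\<lambda>x. frechet_derivative h' (at x) v)" for v
    by (rule Suc.IH[of "\<lambda>x. frechet_derivative h (at x) v"]) (use eq Suc.prems(2) in auto)
  ultimately show ?case by simp
qed

lemma Ck_on_SucD: "Ck_on (Suc k) S h \<Longrightarrow> Ck_on k S h"
proof (induction k arbitrary: h)
  case 0
  then show ?case
    by (auto intro!: differentiable_imp_continuous_on differentiable_at_imp_differentiable_on)
next
  case (Suc k)
  then show ?case by (meson Ck_on.simps(2))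
qed

text \<open>Lets an explicitly given derivative stand in for \<open>frechet_derivative\<close>, so
  that the inductions below can use the usual differentiation rules.\<close>

lemma Ck_on_SucI:
  assumes "open S" "\<And>x. x \<in> S \<Longrightarrow> (h has_derivative h' x) (at x)"
    and "\<And>v. Ck_on k S (\<lambda>x. h' x v)"
  shows "Ck_on (Suc k) S h"
proof -
  have "frechet_derivative h (at x) = h' x" if "x \<in> S" for x
    using assms(2)[OF that] frechet_derivative_at by metis
  then have "Ck_on k S (\<lambda>x. frechet_derivative h (at x) v)" for v
    by (intro Ck_on_cong[OF assms(1) _ assms(3)[of v]]) simp
  then show ?thesis using assms(2) by (auto simp: differentiable_def)
qed

lemma Ck_on_SucE:
  assumes "Ck_on (Suc k) S h"
  obtains h' where "\<And>x. x \<in> S \<Longrightarrow> (h has_derivative h' x) (at x)" "\<And>v. Ck_on k S (\<lambda>x. h' x v)"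
  using assms that[of "\<lambda>x. frechet_derivative h (at x)"] frechet_derivative_works by fastforce

lemma Ck_on_const: "open S \<Longrightarrow> Ck_on k S (\<lambda>x. c)"
proof (induction k arbitrary: c)
  case (Suc k)
  then show ?case by (intro Ck_on_SucI[where h'="\<lambda>x v. 0"]) auto
qed simp

lemma Ck_on_linear:
  assumes "open S" "bounded_linear L" "Ck_on k S h"
  shows "Ck_on k S (\<lambda>x. L (h x))"
  using assms(3)
proof (induction k arbitrary: h)
  case 0
  then show ?case using assms(2) bounded_linear.continuous_on by auto
next
  case (Suc k)
  from Suc.prems obtain h' where h': "\<And>x. x \<in> S \<Longrightarrow> (h has_derivative h' x) (at x)"
    "\<And>v. Ck_on k S (\<lambda>x. h' x v)" by (rule Ck_on_SucE) blast
  show ?case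
    by (rule Ck_on_SucI[OF assms(1), where h'="\<lambda>x v. L (h' x v)"])
      (use h' Suc.IH in \<open>auto intro: bounded_linear.has_derivative[OF assms(2)]\<close>)
qed

lemma Ck_on_add:
  assumes "open S" "Ck_on k S a" "Ck_on k S b"
  shows "Ck_on k S (\<lambda>x. a x + b x)"
  using assms(2,3)
proof (induction k arbitrary: a b)
  case 0
  then show ?case by (auto intro: continuous_on_add)
next
  case (Suc k)
  from Suc.prems(1) obtain a' where a': "\<And>x. x \<in> S \<Longrightarrow> (a has_derivative a' x) (at x)"
    "\<And>v. Ck_on k S (\<lambda>x. a' x v)" by (rule Ck_on_SucE) blast
  from Suc.prems(2) obtain b' where b': "\<And>x. x \<in> S \<Longrightarrow> (b has_derivative b' x) (at x)"
    "\<And>v. Ck_on k S (\<lambda>x. b' x v)" by (rule Ck_on_SucE) blast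
  show ?case
    by (rule Ck_on_SucI[OF assms(1), where h'="\<lambda>x v. a' x v + b' x v"])
      (use a' b' Suc.IH in \<open>auto intro: has_derivative_add\<close>)
qed

lemma Ck_on_sum:
  assumes "open S" "\<And>i. i \<in> I \<Longrightarrow> Ck_on k S (a i)"
  shows "Ck_on k S (\<lambda>x. \<Sum>i\<in>I. a i x)"
  using assms(2)
  by (induction I rule: infinite_finite_induct)
    (auto simp: Ck_on_const[OF assms(1)] intro: Ck_on_add[OF assms(1)])

lemma Ck_on_mult:
  fixes a b :: "'a::real_normed_vector \<Rightarrow> real"
  assumes "open S" "Ck_on k S a" "Ck_on k S b"
  shows "Ck_on k S (\<lambda>x. a x * b x)"
  using assms(2,3)
proof (induction k arbitrary: a b)
  case 0
  then show ?case by (auto intro: continuous_on_mult)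
next
  case (Suc k)
  from Suc.prems(1) obtain a' where a': "\<And>x. x \<in> S \<Longrightarrow> (a has_derivative a' x) (at x)"
    "\<And>v. Ck_on k S (\<lambda>x. a' x v)" by (rule Ck_on_SucE) blast
  from Suc.prems(2) obtain b' where b': "\<And>x. x \<in> S \<Longrightarrow> (b has_derivative b' x) (at x)"
    "\<And>v. Ck_on k S (\<lambda>x. b' x v)" by (rule Ck_on_SucE) blast
  \<comment> \<open>The product rule pairs a derivative with an undifferentiated factor, so the
    induction hypothesis must apply to \<open>a\<close> and \<open>b\<close> themselves as
    well.\<close>
  have ab: "Ck_on k S a" "Ck_on k S b" using Suc.prems by (auto intro: Ck_on_SucD)
  show ?case
    by (rule Ck_on_SucI[OF assms(1), where h'="\<lambda>x v. a x * b' x v + a' x v * b x"])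
      (use a' b' ab Suc.IH in \<open>auto intro: has_derivative_mult Ck_on_add[OF assms(1)]\<close>)
qed

text \<open>In the chain rule the direction \<open>G' x v\<close> varies with \<open>x\<close>,
  while \<open>Ck_on\<close> speaks of fixed directions. Expanding it in the basis turns the
  derivative into a sum of products that the induction hypothesis covers.\<close>

lemma Ck_on_compose:
  fixes F :: "'b::euclidean_space \<Rightarrow> real" and G :: "'a::real_normed_vector \<Rightarrow> 'b"
  assumes "open S" "Ck_on k T F" "Ck_on k S G" "G ` S \<subseteq> T"
  shows "Ck_on k S (\<lambda>x. F (G x))"
  using assms(2,3)
proof (induction k arbitrary: F)
  case 0
  then show ?case using continuous_on_compose2 assms(4) by fastforce
next
  case (Suc k)
  from Suc.prems(1) obtain F' where F': "\<And>x. x \<in> T \<Longrightarrow> (F has_derivative F' x) (at x)"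
    "\<And>v. Ck_on k T (\<lambda>x. F' x v)" by (rule Ck_on_SucE) blast
  from Suc.prems(2) obtain G' where G': "\<And>x. x \<in> S \<Longrightarrow> (G has_derivative G' x) (at x)"
    "\<And>v. Ck_on k S (\<lambda>x. G' x v)" by (rule Ck_on_SucE) blast
  have G: "Ck_on k S G" using Suc.prems(2) by (rule Ck_on_SucD)
  have expand: "F' (G x) w = (\<Sum>b\<in>Basis. (w \<bullet> b) * F' (G x) b)" if "x \<in> S" for x w
  proof -
    interpret bounded_linear "F' (G x)"
      using F'(1) that assms(4) has_derivative_bounded_linear by blast
    have "F' (G x) w = F' (G x) (\<Sum>b\<in>Basis. (w \<bullet> b) *\<^sub>R b)" by (simp add: euclidean_representation)
    then show ?thesis by (simp add: sum scaleR)
  qed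
  show ?case
  proof (rule Ck_on_SucI[OF assms(1), where h'="\<lambda>x v. F' (G x) (G' x v)"])
    fix x assume "x \<in> S"
    then show "((\<lambda>x. F (G x)) has_derivative (\<lambda>v. F' (G x) (G' x v))) (at x)"
      using has_derivative_compose[OF G'(1) F'(1)] assms(4) by blast
  next
    fix v
    have "Ck_on k S (\<lambda>x. \<Sum>b\<in>Basis. (G' x v \<bullet> b) * F' (G x) b)"
      by (intro Ck_on_sum Ck_on_mult assms(1) Ck_on_linear[OF assms(1) bounded_linear_inner_left]
          G'(2) Suc.IH F'(2) G)
    then show "Ck_on k S (\<lambda>x. F' (G x) (G' x v))"
      by (rule Ck_on_cong[OF assms(1), rotated]) (simp add: expand[symmetric])
  qed
qed

lemma Ck_on_exp:
  fixes h :: "'a::real_normed_vector \<Rightarrow> real"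
  assumes "open S" "Ck_on k S h"
  shows "Ck_on k S (\<lambda>x. exp (h x))"
proof (rule Ck_on_compose[OF assms(1) _ assms(2) subset_UNIV])
  show "Ck_on k UNIV (exp :: real \<Rightarrow> real)"
  proof (induction k)
    case 0
    then show ?case by (auto intro: continuous_on_exp)
  next
    case (Suc k)
    then show ?case
      by (intro Ck_on_SucI[where h'="\<lambda>x v. exp x * v"])
        (auto intro!: derivative_eq_intros Ck_on_mult Ck_on_const)
  qed
qed

lemma Ck_on_powr:
  fixes h :: "'a::real_normed_vector \<Rightarrow> real"
  assumes "open S" "Ck_on k S h" "\<And>x. x \<in> S \<Longrightarrow> h x > 0"
  shows "Ck_on k S (\<lambda>x. h x powr a)"
proof (rule Ck_on_compose[OF assms(1) _ assms(2)])
  show "Ck_on k {0<..} (\<lambda>x::real. x powr a)"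
  \<comment> \<open>Each derivative lowers the exponent by one, so the exponent must vary.\<close>
  proof (induction k arbitrary: a)
    case 0
    then show ?case by (auto intro!: continuous_on_powr continuous_on_id continuous_on_const)
  next
    case (Suc k)
    show ?case
    proof (rule Ck_on_SucI[where h'="\<lambda>x v. a * x powr (a - 1) * v"])
      show "((\<lambda>x. x powr a) has_derivative (\<lambda>v. a * x powr (a - 1) * v)) (at x)" if "x \<in> {0<..}" for x :: real
        using has_real_derivative_powr[of x a] that by (simp add: has_field_derivative_def)
    qed (auto intro!: Ck_on_mult Ck_on_const Suc.IH)
  qed
qed (use assms(3) in auto)

lemma smooth_on_derivative: "smooth_on S h \<Longrightarrow> smooth_on S (\<lambda>x. frechet_derivative h (at x) v)"
  unfolding smooth_on_def by (metis Ck_on.simps(2))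

lemma smooth_on_differentiable: "smooth_on S h \<Longrightarrow> x \<in> S \<Longrightarrow> h differentiable (at x)"
  unfolding smooth_on_def by (meson Ck_on.simps(2))

section \<open>Smooth functions and tangent vectors in charts\<close>

lemma smooth_on_subset: "smooth_on S h \<Longrightarrow> T \<subseteq> S \<Longrightarrow> smooth_on T h"
  unfolding smooth_on_def using Ck_on_subset by blast

lemma smooth_on_cong:
  "open S \<Longrightarrow> (\<And>x. x \<in> S \<Longrightarrow> h x = h' x) \<Longrightarrow> smooth_on S h \<Longrightarrow> smooth_on S h'"
  unfolding smooth_on_def by (meson Ck_on_cong)

lemma frechet_derivative_eqI:
  "(h has_derivative h') (at x) \<Longrightarrow> frechet_derivative h (at x) v = h' v"
  using frechet_derivative_at by metis

locale manifold4 =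
  fixes M :: "'m manifold"
  assumes oriented_4_manifold: "oriented_4_manifold M"
begin

abbreviation "T \<equiv> tangent_space M"

section \<open>Charts and smooth functions on the manifold\<close>

lemma chart_openin: "(V, \<phi>) \<in> atlas M \<Longrightarrow> openin (topo M) V"
  and chart_image_open: "(V, \<phi>) \<in> atlas M \<Longrightarrow> open (\<phi> ` V)"
  and chart_homeomorphic:
    "(V, \<phi>) \<in> atlas M \<Longrightarrow> homeomorphic_map (subtopology (topo M) V) (top_of_set (\<phi> ` V)) \<phi>"
  and transition_smooth:
    "(V, \<phi>) \<in> atlas M \<Longrightarrow> (W, \<psi>) \<in> atlas M \<Longrightarrow> smooth_on (\<phi> ` (V \<inter> W)) (\<psi> \<circ> inv_into V \<phi>)"
  and transition_det:
    "(V, \<phi>) \<in> atlas M \<Longrightarrow> (W, \<psi>) \<in> atlas M \<Longrightarrow> x \<in> \<phi> ` (V \<inter> W) \<Longrightarrow>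
       det (matrix (frechet_derivative (\<psi> \<circ> inv_into V \<phi>) (at x))) > 0"
  using oriented_4_manifold unfolding oriented_4_manifold_def by blast+

lemma chart_at:
  assumes "p \<in> points M"
  obtains V \<phi> where "(V, \<phi>) \<in> atlas M" "p \<in> V"
  using oriented_4_manifold assms unfolding oriented_4_manifold_def by blast

lemma openin_points: "openin (topo M) U \<Longrightarrow> U \<subseteq> points M"
  unfolding points_def by (rule openin_subset)

lemma chart_inj: assumes "(V, \<phi>) \<in> atlas M" shows "inj_on \<phi> V"
proof -
  have "topspace (subtopology (topo M) V) = V"
    using chart_openin[OF assms] openin_subset by fastforce
  then show ?thesis
    using homeomorphic_imp_injective_map[OF chart_homeomorphic[OF assms]] by simp
qed

lemma chart_inv: "(V, \<phi>) \<in> atlas M \<Longrightarrow> q \<in> V \<Longrightarrow> inv_into V \<phi> (\<phi> q) = q"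
  using chart_inj inv_into_f_f by metis

lemma chart_open_image:
  assumes "(V, \<phi>) \<in> atlas M" "openin (topo M) U"
  shows "open (\<phi> ` (U \<inter> V))"
proof -
  have "openin (subtopology (topo M) V) (U \<inter> V)"
    using assms(2) by (auto simp: openin_subtopology)
  then have "openin (top_of_set (\<phi> ` V)) (\<phi> ` (U \<inter> V))"
    using homeomorphic_imp_open_map[OF chart_homeomorphic[OF assms(1)]]
    unfolding open_map_def by blast
  then show ?thesis
    using chart_image_open[OF assms(1)] openin_open_trans by blast
qed

lemma chart_open_preimage:
  assumes "(V, \<phi>) \<in> atlas M" "open A"
  shows "openin (topo M) {q \<in> V. \<phi> q \<in> A}"
proof -
  have t: "topspace (subtopology (topo M) V) = V"
    using chart_openin[OF assms(1)] openin_subset by fastforce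
  have "openin (top_of_set (\<phi> ` V)) (\<phi> ` V \<inter> A)"
    using assms(2) by (simp add: openin_open_Int)
  then have "openin (subtopology (topo M) V) {q \<in> topspace (subtopology (topo M) V). \<phi> q \<in> \<phi> ` V \<inter> A}"
    using homeomorphic_imp_continuous_map[OF chart_homeomorphic[OF assms(1)]]
      openin_continuous_map_preimage by blast
  then have "openin (subtopology (topo M) V) {q \<in> V. \<phi> q \<in> A}"
    unfolding t by (rule back_subst) auto
  then show ?thesis
    using chart_openin[OF assms(1)] openin_trans_full by blast
qed

lemma smooth_funI:
  assumes "\<And>V \<phi>. (V, \<phi>) \<in> atlas M \<Longrightarrow> smooth_on (\<phi> ` (U \<inter> V)) (h \<circ> inv_into V \<phi>)"
  shows "smooth_fun M U h"
  using assms unfolding smooth_fun_def by blast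

lemma smooth_funD:
  "smooth_fun M U h \<Longrightarrow> (V, \<phi>) \<in> atlas M \<Longrightarrow> smooth_on (\<phi> ` (U \<inter> V)) (h \<circ> inv_into V \<phi>)"
  unfolding smooth_fun_def by blast

lemma smooth_fun_subset: "smooth_fun M U h \<Longrightarrow> U' \<subseteq> U \<Longrightarrow> smooth_fun M U' h"
  unfolding smooth_fun_def by (fastforce intro: smooth_on_subset)

lemma smooth_fun_cong:
  assumes "openin (topo M) U" "\<And>q. q \<in> U \<Longrightarrow> h q = h' q" "smooth_fun M U h"
  shows "smooth_fun M U h'"
proof (rule smooth_funI)
  fix V \<phi> assume c: "(V, \<phi>) \<in> atlas M"
  show "smooth_on (\<phi> ` (U \<inter> V)) (h' \<circ> inv_into V \<phi>)"
    by (rule smooth_on_cong[OF chart_open_image[OF c assms(1)] _ smooth_funD[OF assms(3) c]])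
      (use assms(2) chart_inv[OF c] in auto)
qed

lemma smooth_fun_const: "openin (topo M) U \<Longrightarrow> smooth_fun M U (\<lambda>q. c)"
  by (rule smooth_funI) (use chart_open_image in \<open>auto simp: smooth_on_def o_def intro!: Ck_on_const\<close>)

lemma smooth_fun_add:
  "openin (topo M) U \<Longrightarrow> smooth_fun M U a \<Longrightarrow> smooth_fun M U b \<Longrightarrow> smooth_fun M U (\<lambda>q. a q + b q)"
  using chart_open_image unfolding smooth_fun_def smooth_on_def
  by (fastforce simp: o_def intro!: Ck_on_add)

lemma smooth_fun_mult:
  "openin (topo M) U \<Longrightarrow> smooth_fun M U a \<Longrightarrow> smooth_fun M U b \<Longrightarrow> smooth_fun M U (\<lambda>q. a q * b q)"
  using chart_open_image unfolding smooth_fun_def smooth_on_def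
  by (fastforce simp: o_def intro!: Ck_on_mult)

lemma smooth_fun_cmult:
  "openin (topo M) U \<Longrightarrow> smooth_fun M U b \<Longrightarrow> smooth_fun M U (\<lambda>q. c * b q)"
  using smooth_fun_mult smooth_fun_const by blast

lemma smooth_fun_uminus:
  "openin (topo M) U \<Longrightarrow> smooth_fun M U b \<Longrightarrow> smooth_fun M U (\<lambda>q. - b q)"
  using smooth_fun_cmult[of U b "-1"] by simp

lemma smooth_fun_diff:
  "openin (topo M) U \<Longrightarrow> smooth_fun M U a \<Longrightarrow> smooth_fun M U b \<Longrightarrow> smooth_fun M U (\<lambda>q. a q - b q)"
  using smooth_fun_add[of U a "\<lambda>q. - b q"] smooth_fun_uminus by simp

lemma smooth_fun_sum:
  "openin (topo M) U \<Longrightarrow> (\<And>i. i \<in> I \<Longrightarrow> smooth_fun M U (a i)) \<Longrightarrow> smooth_fun M U (\<lambda>q. \<Sum>i\<in>I. a i q)"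
  by (induction I rule: infinite_finite_induct) (auto simp: smooth_fun_const intro: smooth_fun_add)

lemmas smooth_intros =
  smooth_fun_const smooth_fun_add smooth_fun_mult smooth_fun_uminus smooth_fun_diff smooth_fun_sum

lemma smooth_fun_exp:
  "openin (topo M) U \<Longrightarrow> smooth_fun M U a \<Longrightarrow> smooth_fun M U (\<lambda>q. exp (a q))"
  using chart_open_image unfolding smooth_fun_def smooth_on_def
  by (fastforce simp: o_def intro!: Ck_on_exp)

lemma smooth_fun_powr:
  assumes U: "openin (topo M) U" and a: "smooth_fun M U a" "\<And>q. q \<in> U \<Longrightarrow> a q > 0"
  shows "smooth_fun M U (\<lambda>q. a q powr c)"
proof (rule smooth_funI)
  fix V \<phi> assume c: "(V, \<phi>) \<in> atlas M"
  show "smooth_on (\<phi> ` (U \<inter> V)) ((\<lambda>q. a q powr c) \<circ> inv_into V \<phi>)"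
    using chart_open_image[OF c U] smooth_funD[OF a(1) c] chart_inv[OF c] a(2)
    unfolding smooth_on_def o_def by (auto intro!: Ck_on_powr)
qed

text \<open>Since transition maps are smooth, a function on a chart domain may be tested in that
  chart alone.\<close>

lemma smooth_fun_chartI:
  assumes c: "(V, \<phi>) \<in> atlas M" and U: "openin (topo M) U" "U \<subseteq> V"
    and h: "smooth_on (\<phi> ` U) (h \<circ> inv_into V \<phi>)"
  shows "smooth_fun M U h"
proof (rule smooth_funI)
  fix W \<psi> assume d: "(W, \<psi>) \<in> atlas M"
  have o: "open (\<psi> ` (U \<inter> W))" by (rule chart_open_image[OF d U(1)])
  have t: "smooth_on (\<psi> ` (U \<inter> W)) (\<phi> \<circ> inv_into W \<psi>)"
    by (rule smooth_on_subset[OF transition_smooth[OF d c]]) (use U in auto)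
  have "(\<phi> \<circ> inv_into W \<psi>) ` \<psi> ` (U \<inter> W) \<subseteq> \<phi> ` U"
    using chart_inv[OF d] by auto
  then have "smooth_on (\<psi> ` (U \<inter> W)) (\<lambda>x. (h \<circ> inv_into V \<phi>) ((\<phi> \<circ> inv_into W \<psi>) x))"
    using t h Ck_on_compose[OF o] unfolding smooth_on_def by blast
  then show "smooth_on (\<psi> ` (U \<inter> W)) (h \<circ> inv_into W \<psi>)"
    by (rule smooth_on_cong[OF o, rotated]) (use chart_inv[OF c] chart_inv[OF d] U in auto)
qed

lemma smooth_nearI: "openin (topo M) U \<Longrightarrow> p \<in> U \<Longrightarrow> smooth_fun M U h \<Longrightarrow> smooth_near M p h"
  unfolding smooth_near_def by blast

lemma smooth_near_cong:
  assumes "openin (topo M) U" "p \<in> U" "\<And>q. q \<in> U \<Longrightarrow> h q = h' q"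
  shows "smooth_near M p h \<longleftrightarrow> smooth_near M p h'"
proof -
  have "smooth_near M p b" if "smooth_near M p a" "\<And>q. q \<in> U \<Longrightarrow> a q = b q" for a b :: "'m \<Rightarrow> real"
  proof -
    obtain U' where U': "openin (topo M) U'" "p \<in> U'" "smooth_fun M U' a"
      using \<open>smooth_near M p a\<close> unfolding smooth_near_def by blast
    have o: "openin (topo M) (U \<inter> U')" using assms(1) U'(1) by blast
    have "smooth_fun M (U \<inter> U') b"
      by (rule smooth_fun_cong[OF o _ smooth_fun_subset[OF U'(3)]]) (use that in auto)
    then show ?thesis using o assms(2) U'(2) smooth_nearI by blast
  qed
  then show ?thesis using assms(3) by metis
qed

lemma smooth_near_common:
  assumes "smooth_near M p h" "smooth_near M p k"
  obtains U where "openin (topo M) U" "p \<in> U" "smooth_fun M U h" "smooth_fun M U k"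
proof -
  obtain U where U: "openin (topo M) U" "p \<in> U" "smooth_fun M U h"
    using assms(1) unfolding smooth_near_def by blast
  obtain U' where U': "openin (topo M) U'" "p \<in> U'" "smooth_fun M U' k"
    using assms(2) unfolding smooth_near_def by blast
  show ?thesis
    by (rule that[of "U \<inter> U'"]) (use U U' in \<open>auto intro: smooth_fun_subset\<close>)
qed

section \<open>Tangent vectors in charts\<close>

lemma smooth_near_has_derivative:
  assumes c: "(V, \<phi>) \<in> atlas M" "p \<in> V" and h: "smooth_near M p h"
  shows "((h \<circ> inv_into V \<phi>) has_derivative
           frechet_derivative (h \<circ> inv_into V \<phi>) (at (\<phi> p))) (at (\<phi> p))"
proof -
  obtain U where U: "openin (topo M) U" "p \<in> U" "smooth_fun M U h"
    using h unfolding smooth_near_def by blast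
  have "(h \<circ> inv_into V \<phi>) differentiable (at (\<phi> p))"
    by (rule smooth_on_differentiable[OF smooth_funD[OF U(3) c(1)]]) (use U c in auto)
  then show ?thesis using frechet_derivative_works by blast
qed

lemma chart_vector_apply:
  assumes c: "(V, \<phi>) \<in> atlas M" "p \<in> V"
    and h: "smooth_near M p h" "((h \<circ> inv_into V \<phi>) has_derivative h') (at (\<phi> p))"
  shows "chart_vector M V \<phi> p w h = h' w"
  using h frechet_derivative_eqI unfolding chart_vector_def by fastforce

lemma chart_vector_add:
  assumes c: "(V, \<phi>) \<in> atlas M" "p \<in> V"
  shows "chart_vector M V \<phi> p (v + w) = tadd (chart_vector M V \<phi> p v) (chart_vector M V \<phi> p w)"
  using has_derivative_bounded_linear[OF smooth_near_has_derivative[OF c]]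
  unfolding chart_vector_def tadd_def by (auto simp: linear_simps)

lemma chart_vector_scale:
  assumes c: "(V, \<phi>) \<in> atlas M" "p \<in> V"
  shows "chart_vector M V \<phi> p (a *\<^sub>R w) = tscale a (chart_vector M V \<phi> p w)"
  using has_derivative_bounded_linear[OF smooth_near_has_derivative[OF c]]
  unfolding chart_vector_def tscale_def by (auto simp: linear_simps)

lemma transition_has_derivative:
  assumes c: "(V, \<phi>) \<in> atlas M" "p \<in> V" and d: "(W, \<psi>) \<in> atlas M" "p \<in> W"
  shows "((\<psi> \<circ> inv_into V \<phi>) has_derivative
           frechet_derivative (\<psi> \<circ> inv_into V \<phi>) (at (\<phi> p))) (at (\<phi> p))"
  using smooth_on_differentiable[OF transition_smooth[OF c(1) d(1)]] c d frechet_derivative_works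
  by blast

text \<open>The chain rule through the transition map; on functions that are not smooth near
  \<open>p\<close> both sides take the default value 0.\<close>

lemma chart_vector_change:
  assumes c: "(V, \<phi>) \<in> atlas M" "p \<in> V" and d: "(W, \<psi>) \<in> atlas M" "p \<in> W"
  shows "chart_vector M V \<phi> p w =
    chart_vector M W \<psi> p (frechet_derivative (\<psi> \<circ> inv_into V \<phi>) (at (\<phi> p)) w)"
proof
  fix h :: "'m \<Rightarrow> real"
  let ?T = "\<psi> \<circ> inv_into V \<phi>"
  let ?h' = "frechet_derivative (h \<circ> inv_into W \<psi>) (at (\<psi> p))"
  show "chart_vector M V \<phi> p w h = chart_vector M W \<psi> p (frechet_derivative ?T (at (\<phi> p)) w) h"
  proof (cases "smooth_near M p h")
    case True
    have eq: "?T (\<phi> p) = \<psi> p" using chart_inv[OF c] by simp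
    have "((\<lambda>x. (h \<circ> inv_into W \<psi>) (?T x)) has_derivative
        (\<lambda>v. ?h' (frechet_derivative ?T (at (\<phi> p)) v))) (at (\<phi> p))"
      by (rule has_derivative_compose[OF transition_has_derivative[OF c d]])
        (unfold eq, rule smooth_near_has_derivative[OF d True])
    then have "((h \<circ> inv_into V \<phi>) has_derivative
        (\<lambda>v. ?h' (frechet_derivative ?T (at (\<phi> p)) v))) (at (\<phi> p))"
      by (rule has_derivative_transform_within_open[OF _ chart_open_image[OF c(1) chart_openin[OF d(1)]]])
        (use c d chart_inv[OF c(1)] chart_inv[OF d(1)] in auto)
    from chart_vector_apply[OF c True this] show ?thesis
      using True by (simp add: chart_vector_def)
  qed (simp add: chart_vector_def)
qed

text \<open>The definition collects vectors from all charts. By the change of chart a single chart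
  represents them all, which makes linear algebra in \<open>real^4\<close> available.\<close>

lemma tangent_space_chart:
  assumes c: "(V, \<phi>) \<in> atlas M" "p \<in> V"
  shows "T p = range (chart_vector M V \<phi> p)"
proof
  show "range (chart_vector M V \<phi> p) \<subseteq> T p"
    using c unfolding tangent_space_def by blast
  show "T p \<subseteq> range (chart_vector M V \<phi> p)"
    unfolding tangent_space_def using chart_vector_change[OF _ _ c] by auto
qed

lemma tangent_add:
  assumes "p \<in> points M" "u \<in> T p" "v \<in> T p"
  shows "tadd u v \<in> T p"
proof -
  obtain V \<phi> where c: "(V, \<phi>) \<in> atlas M" "p \<in> V" using chart_at[OF assms(1)] .
  show ?thesis using assms(2,3) chart_vector_add[OF c] unfolding tangent_space_chart[OF c]
    by (auto simp flip: chart_vector_add[OF c])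
qed

lemma tangent_scale:
  assumes "p \<in> points M" "u \<in> T p"
  shows "tscale a u \<in> T p"
proof -
  obtain V \<phi> where c: "(V, \<phi>) \<in> atlas M" "p \<in> V" using chart_at[OF assms(1)] .
  show ?thesis using assms(2) unfolding tangent_space_chart[OF c]
    by (auto simp flip: chart_vector_scale[OF c])
qed

lemma tangent_zero: "p \<in> points M \<Longrightarrow> tzero \<in> T p"
proof -
  assume p: "p \<in> points M"
  obtain V \<phi> where c: "(V, \<phi>) \<in> atlas M" "p \<in> V" using chart_at[OF p] .
  have "chart_vector M V \<phi> p 0 \<in> T p" unfolding tangent_space_chart[OF c] by blast
  from tangent_scale[OF p this, of 0] show ?thesis by (simp add: tscale_def tzero_def)
qed

lemma tangent_lincomb:
  assumes "p \<in> points M" "\<And>i. i \<in> I \<Longrightarrow> b i \<in> T p"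
  shows "(\<lambda>h. \<Sum>i\<in>I. a i * b i h) \<in> T p"
  using assms(2)
proof (induction I rule: infinite_finite_induct)
  case (insert i I)
  have "tadd (tscale (a i) (b i)) (\<lambda>h. \<Sum>i\<in>I. a i * b i h) \<in> T p"
    using insert by (auto intro!: tangent_add tangent_scale assms(1))
  then show ?case using insert.hyps by (simp add: tadd_def tscale_def)
qed (use tangent_zero[OF assms(1)] in \<open>simp_all add: tzero_def\<close>)

lemma tangent_chart_vector:
  assumes "v \<in> T p"
  obtains V \<phi> w where "(V, \<phi>) \<in> atlas M" "p \<in> V" "v = chart_vector M V \<phi> p w"
  using assms unfolding tangent_space_def by blast

lemma tangent_not_smooth: "v \<in> T p \<Longrightarrow> \<not> smooth_near M p h \<Longrightarrow> v h = 0"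
  unfolding tangent_space_def chart_vector_def by auto

text \<open>Tangent vectors see germs only. Being smooth near \<open>p\<close> is itself a property
  of the germ, so the default value 0 respects this too.\<close>

lemma tangent_cong:
  assumes v: "v \<in> T p" and U: "openin (topo M) U" "p \<in> U" "\<And>q. q \<in> U \<Longrightarrow> h q = k q"
  shows "v h = v k"
proof (cases "smooth_near M p h")
  case True
  obtain V \<phi> w where c: "(V, \<phi>) \<in> atlas M" "p \<in> V" and w: "v = chart_vector M V \<phi> p w"
    using tangent_chart_vector[OF v] .
  have k: "smooth_near M p k" using True smooth_near_cong[OF U] by simp
  have "((k \<circ> inv_into V \<phi>) has_derivative frechet_derivative (h \<circ> inv_into V \<phi>) (at (\<phi> p))) (at (\<phi> p))"
    by (rule has_derivative_transform_within_open[OF smooth_near_has_derivative[OF c True]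
          chart_open_image[OF c(1) U(1)]])
      (use U c chart_inv[OF c(1)] in auto)
  from chart_vector_apply[OF c k this] show ?thesis
    using True w by (simp add: chart_vector_def)
next
  case False
  then show ?thesis using tangent_not_smooth[OF v] smooth_near_cong[OF U] by simp
qed

section \<open>Tangent vectors as derivations\<close>

lemma smooth_near_const: "p \<in> points M \<Longrightarrow> smooth_near M p (\<lambda>q. c)"
  by (rule smooth_nearI[of "points M"])
    (auto simp: points_def intro: smooth_fun_const openin_topspace)

lemma smooth_near_add:
  assumes "smooth_near M p h" "smooth_near M p k"
  shows "smooth_near M p (\<lambda>q. h q + k q)"
  using smooth_near_common[OF assms] smooth_nearI smooth_fun_add by metis

lemma smooth_near_mult:
  assumes "smooth_near M p h" "smooth_near M p k"
  shows "smooth_near M p (\<lambda>q. h q * k q)"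
  using smooth_near_common[OF assms] smooth_nearI smooth_fun_mult by metis

lemma smooth_near_exp: "smooth_near M p h \<Longrightarrow> smooth_near M p (\<lambda>q. exp (h q))"
  unfolding smooth_near_def using smooth_fun_exp by blast

lemma smooth_near_sum:
  "p \<in> points M \<Longrightarrow> (\<And>i. i \<in> I \<Longrightarrow> smooth_near M p (a i)) \<Longrightarrow> smooth_near M p (\<lambda>q. \<Sum>i\<in>I. a i q)"
  by (induction I rule: infinite_finite_induct) (auto simp: smooth_near_const intro: smooth_near_add)

text \<open>Off the manifold there is no chart, so the tangent space is empty there; a tangent
  vector therefore certifies its base point.\<close>

lemma tangent_point: "v \<in> T p \<Longrightarrow> p \<in> points M"
  using tangent_chart_vector chart_openin openin_points by (metis subsetD)

lemma tangent_deriv_const: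
  assumes v: "v \<in> T p"
  shows "v (\<lambda>q. c) = 0"
proof -
  obtain V \<phi> w where c: "(V, \<phi>) \<in> atlas M" "p \<in> V" and w: "v = chart_vector M V \<phi> p w"
    using tangent_chart_vector[OF v] .
  show ?thesis
    unfolding w by (rule chart_vector_apply[OF c smooth_near_const[OF tangent_point[OF v]], where h' = "\<lambda>v. 0"])
      (simp add: o_def)
qed

lemma tangent_deriv_add:
  assumes v: "v \<in> T p" and h: "smooth_near M p h" and k: "smooth_near M p k"
  shows "v (\<lambda>q. h q + k q) = v h + v k"
proof -
  obtain V \<phi> w where c: "(V, \<phi>) \<in> atlas M" "p \<in> V" and w: "v = chart_vector M V \<phi> p w"
    using tangent_chart_vector[OF v] .
  note d = has_derivative_add[OF smooth_near_has_derivative[OF c h] smooth_near_has_derivative[OF c k]]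
  show ?thesis
    using chart_vector_apply[OF c smooth_near_add[OF h k], unfolded o_def, OF d[unfolded o_def]] h k w
    by (simp add: chart_vector_def o_def)
qed

lemma tangent_deriv_mult:
  assumes v: "v \<in> T p" and h: "smooth_near M p h" and k: "smooth_near M p k"
  shows "v (\<lambda>q. h q * k q) = v h * k p + h p * v k"
proof -
  obtain V \<phi> w where c: "(V, \<phi>) \<in> atlas M" "p \<in> V" and w: "v = chart_vector M V \<phi> p w"
    using tangent_chart_vector[OF v] .
  note d = has_derivative_mult[OF smooth_near_has_derivative[OF c h] smooth_near_has_derivative[OF c k]]
  show ?thesis
    using chart_vector_apply[OF c smooth_near_mult[OF h k], unfolded o_def, OF d[unfolded o_def]] h k w
      chart_inv[OF c]
    by (simp add: chart_vector_def o_def)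
qed

lemma tangent_deriv_exp:
  assumes v: "v \<in> T p" and h: "smooth_near M p h"
  shows "v (\<lambda>q. exp (h q)) = exp (h p) * v h"
proof -
  obtain V \<phi> w where c: "(V, \<phi>) \<in> atlas M" "p \<in> V" and w: "v = chart_vector M V \<phi> p w"
    using tangent_chart_vector[OF v] .
  note d = has_derivative_exp[OF smooth_near_has_derivative[OF c h]]
  show ?thesis
    using chart_vector_apply[OF c smooth_near_exp[OF h], unfolded o_def, OF d[unfolded o_def]] h w
      chart_inv[OF c]
    by (simp add: chart_vector_def o_def mult.commute)
qed

lemma tangent_deriv_cmult:
  assumes v: "v \<in> T p" and h: "smooth_near M p h"
  shows "v (\<lambda>q. c * h q) = c * v h"
  using tangent_deriv_mult[OF v smooth_near_const h] tangent_deriv_const[OF v] tangent_point[OF v]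
  by simp

lemma tangent_deriv_uminus:
  assumes v: "v \<in> T p" and h: "smooth_near M p h"
  shows "v (\<lambda>q. - h q) = - v h"
  using tangent_deriv_cmult[OF v h, of "-1"] by simp

lemma tangent_deriv_diff:
  assumes v: "v \<in> T p" and h: "smooth_near M p h" and k: "smooth_near M p k"
  shows "v (\<lambda>q. h q - k q) = v h - v k"
proof -
  have "smooth_near M p (\<lambda>q. (-1) * k q)"
    by (rule smooth_near_mult[OF smooth_near_const[OF tangent_point[OF v]] k])
  then show ?thesis
    using tangent_deriv_add[OF v h, of "\<lambda>q. - k q"] tangent_deriv_uminus[OF v k] by simp
qed

lemma tangent_deriv_sum:
  assumes v: "v \<in> T p" and h: "\<And>i. i \<in> I \<Longrightarrow> smooth_near M p (a i)"
  shows "v (\<lambda>q. \<Sum>i\<in>I. a i q) = (\<Sum>i\<in>I. v (a i))"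
  using h
  by (induction I rule: infinite_finite_induct)
    (simp_all add: tangent_deriv_const[OF v] tangent_deriv_add[OF v] smooth_near_sum tangent_point[OF v])

lemma chart_coordinate_smooth:
  assumes c: "(V, \<phi>) \<in> atlas M"
  shows "smooth_fun M V (\<lambda>q. \<phi> q $ j)"
proof (rule smooth_funI)
  fix W \<psi> assume d: "(W, \<psi>) \<in> atlas M"
  have "smooth_on (\<psi> ` (V \<inter> W)) (\<lambda>x. ((\<phi> \<circ> inv_into W \<psi>) x) $ j)"
    using transition_smooth[OF d c]
      Ck_on_linear[OF chart_open_image[OF d chart_openin[OF c]] bounded_linear_vec_nth]
    unfolding smooth_on_def by (metis Int_commute)
  then show "smooth_on (\<psi> ` (V \<inter> W)) ((\<lambda>q. \<phi> q $ j) \<circ> inv_into W \<psi>)" by (simp add: o_def)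
qed

lemma chart_coordinate_near:
  "(V, \<phi>) \<in> atlas M \<Longrightarrow> p \<in> V \<Longrightarrow> smooth_near M p (\<lambda>q. \<phi> q $ j)"
  using chart_coordinate_smooth chart_openin smooth_nearI by blast

text \<open>Differentiating the coordinate functions recovers \<open>w\<close>. This makes the
  representation in a chart unique and gives access to the determinants in the definition of
  orientation.\<close>

lemma chart_vector_coordinate:
  assumes c: "(V, \<phi>) \<in> atlas M" "p \<in> V"
  shows "chart_vector M V \<phi> p w (\<lambda>q. \<phi> q $ j) = w $ j"
proof (rule chart_vector_apply[OF c chart_coordinate_near[OF c], where h' = "\<lambda>v. v $ j"])
  have "((\<lambda>x. x $ j) has_derivative (\<lambda>v. v $ j)) (at (\<phi> p))"
    by (rule bounded_linear.has_derivative[OF bounded_linear_vec_nth has_derivative_ident])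
  then show "((\<lambda>q. \<phi> q $ j) \<circ> inv_into V \<phi> has_derivative (\<lambda>v. v $ j)) (at (\<phi> p))"
    by (rule has_derivative_transform_within_open[OF _ chart_image_open[OF c(1)]])
      (use c chart_inv[OF c(1)] in auto)
qed

lemma chart_vector_inject:
  assumes "(V, \<phi>) \<in> atlas M" "p \<in> V"
  shows "chart_vector M V \<phi> p v = chart_vector M V \<phi> p w \<longleftrightarrow> v = w"
  using chart_vector_coordinate[OF assms] by (metis vec_eq_iff)

section \<open>Smooth vector fields\<close>

lemma vector_fieldI:
  assumes "\<And>q. q \<in> U \<Longrightarrow> X q \<in> T q"
    and "\<And>V h. openin (topo M) V \<Longrightarrow> V \<subseteq> U \<Longrightarrow> smooth_fun M V h \<Longrightarrow> smooth_fun M V (\<lambda>p. X p h)"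
  shows "vector_field M U X"
  using assms unfolding vector_field_def by blast

lemma vector_field_tangent: "vector_field M U X \<Longrightarrow> q \<in> U \<Longrightarrow> X q \<in> T q"
  unfolding vector_field_def by blast

lemma vector_field_smooth:
  "vector_field M U X \<Longrightarrow> openin (topo M) V \<Longrightarrow> V \<subseteq> U \<Longrightarrow> smooth_fun M V h \<Longrightarrow> smooth_fun M V (\<lambda>p. X p h)"
  unfolding vector_field_def by blast

lemma vector_field_subset: "vector_field M U X \<Longrightarrow> U' \<subseteq> U \<Longrightarrow> vector_field M U' X"
  unfolding vector_field_def by blast

lemma vector_field_cong:
  assumes "vector_field M U X" "\<And>q. q \<in> U \<Longrightarrow> X q = Y q"
  shows "vector_field M U Y"
proof (rule vector_fieldI)
  show "Y q \<in> T q" if "q \<in> U" for q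
    using vector_field_tangent[OF assms(1) that] assms(2)[OF that] by simp
  show "smooth_fun M V (\<lambda>p. Y p h)" if "openin (topo M) V" "V \<subseteq> U" "smooth_fun M V h" for V h
    by (rule smooth_fun_cong[OF that(1) _ vector_field_smooth[OF assms(1) that]])
      (use assms(2) that in auto)
qed

lemma vector_field_zero: "U \<subseteq> points M \<Longrightarrow> vector_field M U (\<lambda>q. tzero)"
  by (rule vector_fieldI) (use tangent_zero in \<open>auto intro: smooth_fun_const simp: tzero_def\<close>)

lemma vector_field_add:
  assumes "vector_field M U X" "vector_field M U Y"
  shows "vector_field M U (\<lambda>q. tadd (X q) (Y q))"
proof (rule vector_fieldI)
  show "tadd (X q) (Y q) \<in> T q" if "q \<in> U" for q
    using vector_field_tangent[OF assms(1) that] vector_field_tangent[OF assms(2) that]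
    by (intro tangent_add tangent_point)
qed (use assms in \<open>auto simp: tadd_def intro!: smooth_fun_add intro: vector_field_smooth\<close>)

lemma vector_field_scale:
  assumes "smooth_fun M U a" "vector_field M U X"
  shows "vector_field M U (\<lambda>q. tscale (a q) (X q))"
proof (rule vector_fieldI)
  show "tscale (a q) (X q) \<in> T q" if "q \<in> U" for q
    using vector_field_tangent[OF assms(2) that] by (intro tangent_scale tangent_point)
qed (use assms in \<open>auto simp: tscale_def intro!: smooth_fun_mult intro: vector_field_smooth smooth_fun_subset\<close>)

lemma vector_field_lincomb:
  assumes U: "openin (topo M) U" and "\<And>i. i \<in> I \<Longrightarrow> smooth_fun M U (a i)"
    "\<And>i. i \<in> I \<Longrightarrow> vector_field M U (X i)"
  shows "vector_field M U (\<lambda>q h. \<Sum>i\<in>I. a i q * X i q h)"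
  using assms(2,3)
proof (induction I rule: infinite_finite_induct)
  case (insert i I)
  then have "vector_field M U (\<lambda>q. tadd (tscale (a i q) (X i q)) (\<lambda>h. \<Sum>i\<in>I. a i q * X i q h))"
    by (intro vector_field_add vector_field_scale) auto
  then show ?case using insert.hyps by (simp add: tadd_def tscale_def)
qed (use vector_field_zero[OF openin_points[OF U]] in \<open>simp_all add: tzero_def\<close>)

text \<open>Read in the chart, applying the field is differentiation in the fixed direction
  \<open>w\<close>, which preserves smoothness.\<close>

lemma vector_field_chart:
  assumes c: "(V, \<phi>) \<in> atlas M"
  shows "vector_field M V (\<lambda>q. chart_vector M V \<phi> q w)"
proof (rule vector_fieldI)
  show "chart_vector M V \<phi> q w \<in> T q" if "q \<in> V" for q
    using tangent_space_chart[OF c that] by blast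
next
  fix U h assume U: "openin (topo M) U" "U \<subseteq> V" and h: "smooth_fun M U h"
  have near: "smooth_near M q h" if "q \<in> U" for q using smooth_nearI[OF U(1) that h] .
  have s: "smooth_on (\<phi> ` U) (h \<circ> inv_into V \<phi>)"
    using smooth_funD[OF h c] U by (simp add: Int_absorb2)
  show "smooth_fun M U (\<lambda>p. chart_vector M V \<phi> p w h)"
  proof (rule smooth_fun_chartI[OF c U])
    show "smooth_on (\<phi> ` U) ((\<lambda>p. chart_vector M V \<phi> p w h) \<circ> inv_into V \<phi>)"
    proof (rule smooth_on_cong[OF _ _ smooth_on_derivative[OF s, of w]])
      show "open (\<phi> ` U)" using chart_open_image[OF c U(1)] U by (simp add: Int_absorb2)
      show "frechet_derivative (h \<circ> inv_into V \<phi>) (at x) w =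
          ((\<lambda>p. chart_vector M V \<phi> p w h) \<circ> inv_into V \<phi>) x" if "x \<in> \<phi> ` U" for x
        using that chart_inv[OF c] U near unfolding chart_vector_def by auto
    qed
  qed
qed

end

section \<open>Tangent spaces as Euclidean spaces\<close>

definition lincomb :: "(4 \<Rightarrow> real) \<Rightarrow> (4 \<Rightarrow> 'm tvec) \<Rightarrow> 'm tvec" where
  "lincomb a b = (\<lambda>h. \<Oplus>i. a i * b i h)"

lemma lincomb_apply: "lincomb a b h = (\<Oplus>i. a i * b i h)"
  by (simp add: lincomb_def)

lemma tadd_lincomb: "tadd (lincomb a b) (lincomb a' b) = lincomb (\<lambda>i. a i + a' i) b"
  by (simp add: tadd_def lincomb_def sum.distrib distrib_right)

lemma tscale_lincomb: "tscale c (lincomb a b) = lincomb (\<lambda>i. c * a i) b"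
  by (simp add: tscale_def lincomb_def sum_distrib_left mult.assoc)

lemma lincomb_lincomb: "lincomb a (\<lambda>i. lincomb (c i) b) = lincomb (\<lambda>j. \<Oplus>i. a i * c i j) b"
  unfolding lincomb_def sum_distrib_left sum_distrib_right
  by (rule ext, subst sum.swap) (simp add: mult.assoc)

lemma lincomb_delta: "lincomb (\<lambda>j. if i = j then 1 else 0) b = b i"
proof
  fix h
  have "lincomb (\<lambda>j. if i = j then 1 else 0) b h = (\<Oplus>j. if i = j then b j h else 0)"
    unfolding lincomb_def by (rule sum.cong) auto
  then show "lincomb (\<lambda>j. if i = j then 1 else 0) b h = b i h" by simp
qed

text \<open>The admissible choice \<open>x\<close> matters: if there were none, every
  \<open>t\<close> would satisfy the description vacuously.\<close>

lemma common_valueI: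
  assumes "P x" "\<And>y. P y \<Longrightarrow> F y = t"
  shows "common_value P F = t"
  unfolding common_value_def by (rule the_equality) (use assms in blast)+

locale riemannian4 = manifold4 M for M :: "'m manifold" +
  fixes g :: "'m metric"
  assumes riemannian_metric: "riemannian_metric M g"
begin

section \<open>The metric on one tangent space\<close>

lemma metric_commute: "u \<in> T p \<Longrightarrow> v \<in> T p \<Longrightarrow> g p u v = g p v u"
  and metric_add_left: "u \<in> T p \<Longrightarrow> v \<in> T p \<Longrightarrow> w \<in> T p \<Longrightarrow> g p (tadd u v) w = g p u w + g p v w"
  and metric_scale_left: "u \<in> T p \<Longrightarrow> v \<in> T p \<Longrightarrow> g p (tscale a u) v = a * g p u v"
  and metric_pos: "u \<in> T p \<Longrightarrow> u \<noteq> tzero \<Longrightarrow> g p u u > 0"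
  using riemannian_metric tangent_point[of u p] unfolding riemannian_metric_def by blast+

lemma metric_smooth:
  "openin (topo M) U \<Longrightarrow> vector_field M U X \<Longrightarrow> vector_field M U Y \<Longrightarrow> smooth_fun M U (\<lambda>p. g p (X p) (Y p))"
  using riemannian_metric unfolding riemannian_metric_def by blast

lemma metric_zero_left: "v \<in> T p \<Longrightarrow> g p tzero v = 0"
  using metric_scale_left[of v p v 0] by (simp add: tscale_def tzero_def)

lemma metric_scale_right: "u \<in> T p \<Longrightarrow> v \<in> T p \<Longrightarrow> g p v (tscale a u) = a * g p v u"
  by (metis metric_scale_left metric_commute tangent_scale tangent_point)

lemma metric_sum_left:
  assumes w: "w \<in> T p" and b: "\<And>i. i \<in> I \<Longrightarrow> b i \<in> T p"
  shows "g p (\<lambda>h. \<Sum>i\<in>I. a i * b i h) w = (\<Sum>i\<in>I. a i * g p (b i) w)"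
  using b
proof (induction I rule: infinite_finite_induct)
  case (insert i I)
  have "(\<lambda>h. \<Sum>i\<in>insert i I. a i * b i h) = tadd (tscale (a i) (b i)) (\<lambda>h. \<Sum>i\<in>I. a i * b i h)"
    using insert.hyps by (simp add: tadd_def tscale_def)
  moreover have "(\<lambda>h. \<Sum>i\<in>I. a i * b i h) \<in> T p" "tscale (a i) (b i) \<in> T p"
    using insert.prems by (auto intro: tangent_lincomb tangent_scale tangent_point[OF w])
  ultimately show ?case using insert w by (simp add: metric_add_left metric_scale_left)
qed (use metric_zero_left[OF w] in \<open>simp_all add: tzero_def\<close>)

lemma lincomb_tangent: "p \<in> points M \<Longrightarrow> (\<And>i. b i \<in> T p) \<Longrightarrow> lincomb a b \<in> T p"
  unfolding lincomb_def by (rule tangent_lincomb)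

lemma metric_lincomb_left:
  "w \<in> T p \<Longrightarrow> (\<And>i. b i \<in> T p) \<Longrightarrow> g p (lincomb a b) w = (\<Oplus>i. a i * g p (b i) w)"
  unfolding lincomb_def by (rule metric_sum_left)

definition orthonormal_at :: "'m \<Rightarrow> (4 \<Rightarrow> 'm tvec) \<Rightarrow> bool" where
  "orthonormal_at p e \<longleftrightarrow> (\<forall>i. e i \<in> T p) \<and> (\<forall>i j. g p (e i) (e j) = (if i = j then 1 else 0))"

lemma orthonormal_tangent: "orthonormal_at p e \<Longrightarrow> e i \<in> T p"
  and orthonormal_metric: "orthonormal_at p e \<Longrightarrow> g p (e i) (e j) = (if i = j then 1 else 0)"
  unfolding orthonormal_at_def by auto

lemma orthonormal_point: "orthonormal_at p e \<Longrightarrow> p \<in> points M"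
  using orthonormal_tangent tangent_point by blast

lemma metric_lincomb_frame:
  assumes "orthonormal_at p e"
  shows "g p (lincomb a e) (e j) = a j"
  using assms
  by (simp add: metric_lincomb_left orthonormal_tangent orthonormal_metric sum.delta
      if_distrib[of "\<lambda>x. _ * x"] cong: if_cong)

text \<open>A vehicle for counting dimensions: taking inner products with the \<open>e i\<close>
  becomes a linear endomorphism of \<open>real^4\<close>, which is injective iff it is surjective.
  Indices outside \<open>I\<close> are padded with zero rows.\<close>

lemma chart_metric_linear:
  assumes c: "(V, \<phi>) \<in> atlas M" "p \<in> V" and e: "\<And>i. i \<in> I \<Longrightarrow> e i \<in> T p"
  shows "linear (\<lambda>w::real^4. (\<chi> i::4. if i \<in> I then g p (chart_vector M V \<phi> p w) (e i) else 0))"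
  by (rule linearI)
    (use e tangent_space_chart[OF c] in \<open>auto simp: vec_eq_iff chart_vector_add[OF c] chart_vector_scale[OF c]
      metric_add_left metric_scale_left\<close>)

text \<open>Orthonormality makes the component map surjective, because \<open>lincomb\<close> hits
  every vector of components; hence it is injective.\<close>

lemma tangent_eqI:
  assumes e: "orthonormal_at p e" and uv: "u \<in> T p" "v \<in> T p" "\<And>i. g p u (e i) = g p v (e i)"
  shows "u = v"
proof -
  obtain V \<phi> where c: "(V, \<phi>) \<in> atlas M" "p \<in> V" using chart_at[OF orthonormal_point[OF e]] .
  let ?F = "\<lambda>w::real^4. (\<chi> i::4. g p (chart_vector M V \<phi> p w) (e i))"
  have lin: "linear ?F"
    using chart_metric_linear[OF c, of UNIV e] orthonormal_tangent[OF e] by simp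
  have "y \<in> range ?F" for y
  proof -
    have "lincomb (\<lambda>i. y $ i) e \<in> T p"
      using e orthonormal_point orthonormal_tangent by (intro lincomb_tangent)
    then obtain w where w: "lincomb (\<lambda>i. y $ i) e = chart_vector M V \<phi> p w"
      unfolding tangent_space_chart[OF c] by blast
    have "?F w = y"
      by (simp add: vec_eq_iff flip: w) (simp add: metric_lincomb_frame[OF e])
    then show ?thesis by (metis rangeI)
  qed
  then have "surj ?F" by blast
  then have "inj ?F" using linear_surjective_imp_injective[OF lin] by blast
  obtain x y where xy: "u = chart_vector M V \<phi> p x" "v = chart_vector M V \<phi> p y"
    using uv(1,2) unfolding tangent_space_chart[OF c] by blast
  have "?F x = ?F y" using uv(3) unfolding xy by simp
  with \<open>inj ?F\<close> have "x = y" by (rule injD)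
  then show ?thesis using xy by simp
qed

lemma frame_expansion:
  assumes e: "orthonormal_at p e" and v: "v \<in> T p"
  shows "v = lincomb (\<lambda>i. g p v (e i)) e"
  by (rule tangent_eqI[OF e v])
    (use e in \<open>auto simp: metric_lincomb_frame[OF e] intro: lincomb_tangent orthonormal_point orthonormal_tangent\<close>)

lemma metric_frame:
  assumes e: "orthonormal_at p e" and v: "u \<in> T p" "v \<in> T p"
  shows "g p u v = (\<Oplus>i. g p u (e i) * g p v (e i))"
proof -
  have "g p u v = g p (lincomb (\<lambda>i. g p u (e i)) e) v"
    by (rule arg_cong[OF frame_expansion[OF e v(1)], of "\<lambda>x. g p x v"])
  then show ?thesis
    using metric_lincomb_left[OF v(2) orthonormal_tangent[OF e]]
      metric_commute[OF v(2) orthonormal_tangent[OF e]] by simp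
qed

text \<open>An index outside \<open>I\<close> gives a zero row, so the component map is not
  surjective, hence not injective; a kernel element is the required vector.\<close>

lemma orthogonal_vector_exists:
  assumes p: "p \<in> points M" and e: "\<And>i. i \<in> I \<Longrightarrow> e i \<in> T p" and I: "I \<noteq> (UNIV :: 4 set)"
  obtains u where "u \<in> T p" "u \<noteq> tzero" "\<And>i. i \<in> I \<Longrightarrow> g p u (e i) = 0"
proof -
  obtain V \<phi> where c: "(V, \<phi>) \<in> atlas M" "p \<in> V" using chart_at[OF p] .
  let ?F = "\<lambda>w::real^4. (\<chi> i::4. if i \<in> I then g p (chart_vector M V \<phi> p w) (e i) else 0)"
  have lin: "linear ?F" by (rule chart_metric_linear[OF c e])
  obtain k where k: "k \<notin> I" using I by blast
  have "\<not> surj ?F"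
  proof
    assume "surj ?F"
    then obtain w where "(\<chi> i. 1) = ?F w" by (rule surjE)
    from arg_cong[OF this, of "\<lambda>x. x $ k"] show False using k by simp
  qed
  then have "\<not> inj ?F" using linear_injective_imp_surjective[OF lin] by blast
  then obtain w where w: "?F w = 0" "w \<noteq> 0" using linear_injective_0[OF lin] by blast
  let ?u = "chart_vector M V \<phi> p w"
  have "?u \<in> T p" unfolding tangent_space_chart[OF c] by blast
  moreover have "?u \<noteq> tzero"
    using w(2) chart_vector_inject[OF c, of w 0] chart_vector_scale[OF c, of 0 w]
    by (auto simp: tscale_def tzero_def)
  moreover have "g p ?u (e i) = 0" if "i \<in> I" for i 
    using arg_cong[OF w(1), of "\<lambda>x. x $ i"] that by simp
  ultimately show ?thesis using that by blast
qed

definition tangent_linear :: "'m \<Rightarrow> ('m tvec \<Rightarrow> 'm tvec) \<Rightarrow> bool" where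
  "tangent_linear p L \<longleftrightarrow> (\<forall>u\<in>T p. L u \<in> T p) \<and>
     (\<forall>a b. (\<forall>i. b i \<in> T p) \<longrightarrow> L (lincomb a b) = lincomb a (\<lambda>i. L (b i)))"

lemma lincomb_frame_eq_iff:
  assumes "orthonormal_at p e"
  shows "lincomb a e = lincomb b e \<longleftrightarrow> a = b"
  using metric_lincomb_frame[OF assms] by (metis ext)

lemma orthonormal_basis:
  assumes e: "orthonormal_at p e"
  shows "tangent_basis M p e"
proof -
  have "\<exists>!a::real^4. v = lincomb (\<lambda>i. a $ i) e" if v: "v \<in> T p" for v
  proof (rule ex1I[of _ "\<chi> i. g p v (e i)"])
    show "v = lincomb (\<lambda>i. (\<chi> i. g p v (e i)) $ i) e"
      unfolding vec_lambda_beta by (rule frame_expansion[OF e v])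
    show "a = (\<chi> i. g p v (e i))" if "v = lincomb (\<lambda>i. a $ i) e" for a :: "real^4"
      using metric_lincomb_frame[OF e] that by (simp add: vec_eq_iff)
  qed
  then show ?thesis unfolding tangent_basis_def using orthonormal_tangent[OF e]
    by (simp add: lincomb_def)
qed

text \<open>The matrices of \<open>L\<close> in an arbitrary basis and in the orthonormal frame are
  similar, so every admissible pair in the definition yields the same trace.\<close>

lemma tangent_trace_frame:
  assumes e: "orthonormal_at p e" and L: "tangent_linear p L"
  shows "tangent_trace M p L = (\<Oplus>i. g p (L (e i)) (e i))"
proof -
  have eT: "e i \<in> T p" for i by (rule orthonormal_tangent[OF e])
  have LT: "L u \<in> T p" if "u \<in> T p" for u using L that unfolding tangent_linear_def by blast
  have Llin: "L (lincomb a b) = lincomb a (\<lambda>i. L (b i))" if "\<And>i. b i \<in> T p" for a b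
    using L that unfolding tangent_linear_def by blast
  define A :: "real^4^4" where "A = (\<chi> i j. g p (L (e i)) (e j))"
  have A: "L (e i) = lincomb (\<lambda>j. A $ i $ j) e" for i
    unfolding A_def vec_lambda_beta by (rule frame_expansion[OF e LT[OF eT]])
  have trA: "trace A = (\<Oplus>i. g p (L (e i)) (e i))" by (simp add: A_def trace_def)
  have eq: "trace a = trace A"
    if b: "tangent_basis M p b" and a: "\<And>i. L (b i) = lincomb (\<lambda>j. a $ i $ j) b"
    for b and a :: "real^4^4"
  proof -
    have bT: "b i \<in> T p" for i using b unfolding tangent_basis_def by blast
    define B :: "real^4^4" where "B = (\<chi> i j. g p (b i) (e j))"
    have B: "b i = lincomb (\<lambda>j. B $ i $ j) e" for i
      unfolding B_def vec_lambda_beta by (rule frame_expansion[OF e bT])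
    have bB: "(\<lambda>i. lincomb (\<lambda>j. B $ i $ j) e) = b" by (rule ext, rule B[symmetric])
    have eA: "(\<lambda>i. lincomb (\<lambda>j. A $ i $ j) e) = (\<lambda>i. L (e i))" by (rule ext, rule A[symmetric])
    have "\<exists>c::real^4. e i = lincomb (\<lambda>j. c $ j) b" for i
      using b eT unfolding tangent_basis_def lincomb_def by blast
    then obtain c :: "4 \<Rightarrow> real^4" where c: "\<And>i. e i = lincomb (\<lambda>j. c i $ j) b" by metis
    \<comment> \<open>The inverse change of basis; for square matrices a one-sided inverse is
      two-sided.\<close>
    define C :: "real^4^4" where "C = (\<chi> i. c i)"
    have "lincomb (\<lambda>j. (C ** B) $ i $ j) e = lincomb (\<lambda>j. mat 1 $ i $ j) e" for i
    proof -
      have "e i = lincomb (\<lambda>j. C $ i $ j) (\<lambda>i. lincomb (\<lambda>j. B $ i $ j) e)"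
        unfolding C_def bB vec_lambda_beta by (rule c)
      then have "e i = lincomb (\<lambda>j. (C ** B) $ i $ j) e"
        unfolding lincomb_lincomb by (simp add: matrix_matrix_mult_def)
      then show ?thesis using lincomb_delta[of i e] by (simp add: mat_def)
    qed
    then have CB: "C ** B = mat 1"
      unfolding lincomb_frame_eq_iff[OF e] by (metis (no_types, lifting) ext vec_eq_iff)
    \<comment> \<open>Expand \<open>L (b i)\<close> in the frame twice: through the matrix of
      \<open>L\<close> in \<open>b\<close>, and through its matrix in \<open>e\<close>.\<close>
    have "lincomb (\<lambda>j. (a ** B) $ i $ j) e = lincomb (\<lambda>j. (B ** A) $ i $ j) e" for i
    proof -
      have "L (b i) = lincomb (\<lambda>j. (a ** B) $ i $ j) e"
      proof -
        have "L (b i) = lincomb (\<lambda>j. a $ i $ j) (\<lambda>i. lincomb (\<lambda>j. B $ i $ j) e)"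
          unfolding bB by (rule a)
        then show ?thesis unfolding lincomb_lincomb by (simp add: matrix_matrix_mult_def)
      qed
      moreover have "L (b i) = lincomb (\<lambda>j. (B ** A) $ i $ j) e"
      proof -
        have "L (b i) = lincomb (\<lambda>j. B $ i $ j) (\<lambda>i. lincomb (\<lambda>j. A $ i $ j) e)"
          unfolding eA Llin[OF eT, symmetric] by (rule arg_cong[OF B])
        then show ?thesis unfolding lincomb_lincomb by (simp add: matrix_matrix_mult_def)
      qed
      ultimately show ?thesis by simp
    qed
    then have aB: "a ** B = B ** A"
      unfolding lincomb_frame_eq_iff[OF e] by (metis (no_types, lifting) ext vec_eq_iff)
    have BC: "B ** C = mat 1" using CB matrix_left_right_inverse by blast
    have "a = a ** (B ** C)" by (simp add: BC)
    also have "\<dots> = B ** (A ** C)" by (metis aB matrix_mul_assoc)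
    finally have "trace a = trace ((A ** C) ** B)" by (metis trace_mul_sym)
    also have "\<dots> = trace A" by (metis CB matrix_mul_assoc matrix_mul_rid)
    finally show ?thesis .
  qed
  show ?thesis
    unfolding tangent_trace_def
    by (rule common_valueI[where x = "(e, A)"])
      (use orthonormal_basis[OF e] A eq trA in \<open>auto simp: lincomb_def\<close>)
qed

text \<open>The hypothesis on \<alpha> encodes linearity as recovery from the values on the
  frame.\<close>

lemma sharp_frame:
  assumes e: "orthonormal_at p e"
    and \<alpha>: "\<And>w. w \<in> T p \<Longrightarrow> \<alpha> w = (\<Oplus>i. g p w (e i) * \<alpha> (e i))"
  shows "sharp M g p \<alpha> = lincomb (\<lambda>i. \<alpha> (e i)) e"
  unfolding sharp_def
proof (rule the_equality)
  have t: "lincomb (\<lambda>i. \<alpha> (e i)) e \<in> T p"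
    using e by (intro lincomb_tangent orthonormal_point orthonormal_tangent)
  moreover have "g p (lincomb (\<lambda>i. \<alpha> (e i)) e) w = \<alpha> w" if "w \<in> T p" for w
    using metric_frame[OF e t that] \<alpha>[OF that] by (simp add: metric_lincomb_frame[OF e] mult.commute)
  ultimately show "lincomb (\<lambda>i. \<alpha> (e i)) e \<in> T p \<and> (\<forall>w\<in>T p. g p (lincomb (\<lambda>i. \<alpha> (e i)) e) w = \<alpha> w)"
    by blast
  show "v = lincomb (\<lambda>i. \<alpha> (e i)) e" if "v \<in> T p \<and> (\<forall>w\<in>T p. g p v w = \<alpha> w)" for v
  proof -
    have "v = lincomb (\<lambda>i. g p v (e i)) e" using frame_expansion[OF e] that by blast
    also have "(\<lambda>i. g p v (e i)) = (\<lambda>i. \<alpha> (e i))" using that orthonormal_tangent[OF e] by blast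
    finally show ?thesis .
  qed
qed

end

section \<open>Connections and curvature in an orthonormal frame\<close>

lemma sum_bilinear:
  fixes a b :: "'j::finite \<Rightarrow> 'm::finite \<Rightarrow> real"
  shows "(\<Oplus>m. (\<Oplus>j. y j * a j m) * (\<Oplus>i. x i * b i m)) =
    (\<Oplus>i j. x i * y j * (\<Oplus>m. a j m * b i m))"
proof -
  have "(\<Oplus>m. (\<Oplus>j. y j * a j m) * (\<Oplus>i. x i * b i m)) =
    (\<Oplus>m i j. x i * y j * (a j m * b i m))"
    by (subst mult.commute) (simp add: sum_product mult_ac)
  also have "\<dots> = (\<Oplus>i m j. x i * y j * (a j m * b i m))"
    by (rule sum.swap)
  also have "\<dots> = (\<Oplus>i j m. x i * y j * (a j m * b i m))"
    by (intro sum.cong refl sum.swap)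
  finally show ?thesis by (simp add: sum_distrib_left)
qed

lemma sum_contract:
  fixes a :: "'i::finite \<Rightarrow> 'j::finite \<Rightarrow> 'm::finite \<Rightarrow> real"
  shows "(\<Oplus>m. (\<Oplus>i j. x i * y j * a i j m) * b m) =
    (\<Oplus>i j. x i * y j * (\<Oplus>m. a i j m * b m))"
proof -
  have "(\<Oplus>m. (\<Oplus>i j. x i * y j * a i j m) * b m) =
    (\<Oplus>m i j. x i * y j * (a i j m * b m))"
    by (simp add: sum_distrib_right mult.assoc)
  also have "\<dots> = (\<Oplus>i m j. x i * y j * (a i j m * b m))"
    by (rule sum.swap)
  also have "\<dots> = (\<Oplus>i j m. x i * y j * (a i j m * b m))"
    by (intro sum.cong refl sum.swap)
  finally show ?thesis by (simp add: sum_distrib_left)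
qed

text \<open>The cancellation behind tensoriality of the curvature in \<open>Z\<close>:
  \<open>z\<close> stands for the components of \<open>Z\<close>, \<open>x\<close> and
  \<open>y\<close> for their derivatives along \<open>X\<close> and \<open>Y\<close>,
  \<open>a\<close> and \<open>b\<close> for the two mixed second derivatives. Only terms with a
  factor \<open>z\<close> survive.\<close>

lemma sum_cancel:
  fixes z :: "'k::finite \<Rightarrow> real"
  shows "- (a + (\<Oplus>k. x k * v k + z k * v' k) + (\<Oplus>k. y k * u k) + (\<Oplus>k. z k * p k))
    + (b + (\<Oplus>k. y k * u k + z k * u' k) + (\<Oplus>k. x k * v k) + (\<Oplus>k. z k * r k))
    + (a - b + (\<Oplus>k. z k * c k)) =
    (\<Oplus>k. z k * (- v' k + u' k + c k - p k + r k))"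
  unfolding distrib_left right_diff_distrib sum.distrib sum_subtractf sum_negf mult_minus_right
  by linarith

text \<open>The same cancellation for \<open>X\<close> and \<open>Y\<close>: here \<open>a\<close>
  and \<open>b\<close> collect the derivatives of their components, which the bracket
  removes.\<close>

lemma sum_cancel_two_form:
  fixes x y :: "'i::finite \<Rightarrow> real"
  shows "- (a + (\<Oplus>i j. x i * y j * p i j)) + (b + (\<Oplus>i j. x i * y j * r i j))
    + (a - b + (\<Oplus>i j. x i * y j * c i j)) - (\<Oplus>i j. x i * y j * u i j)
    + (\<Oplus>i j. x i * y j * v i j) =
    (\<Oplus>i j. x i * y j * (- p i j + r i j + c i j - (u i j - v i j)))"
  unfolding distrib_left right_diff_distrib sum.distrib sum_subtractf sum_negf mult_minus_right
  by linarith

text \<open>Torsion-freeness is kept apart from compatibility with a metric, so that the connection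
  of \<open>exp f * g\<close> can be expanded in a frame that is orthonormal for
  \<open>g\<close>.\<close>

locale torsion_free4 = manifold4 M for M :: "'m manifold" +
  fixes D :: "'m connection"
  assumes connection: "affine_connection M D"
    and torsion_free: "\<And>U X Y p. openin (topo M) U \<Longrightarrow> vector_field M U X \<Longrightarrow> vector_field M U Y \<Longrightarrow>
      p \<in> U \<Longrightarrow> D p (X p) Y = tadd (D p (Y p) X) (lie_bracket M X Y p)"
begin

section \<open>Linearity and locality of the covariant derivative\<close>

context
  fixes U :: "'m set" and Y :: "'m \<Rightarrow> 'm tvec"
  assumes U: "openin (topo M) U" and Y: "vector_field M U Y"
begin

lemmas affine_connection_axioms =
  connection[unfolded affine_connection_def, THEN spec, THEN spec, THEN mp, OF conjI[OF U Y]]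

lemma cov_field: "vector_field M U X \<Longrightarrow> vector_field M U (\<lambda>p. D p (X p) Y)"
  using affine_connection_axioms[THEN conjunct1] by blast

lemma cov_direction_add:
  "p \<in> U \<Longrightarrow> u \<in> T p \<Longrightarrow> v \<in> T p \<Longrightarrow>
     D p (tadd u v) Y = tadd (D p u Y) (D p v Y)"
  and cov_direction_scale:
  "p \<in> U \<Longrightarrow> v \<in> T p \<Longrightarrow> D p (tscale a v) Y = tscale a (D p v Y)"
  using affine_connection_axioms[THEN conjunct2, THEN conjunct1] by blast+

lemma cov_add:
  "vector_field M U Z \<Longrightarrow> p \<in> U \<Longrightarrow> v \<in> T p \<Longrightarrow>
     D p v (\<lambda>q. tadd (Y q) (Z q)) = tadd (D p v Y) (D p v Z)"
  using affine_connection_axioms[THEN conjunct2, THEN conjunct2, THEN conjunct1] by blast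

lemma cov_leibniz:
  "smooth_fun M U h \<Longrightarrow> p \<in> U \<Longrightarrow> v \<in> T p \<Longrightarrow>
     D p v (\<lambda>q. tscale (h q) (Y q)) = tadd (tscale (v h) (Y p)) (tscale (h p) (D p v Y))"
  using affine_connection_axioms[THEN conjunct2, THEN conjunct2, THEN conjunct2] by blast

end

text \<open>Multiplication by the indicator function of \<open>U\<close> is invisible to the derivative at a point of
  \<open>U\<close> but erases the values outside \<open>U\<close>.\<close>

lemma cov_cong:
  assumes U: "openin (topo M) U" and Y: "vector_field M U Y"
    and p: "p \<in> U" and v: "v \<in> T p" and eq: "\<And>q. q \<in> U \<Longrightarrow> Y q = Z q"
  shows "D p v Y = D p v Z"
proof -
  define a :: "'m \<Rightarrow> real" where "a = (\<lambda>q. if q \<in> U then 1 else 0)"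
  have a: "smooth_fun M U a"
    by (rule smooth_fun_cong[OF U _ smooth_fun_const[OF U, of 1]]) (simp add: a_def)
  have va: "v a = 0"
    using tangent_cong[OF v U p, of a "\<lambda>q. 1"] tangent_deriv_const[OF v] by (simp add: a_def)
  have ap: "a p = 1" using p by (simp add: a_def)
  have YD: "D p v (\<lambda>q. tscale (a q) (Y q)) = D p v Y"
    using cov_leibniz[OF U Y a p v] va ap by (simp add: tadd_def tscale_def)
  have Z: "vector_field M U Z" by (rule vector_field_cong[OF Y eq])
  have ZD: "D p v (\<lambda>q. tscale (a q) (Z q)) = D p v Z"
    using cov_leibniz[OF U Z a p v] va ap by (simp add: tadd_def tscale_def)
  have "(\<lambda>q. tscale (a q) (Y q)) = (\<lambda>q. tscale (a q) (Z q))"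
    using eq by (auto simp: a_def tscale_def)
  then show ?thesis using YD ZD by metis
qed

text \<open>The axioms yield tangency only for derivatives along fields, so \<open>v\<close> is
  extended with constant coefficients in a chart.\<close>

lemma cov_tangent:
  assumes U: "openin (topo M) U" and Y: "vector_field M U Y"
    and p: "p \<in> U" and v: "v \<in> T p"
  shows "D p v Y \<in> T p"
proof -
  obtain V \<phi> w where c: "(V, \<phi>) \<in> atlas M" "p \<in> V" and w: "v = chart_vector M V \<phi> p w"
    using tangent_chart_vector[OF v] .
  have o: "openin (topo M) (U \<inter> V)" using U chart_openin[OF c(1)] by blast
  have Y': "vector_field M (U \<inter> V) Y" by (rule vector_field_subset[OF Y]) blast
  have X: "vector_field M (U \<inter> V) (\<lambda>q. chart_vector M V \<phi> q w)"
    by (rule vector_field_subset[OF vector_field_chart[OF c(1)]]) blast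
  have "vector_field M (U \<inter> V) (\<lambda>q. D q (chart_vector M V \<phi> q w) Y)"
    by (rule cov_field[OF o Y' X])
  from vector_field_tangent[OF this, of p] show ?thesis using p c w by blast
qed

context
  fixes U :: "'m set" and Y :: "'m \<Rightarrow> 'm tvec"
  assumes U: "openin (topo M) U" and Y: "vector_field M U Y"
begin

lemma cov_zero_direction: "p \<in> U \<Longrightarrow> D p tzero Y = tzero"
proof -
  assume p: "p \<in> U"
  have z: "tzero \<in> T p" using p openin_points[OF U] tangent_zero by blast
  then show ?thesis using cov_direction_scale[OF U Y p z, of 0] by (simp add: tscale_def tzero_def)
qed

lemma cov_direction_sum:
  assumes p: "p \<in> U" and b: "\<And>i. i \<in> I \<Longrightarrow> b i \<in> T p"
  shows "D p (\<lambda>h. \<Sum>i\<in>I. a i * b i h) Y = (\<lambda>h. \<Sum>i\<in>I. a i * D p (b i) Y h)"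
  using b
proof (induction I rule: infinite_finite_induct)
  case (insert i I)
  have pM: "p \<in> points M" using p openin_points[OF U] by blast
  have eq: "(\<lambda>h. \<Sum>i\<in>insert i I. a i * b i h) = tadd (tscale (a i) (b i)) (\<lambda>h. \<Sum>i\<in>I. a i * b i h)"
    using insert.hyps by (simp add: tadd_def tscale_def)
  have t: "(\<lambda>h. \<Sum>i\<in>I. a i * b i h) \<in> T p" "tscale (a i) (b i) \<in> T p"
    using insert.prems by (auto intro: tangent_lincomb tangent_scale pM)
  show ?case
    unfolding eq cov_direction_add[OF U Y p t(2,1)]
    using insert cov_direction_scale[OF U Y p, of "b i" "a i"] by (simp add: tadd_def tscale_def)
qed (use cov_zero_direction[OF p] in \<open>simp_all add: tzero_def\<close>)

end

lemma cov_zero: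
  assumes U: "openin (topo M) U" and p: "p \<in> U" and v: "v \<in> T p"
  shows "D p v (\<lambda>q. tzero) = tzero"
proof -
  have z: "vector_field M U (\<lambda>q. tzero)" by (rule vector_field_zero[OF openin_points[OF U]])
  have "D p v (\<lambda>q. tscale 0 tzero) = tadd (tscale (v (\<lambda>q. 0)) tzero) (tscale 0 (D p v (\<lambda>q. tzero)))"
    by (rule cov_leibniz[OF U z smooth_fun_const[OF U] p v])
  then show ?thesis by (simp add: tscale_def tadd_def tzero_def)
qed

lemma cov_sum:
  assumes U: "openin (topo M) U" and p: "p \<in> U" and v: "v \<in> T p"
    and X: "\<And>i. i \<in> I \<Longrightarrow> vector_field M U (X i)" and a: "\<And>i. i \<in> I \<Longrightarrow> smooth_fun M U (a i)"
  shows "D p v (\<lambda>q h. \<Sum>i\<in>I. a i q * X i q h) = (\<lambda>h. \<Sum>i\<in>I. v (a i) * X i p h + a i p * D p v (X i) h)"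
  using X a
proof (induction I rule: infinite_finite_induct)
  case (insert i I)
  have eq: "(\<lambda>q h. \<Sum>i\<in>insert i I. a i q * X i q h) =
      (\<lambda>q. tadd (tscale (a i q) (X i q)) (\<lambda>h. \<Sum>i\<in>I. a i q * X i q h))"
    using insert.hyps by (simp add: tadd_def tscale_def)
  have f: "vector_field M U (\<lambda>q h. \<Sum>i\<in>I. a i q * X i q h)" "vector_field M U (\<lambda>q. tscale (a i q) (X i q))"
    using insert.prems by (auto intro!: vector_field_lincomb U vector_field_scale)
  show ?case
    unfolding eq cov_add[OF U f(2,1) p v]
    using insert cov_leibniz[OF U, of "X i" "a i" p v] p v by (simp add: tadd_def tscale_def)
qed (use cov_zero[OF U p v] in \<open>simp_all add: tzero_def\<close>)

lemma lie_bracket_eq: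
  assumes "openin (topo M) U" "vector_field M U X" "vector_field M U Y" "p \<in> U"
  shows "lie_bracket M X Y p = (\<lambda>h. D p (X p) Y h - D p (Y p) X h)"
  using torsion_free[OF assms] by (simp add: tadd_def)

text \<open>Torsion-freeness writes the bracket as a difference of covariant derivatives, so its
  tangency and smoothness are inherited and no computation in coordinates is made.\<close>

lemma lie_bracket_field:
  assumes U: "openin (topo M) U" and X: "vector_field M U X" and Y: "vector_field M U Y"
  shows "vector_field M U (lie_bracket M X Y)"
proof -
  have "vector_field M U (\<lambda>q. tadd (D q (X q) Y) (tscale (-1) (D q (Y q) X)))"
    using openin_points[OF U]
    by (intro vector_field_add vector_field_scale smooth_fun_const U cov_field X Y)
  then show ?thesis
    by (rule vector_field_cong) (simp add: lie_bracket_eq[OF U X Y] tadd_def tscale_def)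
qed

end

locale orthonormal_frame = riemannian4 M g for M :: "'m manifold" and g +
  fixes U :: "'m set" and E :: "4 \<Rightarrow> 'm \<Rightarrow> 'm tvec"
  assumes domain_open: "openin (topo M) U"
    and frame_field: "\<And>i. vector_field M U (E i)"
    and frame_orthonormal: "\<And>q. q \<in> U \<Longrightarrow> orthonormal_at q (\<lambda>i. E i q)"
begin

section \<open>Components of fields and of the connection in a frame\<close>

definition comp :: "('m \<Rightarrow> 'm tvec) \<Rightarrow> 4 \<Rightarrow> 'm \<Rightarrow> real" where
  "comp X i q = g q (X q) (E i q)"

lemma frame_tangent: "q \<in> U \<Longrightarrow> E i q \<in> T q"
  using vector_field_tangent[OF frame_field] .

lemma expand_tangent: "q \<in> U \<Longrightarrow> v \<in> T q \<Longrightarrow> v = lincomb (\<lambda>i. g q v (E i q)) (\<lambda>i. E i q)"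
  using frame_expansion[OF frame_orthonormal] .

lemma expand_apply: "q \<in> U \<Longrightarrow> v \<in> T q \<Longrightarrow> v h = (\<Oplus>i. g q v (E i q) * E i q h)"
  by (rule fun_cong[OF expand_tangent[unfolded lincomb_def]])

lemma metric_lincomb_E: "q \<in> U \<Longrightarrow> g q (lincomb a (\<lambda>i. E i q)) (E j q) = a j"
  using metric_lincomb_frame[OF frame_orthonormal] .

lemma lincomb_E_tangent: "q \<in> U \<Longrightarrow> lincomb a (\<lambda>i. E i q) \<in> T q"
  by (intro lincomb_tangent tangent_point[OF frame_tangent] frame_tangent)

lemma comp_smooth:
  "openin (topo M) W \<Longrightarrow> W \<subseteq> U \<Longrightarrow> vector_field M W X \<Longrightarrow> smooth_fun M W (comp X i)"
  unfolding comp_def by (rule metric_smooth[OF _ _ vector_field_subset[OF frame_field]])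

end

locale torsion_free_frame = orthonormal_frame M g U E + torsion_free4 M D
  for M :: "'m manifold" and g U E D
begin

definition conn :: "4 \<Rightarrow> 4 \<Rightarrow> 4 \<Rightarrow> 'm \<Rightarrow> real" where
  "conn j k l q = g q (D q (E j q) (E k)) (E l q)"

lemma conn_smooth: "smooth_fun M U (conn j k l)"
  unfolding conn_def by (rule metric_smooth[OF domain_open cov_field[OF domain_open frame_field frame_field] frame_field])

text \<open>The connection 1-form with indices \<open>k\<close>, \<open>l\<close>, evaluated on
  \<open>X\<close>.\<close>

definition conn_form :: "('m \<Rightarrow> 'm tvec) \<Rightarrow> 4 \<Rightarrow> 4 \<Rightarrow> 'm \<Rightarrow> real" where
  "conn_form X k l q = (\<Oplus>j. comp X j q * conn j k l q)"

lemma conn_form_smooth: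
  "openin (topo M) W \<Longrightarrow> W \<subseteq> U \<Longrightarrow> vector_field M W X \<Longrightarrow> smooth_fun M W (conn_form X k l)"
  unfolding conn_form_def
  by (intro smooth_intros comp_smooth smooth_fun_subset[OF conn_smooth])

lemma comp_cov_tangent:
  assumes W: "openin (topo M) W" "W \<subseteq> U" and Y: "vector_field M W Y" and q: "q \<in> W" and v: "v \<in> T q"
  shows "g q (D q v Y) (E l q) = v (comp Y l) +
    (\<Oplus>k. comp Y k q * (\<Oplus>j. g q v (E j q) * conn j k l q))"
proof -
  have qU: "q \<in> U" using q W by blast
  have EW: "vector_field M W (E i)" for i by (rule vector_field_subset[OF frame_field W(2)])
  \<comment> \<open>The frame expansion of \<open>Y\<close> is valid on \<open>W\<close> only, so
    locality in the form of \<open>cov_cong\<close> is what permits the replacement.\<close>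
  have "D q v Y = D q v (\<lambda>q h. \<Oplus>i. comp Y i q * E i q h)"
  proof (rule cov_cong[OF W(1) Y q v])
    fix r assume r: "r \<in> W"
    then have "r \<in> U" "Y r \<in> T r" using W vector_field_tangent[OF Y] by blast+
    from expand_tangent[OF this] show "Y r = (\<lambda>h. \<Oplus>i. comp Y i r * E i r h)"
      unfolding lincomb_def comp_def .
  qed
  also have "\<dots> = (\<lambda>h. \<Oplus>i. v (comp Y i) * E i q h + comp Y i q * D q v (E i) h)"
    by (rule cov_sum[OF W(1) q v EW comp_smooth[OF W Y]])
  also have "\<dots> = tadd (lincomb (\<lambda>i. v (comp Y i)) (\<lambda>i. E i q)) (lincomb (\<lambda>i. comp Y i q) (\<lambda>i. D q v (E i)))"
    by (simp add: tadd_def lincomb_def sum.distrib)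
  finally have DY: "D q v Y = \<dots>" .
  have DE: "D q v (E i) \<in> T q" for i by (rule cov_tangent[OF W(1) EW q v])
  have "g q (D q v (E k)) (E l q) = (\<Oplus>j. g q v (E j q) * conn j k l q)" for k
  proof -
    have "D q v (E k) = D q (lincomb (\<lambda>i. g q v (E i q)) (\<lambda>i. E i q)) (E k)"
      by (rule arg_cong[OF expand_tangent[OF qU v], of "\<lambda>x. D q x (E k)"])
    also have "\<dots> = lincomb (\<lambda>i. g q v (E i q)) (\<lambda>i. D q (E i q) (E k))"
      unfolding lincomb_def by (rule cov_direction_sum[OF W(1) EW q]) (rule frame_tangent[OF qU])
    finally show ?thesis
      using metric_lincomb_left[OF frame_tangent[OF qU] cov_tangent[OF W(1) EW q frame_tangent[OF qU]]]
      by (simp add: conn_def)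
  qed
  moreover have "lincomb (\<lambda>i. comp Y i q) (\<lambda>i. D q v (E i)) \<in> T q"
    by (rule lincomb_tangent[OF tangent_point[OF v] DE])
  ultimately show ?thesis
    unfolding DY
    by (simp add: metric_add_left[OF lincomb_E_tangent[OF qU] _ frame_tangent[OF qU]]
        metric_lincomb_E[OF qU] metric_lincomb_left[OF frame_tangent[OF qU] DE])
qed

lemma comp_cov:
  assumes W: "openin (topo M) W" "W \<subseteq> U" and X: "vector_field M W X" and Y: "vector_field M W Y"
    and q: "q \<in> W"
  shows "comp (\<lambda>q. D q (X q) Y) l q =
    X q (comp Y l) + (\<Oplus>k. comp Y k q * conn_form X k l q)"
  using comp_cov_tangent[OF W Y q vector_field_tangent[OF X q]]
  by (simp add: comp_def conn_form_def)

lemma comp_bracket: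
  assumes W: "openin (topo M) W" "W \<subseteq> U" and X: "vector_field M W X" and Y: "vector_field M W Y"
    and q: "q \<in> W"
  shows "comp (lie_bracket M X Y) l q = X q (comp Y l) - Y q (comp X l) +
    (\<Oplus>k. comp Y k q * conn_form X k l q) - (\<Oplus>k. comp X k q * conn_form Y k l q)"
proof -
  have qU: "q \<in> U" using W q by blast
  have B: "lie_bracket M X Y q \<in> T q" by (rule vector_field_tangent[OF lie_bracket_field[OF W(1) X Y] q])
  have YX: "D q (Y q) X \<in> T q" by (rule cov_tangent[OF W(1) X q vector_field_tangent[OF Y q]])
  have "comp (\<lambda>q. D q (X q) Y) l q = comp (\<lambda>q. D q (Y q) X) l q + comp (lie_bracket M X Y) l q"
    unfolding comp_def torsion_free[OF W(1) X Y q] by (rule metric_add_left[OF YX B frame_tangent[OF qU]])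
  then show ?thesis using comp_cov[OF W X Y q] comp_cov[OF W Y X q] by simp
qed

text \<open>The components of \<open>R(E\<^sub>i, E\<^sub>j) E\<^sub>k\<close>.\<close>

definition curv :: "4 \<Rightarrow> 4 \<Rightarrow> 4 \<Rightarrow> 4 \<Rightarrow> 'm \<Rightarrow> real" where
  "curv i j k l q = - E i q (conn j k l) + E j q (conn i k l)
     + (\<Oplus>m. (conn i j m q - conn j i m q) * conn m k l q)
     - (\<Oplus>m. conn j k m q * conn i m l q - conn i k m q * conn j m l q)"

lemma comp_cov_cov:
  assumes W: "openin (topo M) W" "W \<subseteq> U" and X: "vector_field M W X" and Y: "vector_field M W Y"
    and Z: "vector_field M W Z" and q: "q \<in> W"
  shows "comp (\<lambda>q. D q (X q) (\<lambda>q. D q (Y q) Z)) l q =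
    X q (\<lambda>r. Y r (comp Z l)) + (\<Oplus>k. X q (comp Z k) * conn_form Y k l q + comp Z k q * X q (conn_form Y k l))
    + (\<Oplus>k. (Y q (comp Z k)) * conn_form X k l q)
    + (\<Oplus>k. comp Z k q * (\<Oplus>m. conn_form Y k m q * conn_form X m l q))"
proof -
  have XT: "X q \<in> T q" by (rule vector_field_tangent[OF X q])
  have sm: "smooth_near M q (comp Z k)" "smooth_near M q (conn_form Y k l)" 
    "smooth_near M q (\<lambda>r. Y r (comp Z k))" for k l
    using smooth_nearI[OF W(1) q] comp_smooth[OF W Z] conn_form_smooth[OF W Y]
      vector_field_smooth[OF Y W(1) subset_refl comp_smooth[OF W Z]] by blast+
  have qM: "q \<in> points M" by (rule tangent_point[OF XT])
  have 1: "comp (\<lambda>q. D q (X q) (\<lambda>q. D q (Y q) Z)) l q = X q (comp (\<lambda>q. D q (Y q) Z) l)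
     + (\<Oplus>m. comp (\<lambda>q. D q (Y q) Z) m q * conn_form X m l q)"
    by (rule comp_cov[OF W X cov_field[OF W(1) Z Y] q])
  have "X q (comp (\<lambda>q. D q (Y q) Z) l) =
     X q (\<lambda>r. Y r (comp Z l) + (\<Oplus>k. comp Z k r * conn_form Y k l r))"
    by (rule tangent_cong[OF XT W(1) q]) (rule comp_cov[OF W Y Z])
  also have "\<dots> = X q (\<lambda>r. Y r (comp Z l)) +
      (\<Oplus>k. X q (comp Z k) * conn_form Y k l q + comp Z k q * X q (conn_form Y k l))"
    using sm qM
    by (simp add: tangent_deriv_add[OF XT] tangent_deriv_sum[OF XT] tangent_deriv_mult[OF XT]
        smooth_near_sum smooth_near_mult)
  finally have 2: "X q (comp (\<lambda>q. D q (Y q) Z) l) = X q (\<lambda>r. Y r (comp Z l)) +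
      (\<Oplus>k. X q (comp Z k) * conn_form Y k l q + comp Z k q * X q (conn_form Y k l))" .
  have 3: "(\<Oplus>m. comp (\<lambda>q. D q (Y q) Z) m q * conn_form X m l q) =
      (\<Oplus>m. Y q (comp Z m) * conn_form X m l q)
      + (\<Oplus>m k. comp Z k q * conn_form Y k m q * conn_form X m l q)"
    by (simp add: comp_cov[OF W Y Z q] distrib_right sum.distrib sum_distrib_right)
  have 4: "(\<Oplus>m k. comp Z k q * conn_form Y k m q * conn_form X m l q) =
      (\<Oplus>k. comp Z k q * (\<Oplus>m. conn_form Y k m q * conn_form X m l q))"
    unfolding sum_distrib_left by (subst sum.swap) (simp add: mult.assoc)
  show ?thesis unfolding 1 2 3 4 by (simp only: add.assoc)
qed

lemma deriv_conn_form:
  assumes W: "openin (topo M) W" "W \<subseteq> U" and X: "vector_field M W X" and Y: "vector_field M W Y"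
    and q: "q \<in> W"
  shows "X q (conn_form Y k l) = (\<Oplus>j. X q (comp Y j) * conn j k l q)
    + (\<Oplus>i j. comp X i q * comp Y j q * E i q (conn j k l))"
proof -
  have XT: "X q \<in> T q" by (rule vector_field_tangent[OF X q])
  have qU: "q \<in> U" using W q by blast
  have sm: "smooth_near M q (comp Y j)" "smooth_near M q (conn j k l)" for j k l
    using smooth_nearI[OF W(1) q] comp_smooth[OF W Y] smooth_fun_subset[OF conn_smooth W(2)] by blast+
  have 1: "X q (conn_form Y k l) = (\<Oplus>j. X q (comp Y j) * conn j k l q) + (\<Oplus>j. comp Y j q * X q (conn j k l))"
    unfolding conn_form_def using sm
    by (simp add: tangent_deriv_sum[OF XT] tangent_deriv_mult[OF XT] smooth_near_mult sum.distrib)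
  have "(\<Oplus>j. comp Y j q * X q (conn j k l)) =
      (\<Oplus>j i. comp X i q * comp Y j q * E i q (conn j k l))"
    unfolding expand_apply[OF qU XT, of "conn _ k l"] comp_def[of X]
    by (simp add: sum_distrib_left mult.commute mult.left_commute)
  also have "\<dots> = (\<Oplus>i j. comp X i q * comp Y j q * E i q (conn j k l))"
    by (rule sum.swap)
  finally show ?thesis unfolding 1 by simp
qed

text \<open>Cartan's second structure equation in the present sign convention. The derivatives of
  the components of \<open>X\<close> and \<open>Y\<close> cancel against those in the bracket, which
  leaves an expression in their values at \<open>q\<close>.\<close>

lemma curvature_two_form:
  assumes W: "openin (topo M) W" "W \<subseteq> U" and X: "vector_field M W X" and Y: "vector_field M W Y"
    and q: "q \<in> W"
  shows "- X q (conn_form Y k l) + Y q (conn_form X k l) + conn_form (lie_bracket M X Y) k l q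
     - (\<Oplus>m. conn_form Y k m q * conn_form X m l q) + (\<Oplus>m. conn_form X k m q * conn_form Y m l q)
    = (\<Oplus>i j. comp X i q * comp Y j q * curv i j k l q)"
proof -
  \<comment> \<open>Torsion-freeness expresses the components of the bracket by derivatives of
    components and connection coefficients.\<close>
  have br: "conn_form (lie_bracket M X Y) k l q =
      (\<Oplus>j. X q (comp Y j) * conn j k l q) - (\<Oplus>j. Y q (comp X j) * conn j k l q)
     + (\<Oplus>i j. comp X i q * comp Y j q * (\<Oplus>m. (conn i j m q - conn j i m q) * conn m k l q))"
  proof -
    have 1: "(\<Oplus>k. comp Y k q * conn_form X k m q) =
        (\<Oplus>i j. comp X i q * comp Y j q * conn i j m q)" for m
      unfolding conn_form_def sum_distrib_left by (subst sum.swap) (simp add: mult_ac)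
    have 2: "(\<Oplus>k. comp X k q * conn_form Y k m q) =
        (\<Oplus>i j. comp X i q * comp Y j q * conn j i m q)" for m
      unfolding conn_form_def sum_distrib_left by (simp add: mult_ac)
    let ?S = "\<lambda>m. \<Oplus>i j. comp X i q * comp Y j q * (conn i j m q - conn j i m q)"
    have 3: "comp (lie_bracket M X Y) m q = X q (comp Y m) - Y q (comp X m) + ?S m" for m
      unfolding comp_bracket[OF W X Y q] 1 2 by (simp add: right_diff_distrib sum_subtractf)
    have "conn_form (lie_bracket M X Y) k l q =
        (\<Oplus>m. (X q (comp Y m) - Y q (comp X m) + ?S m) * conn m k l q)"
      unfolding conn_form_def 3 ..
    also have "\<dots> = (\<Oplus>j. X q (comp Y j) * conn j k l q) - (\<Oplus>j. Y q (comp X j) * conn j k l q)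
        + (\<Oplus>m. ?S m * conn m k l q)"
      by (simp only: distrib_right left_diff_distrib sum.distrib sum_subtractf)
    also have "(\<Oplus>m. ?S m * conn m k l q) = (\<Oplus>i j. comp X i q * comp Y j q *
        (\<Oplus>m. (conn i j m q - conn j i m q) * conn m k l q))"
      by (rule sum_contract)
    finally show ?thesis .
  qed
  have sw: "(\<Oplus>i j. comp Y i q * comp X j q * E i q (conn j k l))
     = (\<Oplus>i j. comp X i q * comp Y j q * E j q (conn i k l))"
    by (subst sum.swap) (simp add: mult.commute)
  have q1: "(\<Oplus>m. conn_form Y k m q * conn_form X m l q) =
    (\<Oplus>i j. comp X i q * comp Y j q * (\<Oplus>m. conn j k m q * conn i m l q))"
    unfolding conn_form_def by (rule sum_bilinear)
  have q2: "(\<Oplus>m. conn_form X k m q * conn_form Y m l q) =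
    (\<Oplus>i j. comp X i q * comp Y j q * (\<Oplus>m. conn i k m q * conn j m l q))"
  proof -
    have "(\<Oplus>m. conn_form X k m q * conn_form Y m l q) = (\<Oplus>m. conn_form Y m l q * conn_form X k m q)"
      by (intro sum.cong refl mult.commute)
    also have "\<dots> = (\<Oplus>i j. comp X i q * comp Y j q * (\<Oplus>m. conn j m l q * conn i k m q))"
      unfolding conn_form_def by (rule sum_bilinear)
    also have "\<dots> = (\<Oplus>i j. comp X i q * comp Y j q * (\<Oplus>m. conn i k m q * conn j m l q))"
      by (intro sum.cong refl arg_cong2[where f = "(*)"] mult.commute)
    finally show ?thesis .
  qed
  show ?thesis
    unfolding deriv_conn_form[OF W X Y q] deriv_conn_form[OF W Y X q] br sw q1 q2 curv_def sum_subtractf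
    by (rule sum_cancel_two_form)
qed

text \<open>Tensoriality in all three arguments: the right-hand side depends on the fields only
  through their values at \<open>q\<close>.\<close>

lemma comp_curvature_op:
  assumes W: "openin (topo M) W" "W \<subseteq> U" and X: "vector_field M W X" and Y: "vector_field M W Y"
    and Z: "vector_field M W Z" and q: "q \<in> W"
  shows "curvature_op M D X Y Z q \<in> T q"
    and "comp (curvature_op M D X Y Z) l q =
      (\<Oplus>k. comp Z k q * (\<Oplus>i j. comp X i q * comp Y j q * curv i j k l q))"
proof -
  have qU: "q \<in> U" and qM: "q \<in> points M" using W q openin_points by blast+
  let ?A = "D q (X q) (\<lambda>q. D q (Y q) Z)" and ?B = "D q (Y q) (\<lambda>q. D q (X q) Z)"
    and ?C = "D q (lie_bracket M X Y q) Z"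
  have XT: "X q \<in> T q" and YT: "Y q \<in> T q" using vector_field_tangent X Y q by blast+
  have BT: "lie_bracket M X Y q \<in> T q" by (rule vector_field_tangent[OF lie_bracket_field[OF W(1) X Y] q])
  have A: "?A \<in> T q" by (rule cov_tangent[OF W(1) cov_field[OF W(1) Z Y] q XT])
  have B: "?B \<in> T q" by (rule cov_tangent[OF W(1) cov_field[OF W(1) Z X] q YT])
  have C: "?C \<in> T q" by (rule cov_tangent[OF W(1) Z q BT])
  have eq: "curvature_op M D X Y Z q = tadd (tscale (-1) ?A) (tadd ?B ?C)"
    by (rule ext) (simp add: curvature_op_def tadd_def tscale_def)
  show "curvature_op M D X Y Z q \<in> T q"
    unfolding eq by (intro tangent_add tangent_scale qM A B C)
  have sm: "smooth_near M q (comp Z l)"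
    using smooth_nearI[OF W(1) q comp_smooth[OF W Z]] .
  have 1: "comp (curvature_op M D X Y Z) l q = - comp (\<lambda>q. D q (X q) (\<lambda>q. D q (Y q) Z)) l q
     + comp (\<lambda>q. D q (Y q) (\<lambda>q. D q (X q) Z)) l q + comp (\<lambda>q. D q (lie_bracket M X Y q) Z) l q"
    unfolding comp_def eq
      metric_add_left[OF tangent_scale[OF qM A] tangent_add[OF qM B C] frame_tangent[OF qU]]
      metric_add_left[OF B C frame_tangent[OF qU]] metric_scale_left[OF A frame_tangent[OF qU]]
    by simp
  have 2: "comp (\<lambda>q. D q (lie_bracket M X Y q) Z) l q =
     X q (\<lambda>r. Y r (comp Z l)) - Y q (\<lambda>r. X r (comp Z l)) + (\<Oplus>k. comp Z k q * conn_form (lie_bracket M X Y) k l q)"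
    using comp_cov[OF W lie_bracket_field[OF W(1) X Y] Z q] sm by (simp add: lie_bracket_def)
  have "comp (curvature_op M D X Y Z) l q =
      (\<Oplus>k. comp Z k q * (- X q (conn_form Y k l) + Y q (conn_form X k l) + conn_form (lie_bracket M X Y) k l q
     - (\<Oplus>m. conn_form Y k m q * conn_form X m l q) + (\<Oplus>m. conn_form X k m q * conn_form Y m l q)))"
    unfolding 1 2 comp_cov_cov[OF W X Y Z q] comp_cov_cov[OF W Y X Z q] by (rule sum_cancel)
  then show "comp (curvature_op M D X Y Z) l q =
      (\<Oplus>k. comp Z k q * (\<Oplus>i j. comp X i q * comp Y j q * curv i j k l q))"
    unfolding curvature_two_form[OF W X Y q] .
qed

text \<open>By tensoriality all extensions of \<open>u\<close>, \<open>v\<close>, \<open>w\<close>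
  give the same value, which justifies the \<open>common_value\<close> in the definition.\<close>

lemma curvature_frame:
  assumes q: "q \<in> U" and u: "u \<in> T q" and v: "v \<in> T q" and w: "w \<in> T q"
  shows "curvature M D q u v w = lincomb (\<lambda>l. \<Oplus>k. g q w (E k q) *
    (\<Oplus>i j. g q u (E i q) * g q v (E j q) * curv i j k l q)) (\<lambda>l. E l q)"
proof -
  have op: "curvature_op M D X Y Z q = lincomb (\<lambda>l. \<Oplus>k. g q w (E k q) *
      (\<Oplus>i j. g q u (E i q) * g q v (E j q) * curv i j k l q)) (\<lambda>l. E l q)"
    if W: "openin (topo M) W" "q \<in> W" and X: "vector_field M W X" "vector_field M W Y" "vector_field M W Z"
      and eq: "X q = u" "Y q = v" "Z q = w" for W X Y Z
  proof -
    \<comment> \<open>An extension lives on its own \<open>W\<close>; it is compared with the frame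
      on the intersection with \<open>U\<close>.\<close>
    have W': "openin (topo M) (W \<inter> U)" "W \<inter> U \<subseteq> U" "q \<in> W \<inter> U" using W q domain_open by auto
    have X': "vector_field M (W \<inter> U) X" "vector_field M (W \<inter> U) Y" "vector_field M (W \<inter> U) Z"
      using X vector_field_subset by blast+
    show ?thesis
    proof (rule tangent_eqI[OF frame_orthonormal[OF q] comp_curvature_op(1)[OF W'(1,2) X' W'(3)] lincomb_E_tangent[OF q]])
      fix l
      show "g q (curvature_op M D X Y Z q) (E l q) = g q (lincomb (\<lambda>l. \<Oplus>k. g q w (E k q) *
        (\<Oplus>i j. g q u (E i q) * g q v (E j q) * curv i j k l q)) (\<lambda>l. E l q)) (E l q)"
        unfolding metric_lincomb_E[OF q]
        using comp_curvature_op(2)[OF W'(1,2) X' W'(3), of l] by (simp add: comp_def eq)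
    qed
  qed
  \<comment> \<open>Constant coefficients in the frame provide the extension that
    \<open>common_valueI\<close> asks for.\<close>
  have ext: "\<exists>X. vector_field M U X \<and> X q = u" if u: "u \<in> T q" for u
  proof (intro exI conjI)
    show "vector_field M U (\<lambda>r h. \<Oplus>i. g q u (E i q) * E i r h)"
      by (intro vector_field_lincomb domain_open smooth_fun_const frame_field)
    show "(\<lambda>h. \<Oplus>i. g q u (E i q) * E i q h) = u"
      using expand_tangent[OF q u] unfolding lincomb_def by (rule sym)
  qed
  obtain X Y Z where XYZ: "vector_field M U X" "X q = u" "vector_field M U Y" "Y q = v"
    "vector_field M U Z" "Z q = w"
    using ext[OF u] ext[OF v] ext[OF w] by blast
  show ?thesis
    unfolding curvature_def
    by (rule common_valueI[where x = "(X, Y, Z)"]) (use XYZ domain_open q op in auto)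
qed

end

section \<open>Frames that are parallel at a point\<close>

context manifold4
begin

text \<open>Yields the neighbourhood on which the Gram-Schmidt process may divide by a norm.\<close>

lemma smooth_fun_open_positive:
  assumes U: "openin (topo M) U" and h: "smooth_fun M U h"
  shows "openin (topo M) {q \<in> U. h q > 0}"
proof (subst openin_subopen, intro ballI)
  fix p assume p: "p \<in> {q \<in> U. h q > 0}"
  then have "p \<in> points M" using openin_points[OF U] by blast
  then obtain V \<phi> where c: "(V, \<phi>) \<in> atlas M" "p \<in> V" by (rule chart_at)
  let ?A = "\<phi> ` (U \<inter> V)"
  have "smooth_on ?A (h \<circ> inv_into V \<phi>)" by (rule smooth_funD[OF h c(1)])
  then have "continuous_on ?A (h \<circ> inv_into V \<phi>)" unfolding smooth_on_def by (metis Ck_on.simps(1))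
  then have "open (?A \<inter> (h \<circ> inv_into V \<phi>) -` {0<..})"
    using chart_open_image[OF c(1) U] continuous_on_open_vimage open_greaterThan
    by (metis inf_commute)
  then have o: "openin (topo M) {q \<in> V. \<phi> q \<in> ?A \<inter> (h \<circ> inv_into V \<phi>) -` {0<..}}"
    by (rule chart_open_preimage[OF c(1)])
  have AU: "q \<in> U" if "q \<in> V" "\<phi> q \<in> ?A" for q
    using that chart_inj[OF c(1)] by (auto simp: inj_on_def)
  have "{q \<in> V. \<phi> q \<in> ?A \<inter> (h \<circ> inv_into V \<phi>) -` {0<..}} \<subseteq> {q \<in> U. h q > 0}"
  proof
    fix q assume "q \<in> {q \<in> V. \<phi> q \<in> ?A \<inter> (h \<circ> inv_into V \<phi>) -` {0<..}}"
    then have "q \<in> V" "\<phi> q \<in> ?A" "(h \<circ> inv_into V \<phi>) (\<phi> q) > 0" by blast+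
    then show "q \<in> {q \<in> U. h q > 0}" using AU[of q] chart_inv[OF c(1), of q] by simp
  qed
  moreover have "p \<in> {q \<in> V. \<phi> q \<in> ?A \<inter> (h \<circ> inv_into V \<phi>) -` {0<..}}"
    using p c chart_inv[OF c(1)] by auto
  ultimately show "\<exists>S. openin (topo M) S \<and> p \<in> S \<and> S \<subseteq> {q \<in> U. h q > 0}"
    using o by blast
qed

lemma tangent_extension:
  assumes "v \<in> T p" "openin (topo M) U" "p \<in> U"
  obtains W X where "openin (topo M) W" "W \<subseteq> U" "p \<in> W" "vector_field M W X" "X p = v"
proof -
  obtain V \<phi> w where c: "(V, \<phi>) \<in> atlas M" "p \<in> V" and w: "v = chart_vector M V \<phi> p w"
    using tangent_chart_vector[OF assms(1)] .
  show ?thesis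
    by (rule that[of "U \<inter> V" "\<lambda>q. chart_vector M V \<phi> q w"])
      (use assms c w chart_openin[OF c(1)] in \<open>auto intro: vector_field_subset[OF vector_field_chart[OF c(1)]]\<close>)
qed

lemma chart_vector_axis_sum:
  assumes c: "(V, \<phi>) \<in> atlas M" "p \<in> V"
  shows "chart_vector M V \<phi> p w = (\<lambda>h. \<Oplus>j. w $ j * chart_vector M V \<phi> p (axis j 1) h)"
proof
  fix h
  show "chart_vector M V \<phi> p w h = (\<Oplus>j. w $ j * chart_vector M V \<phi> p (axis j 1) h)"
  proof (cases "smooth_near M p h")
    case True
    let ?F = "frechet_derivative (h \<circ> inv_into V \<phi>) (at (\<phi> p))"
    interpret F: bounded_linear ?F
      by (rule has_derivative_bounded_linear[OF smooth_near_has_derivative[OF c True]])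
    have "?F w = ?F (\<Oplus>j. w $ j *\<^sub>R axis j 1)"
      by (simp add: basis_expansion scalar_mult_eq_scaleR[symmetric])
    also have "\<dots> = (\<Oplus>j. w $ j * ?F (axis j 1))"
      by (simp add: F.sum F.scaleR)
    finally show ?thesis using True by (simp add: chart_vector_def)
  qed (simp add: chart_vector_def)
qed

text \<open>The two determinants differ by the Jacobian determinant of the transition map, which is
  positive for an oriented atlas; one chart therefore decides the orientation.\<close>

lemma orientation_chart_independent:
  fixes e :: "4 \<Rightarrow> 'm tvec"
  assumes e: "\<And>i. e i \<in> T p"
    and c: "(V, \<phi>) \<in> atlas M" "p \<in> V" and d: "(W, \<psi>) \<in> atlas M" "p \<in> W"
    and pos: "det (\<chi> i j. e i (\<lambda>q. \<phi> q $ j)) > 0"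
  shows "det (\<chi> i j. e i (\<lambda>q. \<psi> q $ j)) > 0"
proof -
  have "\<forall>i. \<exists>w. e i = chart_vector M V \<phi> p w" using e unfolding tangent_space_chart[OF c] by blast
  then obtain w where w: "\<And>i. e i = chart_vector M V \<phi> p (w i)" by metis
  let ?L = "frechet_derivative (\<psi> \<circ> inv_into V \<phi>) (at (\<phi> p))"
  have L: "linear ?L"
    using transition_has_derivative[OF c d] has_derivative_bounded_linear bounded_linear.linear by blast
  have "e i (\<lambda>q. \<psi> q $ j) = (\<Oplus>k. w i $ k * matrix ?L $ j $ k)" for i j
  proof -
    have "e i (\<lambda>q. \<psi> q $ j) = ?L (w i) $ j"
      unfolding w chart_vector_change[OF c d] by (rule chart_vector_coordinate[OF d])
    also have "?L (w i) = matrix ?L *v w i" by (simp add: matrix_works L[unfolded linear_def] L)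
    finally show ?thesis by (simp add: matrix_vector_mult_def mult.commute)
  qed
  moreover have "e i (\<lambda>q. \<phi> q $ j) = w i $ j" for i j
    unfolding w by (rule chart_vector_coordinate[OF c])
  ultimately have "(\<chi> i j. e i (\<lambda>q. \<psi> q $ j)) = (\<chi> i j. e i (\<lambda>q. \<phi> q $ j)) ** transpose (matrix ?L)"
    by (simp add: matrix_matrix_mult_def transpose_def vec_eq_iff)
  then have "det (\<chi> i j. e i (\<lambda>q. \<psi> q $ j)) = det (\<chi> i j. e i (\<lambda>q. \<phi> q $ j)) * det (matrix ?L)"
    by (simp add: det_mul)
  moreover have "det (matrix ?L) > 0" by (rule transition_det[OF c(1) d(1)]) (use c d in blast)
  ultimately show ?thesis using pos by simp
qed

end

context torsion_free4
begin

text \<open>Start from the field with constant coefficients in a chart and subtract its first-order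
  covariant derivative at \<open>p\<close>, with coordinate differences as coefficients.\<close>

lemma parallel_extension:
  assumes u: "u \<in> T p"
  obtains V F where "openin (topo M) V" "p \<in> V" "vector_field M V F" "F p = u"
    "\<And>v. v \<in> T p \<Longrightarrow> D p v F = tzero"
proof -
  obtain V \<phi> w where c: "(V, \<phi>) \<in> atlas M" "p \<in> V" and w: "u = chart_vector M V \<phi> p w"
    using tangent_chart_vector[OF u] .
  have V: "openin (topo M) V" by (rule chart_openin[OF c(1)])
  let ?c = "\<lambda>w q. chart_vector M V \<phi> q w"
  have cT: "?c w p \<in> T p" for w using tangent_space_chart[OF c] by blast
  have vc: "vector_field M V (?c w)" for w by (rule vector_field_chart[OF c(1)])
  have "\<exists>b. D p (?c (axis j 1) p) (?c w) = ?c b p" for j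
    using cov_tangent[OF V vc c(2) cT] unfolding tangent_space_chart[OF c] by blast
  then obtain b where b: "\<And>j. D p (?c (axis j 1) p) (?c w) = ?c (b j) p" by metis
  \<comment> \<open>These coefficients vanish at \<open>p\<close>, so the value there is kept, while
    their derivatives are minus the components of the direction, so the covariant derivative is
    cancelled.\<close>
  let ?a = "\<lambda>j q. \<phi> p $ j - \<phi> q $ j"
  let ?G = "\<lambda>q h. \<Oplus>j. ?a j q * ?c (b j) q h"
  have a: "smooth_fun M V (?a j)" for j
    by (intro smooth_intros V chart_coordinate_smooth[OF c(1)])
  have G: "vector_field M V ?G" by (intro vector_field_lincomb V a vc)
  have "D p v (\<lambda>q. tadd (?c w q) (?G q)) = tzero" if v: "v \<in> T p" for v
  proof -
    obtain v' where v': "v = ?c v' p" using v unfolding tangent_space_chart[OF c] by blast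
    have va: "v (?a j) = - v' $ j" for j
      using tangent_deriv_diff[OF v smooth_near_const[OF tangent_point[OF v]] chart_coordinate_near[OF c]]
        tangent_deriv_const[OF v] chart_vector_coordinate[OF c, of v' j] v' by simp
    have "D p v ?G = (\<lambda>h. \<Oplus>j. v (?a j) * ?c (b j) p h + ?a j p * D p v (?c (b j)) h)"
      by (rule cov_sum[OF V c(2) v vc a])
    then have 1: "D p v ?G = (\<lambda>h. - (\<Oplus>j. v' $ j * ?c (b j) p h))"
      by (simp add: va sum_negf)
    have "D p v (?c w) = D p (\<lambda>h. \<Oplus>j. v' $ j * ?c (axis j 1) p h) (?c w)"
      unfolding v' by (rule arg_cong[OF chart_vector_axis_sum[OF c], of "\<lambda>x. D p x (?c w)"])
    also have "\<dots> = (\<lambda>h. \<Oplus>j. v' $ j * D p (?c (axis j 1) p) (?c w) h)"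
      by (rule cov_direction_sum[OF V vc c(2) cT])
    finally have 2: "D p v (?c w) = (\<lambda>h. \<Oplus>j. v' $ j * ?c (b j) p h)" unfolding b .
    show ?thesis unfolding cov_add[OF V vc G c(2) v] 1 2 by (simp add: tadd_def tzero_def)
  qed
  moreover have "tadd (?c w p) (?G p) = u" by (simp add: tadd_def w)
  ultimately show ?thesis using that[OF V c(2) vector_field_add[OF vc G]] by blast
qed

end

locale levi_civita4 = riemannian4 M g + torsion_free4 M D for M :: "'m manifold" and g D +
  assumes metric_connection: "\<And>U X Y Z p. openin (topo M) U \<Longrightarrow> vector_field M U X \<Longrightarrow>
    vector_field M U Y \<Longrightarrow> vector_field M U Z \<Longrightarrow> p \<in> U \<Longrightarrow>
    X p (\<lambda>q. g q (Y q) (Z q)) = g p (D p (X p) Y) (Z p) + g p (Y p) (D p (X p) Z)"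
begin

lemma metric_derivative:
  assumes U: "openin (topo M) U" and Y: "vector_field M U Y" and Z: "vector_field M U Z"
    and p: "p \<in> U" and v: "v \<in> T p"
  shows "v (\<lambda>q. g q (Y q) (Z q)) = g p (D p v Y) (Z p) + g p (Y p) (D p v Z)"
proof -
  obtain W X where W: "openin (topo M) W" "W \<subseteq> U" "p \<in> W" "vector_field M W X" "X p = v"
    using tangent_extension[OF v U p] .
  show ?thesis
    using metric_connection[OF W(1,4) vector_field_subset[OF Y W(2)] vector_field_subset[OF Z W(2)] W(3)] W(5)
    by simp
qed

text \<open>Gram-Schmidt process, one field at a time; each new field is orthogonalised from an extension
  that is parallel at \<open>p\<close>, and remains parallel at \<open>p\<close>.\<close>

lemma orthonormal_fields_exist:
  assumes p: "p \<in> points M"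
  shows "\<exists>U E. openin (topo M) U \<and> p \<in> U \<and> (\<forall>i\<in>I. vector_field M U (E i)) \<and>
    (\<forall>i\<in>I. \<forall>v\<in>T p. D p v (E i) = tzero) \<and>
    (\<forall>q\<in>U. \<forall>i\<in>I. \<forall>j\<in>I. g q (E i q) (E j q) = (if (i::4) = j then 1 else 0))"
    (is "\<exists>U E. ?P I U E")
proof (induction I rule: infinite_finite_induct)
  case (infinite I)
  then show ?case by simp
next
  case empty
  show ?case using p unfolding points_def by auto
next
  case (insert k I)
  obtain U E where UE: "?P I U E"
    using insert.IH by (elim exE)
  have U: "openin (topo M) U" "p \<in> U" and E: "\<And>i. i \<in> I \<Longrightarrow> vector_field M U (E i)"
    and par: "\<And>i v. i \<in> I \<Longrightarrow> v \<in> T p \<Longrightarrow> D p v (E i) = tzero"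
    and on: "\<And>q i j. q \<in> U \<Longrightarrow> i \<in> I \<Longrightarrow> j \<in> I \<Longrightarrow> g q (E i q) (E j q) = (if i = j then 1 else 0)"
    using UE by blast+
  have Ep: "E i p \<in> T p" if "i \<in> I" for i using vector_field_tangent[OF E[OF that] U(2)] .
  \<comment> \<open>The new index \<open>k\<close> is still free, which leaves room for one more
    orthogonal direction.\<close>
  have "I \<noteq> UNIV" using insert.hyps(2) by blast
  then obtain u where u: "u \<in> T p" "u \<noteq> tzero" "\<And>i. i \<in> I \<Longrightarrow> g p u (E i p) = 0"
    using orthogonal_vector_exists[OF p, of I "\<lambda>i. E i p"] Ep by blast
  obtain V F where V: "openin (topo M) V" "p \<in> V" and F: "vector_field M V F" "F p = u"
    and parF: "\<And>v. v \<in> T p \<Longrightarrow> D p v F = tzero"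
    using parallel_extension[OF u(1)] by metis
  define W where "W = U \<inter> V"
  have W: "openin (topo M) W" "p \<in> W" "W \<subseteq> U" "W \<subseteq> V" using U V by (auto simp: W_def)
  have FW: "vector_field M W F" by (rule vector_field_subset[OF F(1) W(4)])
  have EW: "vector_field M W (E i)" if "i \<in> I" for i by (rule vector_field_subset[OF E[OF that] W(3)])
  have z0: "g p tzero x = 0" "g p x tzero = 0" if "x \<in> T p" for x
    using that metric_zero_left metric_commute tangent_zero[OF p] by metis+
  let ?a = "\<lambda>i q. - g q (F q) (E i q)"
  let ?S = "\<lambda>q h. \<Sum>i\<in>I. ?a i q * E i q h"
  define G where "G = (\<lambda>q. tadd (F q) (?S q))"
  have a: "smooth_fun M W (?a i)" if "i \<in> I" for i
    by (intro smooth_fun_uminus metric_smooth W FW EW that)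
  have S: "vector_field M W ?S" by (intro vector_field_lincomb W a EW)
  have G: "vector_field M W G" unfolding G_def by (intro vector_field_add FW S)
  have Gp: "G p = u" using u(3) F(2) by (simp add: G_def tadd_def)
  have parG: "D p v G = tzero" if v: "v \<in> T p" for v
  proof -
    \<comment> \<open>Both \<open>F\<close> and \<open>E i\<close> are parallel at \<open>p\<close>,
      so by metric compatibility their inner product has zero derivative there; subtracting the
      projections keeps the field parallel at \<open>p\<close>.\<close>
    have va: "v (?a i) = 0" if i: "i \<in> I" for i
    proof -
      have "v (?a i) = - v (\<lambda>q. g q (F q) (E i q))"
        by (rule tangent_deriv_uminus[OF v smooth_nearI[OF W(1,2) metric_smooth[OF W(1) FW EW[OF i]]]])
      also have "\<dots> = 0"
        using metric_derivative[OF W(1) FW EW[OF i] W(2) v] parF[OF v] par[OF i v] z0 Ep[OF i] u(1) F(2)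
        by simp
      finally show ?thesis .
    qed
    have "D p v ?S = (\<lambda>h. \<Sum>i\<in>I. v (?a i) * E i p h + ?a i p * D p v (E i) h)"
      by (rule cov_sum[OF W(1,2) v EW a])
    also have "\<dots> = tzero" using va par[OF _ v] by (simp add: tzero_def)
    finally show ?thesis
      unfolding G_def cov_add[OF W(1) FW S W(2) v] parF[OF v] by (simp add: tadd_def tzero_def)
  qed
  have orth: "g q (G q) (E i q) = 0" if q: "q \<in> W" and i: "i \<in> I" for q i
  proof -
    have qT: "E j q \<in> T q" if "j \<in> I" for j using vector_field_tangent[OF EW[OF that] q] .
    have "g q (G q) (E i q) = g q (F q) (E i q) + g q (?S q) (E i q)"
      unfolding G_def
      by (rule metric_add_left[OF vector_field_tangent[OF FW q] vector_field_tangent[OF S q] qT[OF i]])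
    also have "g q (?S q) (E i q) = (\<Sum>j\<in>I. ?a j q * g q (E j q) (E i q))"
      by (rule metric_sum_left[OF qT[OF i] qT])
    also have "\<dots> = (\<Sum>j\<in>I. if j = i then ?a i q else 0)"
      by (rule sum.cong) (use on i q W in auto)
    also have "\<dots> = ?a i q" using i insert.hyps(1) by simp
    finally show ?thesis by simp
  qed
  define n where "n = (\<lambda>q. g q (G q) (G q))"
  have n: "smooth_fun M W n" unfolding n_def by (rule metric_smooth[OF W(1) G G])
  \<comment> \<open>The squared norm \<open>n\<close> is positive at \<open>p\<close>, where
    \<open>G\<close> has the nonzero value \<open>u\<close>; shrink to where it stays
    positive.\<close>
  define W' where "W' = {q \<in> W. n q > 0}"
  have W': "openin (topo M) W'" "W' \<subseteq> W" "W' \<subseteq> U"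
    using smooth_fun_open_positive[OF W(1) n] W by (auto simp: W'_def)
  have pW': "p \<in> W'" using W(2) metric_pos[OF u(1,2)] by (simp add: W'_def n_def Gp)
  define c where "c = (\<lambda>q. n q powr (-1/2))"
  define N where "N = (\<lambda>q. tscale (c q) (G q))"
  have c: "smooth_fun M W' c" unfolding c_def
    by (rule smooth_fun_powr[OF W'(1) smooth_fun_subset[OF n W'(2)]]) (simp add: W'_def)
  have GW: "vector_field M W' G" by (rule vector_field_subset[OF G W'(2)])
  have N: "vector_field M W' N" unfolding N_def by (rule vector_field_scale[OF c GW])
  have GT: "G q \<in> T q" and NT: "N q \<in> T q" if "q \<in> W'" for q
    using vector_field_tangent that GW N by blast+
  have NN: "g q (N q) (N q) = 1" if q: "q \<in> W'" for q
  proof -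
    have "g q (N q) (N q) = c q * c q * n q"
      unfolding N_def using GT[OF q] tangent_scale[OF tangent_point[OF GT[OF q]] GT[OF q]]
      by (simp add: metric_scale_left metric_scale_right n_def)
    also have "c q * c q = n q powr (-1)" unfolding c_def by (simp flip: powr_add)
    also have "\<dots> * n q = 1" using q by (simp add: W'_def powr_minus)
    finally show ?thesis .
  qed
  have NE: "g q (N q) (E i q) = 0" "g q (E i q) (N q) = 0" if q: "q \<in> W'" and i: "i \<in> I" for q i
  proof -
    have eT: "E i q \<in> T q" using vector_field_tangent[OF EW[OF i]] q W' by blast
    show 1: "g q (N q) (E i q) = 0"
      unfolding N_def using metric_scale_left[OF GT[OF q] eT] orth i q W' by auto
    show "g q (E i q) (N q) = 0" using 1 metric_commute[OF NT[OF q] eT] by simp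
  qed
  have parN: "D p v N = tzero" if v: "v \<in> T p" for v
  proof -
    have DN: "D p v N = tscale (v c) (G p)"
      unfolding N_def cov_leibniz[OF W'(1) GW c pW' v] parG[OF v] by (simp add: tadd_def tscale_def tzero_def)
    have DNT: "D p v N \<in> T p" by (rule cov_tangent[OF W'(1) N pW' v])
    \<comment> \<open>Differentiating the constant squared norm of \<open>N\<close> gives
      \<open>v c = 0\<close> and avoids computing the derivative of the power in
      \<open>c\<close>.\<close>
    have "0 = v (\<lambda>q. g q (N q) (N q))"
      using tangent_cong[OF v W'(1) pW' NN] tangent_deriv_const[OF v] by simp
    also have "\<dots> = 2 * g p (D p v N) (N p)"
      using metric_derivative[OF W'(1) N N pW' v] metric_commute[OF DNT NT[OF pW']] by simp
    also have "\<dots> = 2 * (v c * (c p * n p))"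
      unfolding DN using GT[OF pW'] NT[OF pW']
      by (simp add: metric_scale_left N_def metric_scale_right n_def)
    finally have "v c = 0" using pW' by (simp add: c_def W'_def)
    then show ?thesis unfolding DN by (simp add: tscale_def tzero_def)
  qed
  let ?E = "E(k := N)"
  have "?P (insert k I) W' ?E"
    using W' pW' N parN par NN NE on vector_field_subset[OF E W'(3)] insert.hyps(2) by auto
  then show ?case by blast
qed

end

context riemannian4
begin

lemma oriented_orthonormal_at: "oriented_orthonormal M g p e \<Longrightarrow> orthonormal_at p e"
  unfolding oriented_orthonormal_def orthonormal_at_def by blast

text \<open>Expanding the coordinate vectors in the frame exhibits an inverse of the matrix of
  coordinate components.\<close>

lemma frame_chart_det_nonzero:
  assumes e: "orthonormal_at p e" and c: "(V, \<phi>) \<in> atlas M" "p \<in> V"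
  shows "det (\<chi> i j. e i (\<lambda>q. \<phi> q $ j)) \<noteq> 0"
proof -
  let ?X = "\<lambda>j. chart_vector M V \<phi> p (axis j 1)"
  let ?B = "\<chi> j i. g p (?X j) (e i)" and ?W = "\<chi> i j. e i (\<lambda>q. \<phi> q $ j)"
  have X: "?X j \<in> T p" for j using tangent_space_chart[OF c] by blast
  have "(\<Oplus>i. g p (?X j) (e i) * e i (\<lambda>q. \<phi> q $ k)) = (if j = k then 1 else 0)" for j k
  proof -
    have "(\<Oplus>i. g p (?X j) (e i) * e i (\<lambda>q. \<phi> q $ k)) = ?X j (\<lambda>q. \<phi> q $ k)"
      by (rule fun_cong[OF frame_expansion[OF e X, unfolded lincomb_def], symmetric])
    also have "\<dots> = axis j 1 $ k" by (rule chart_vector_coordinate[OF c])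
    finally show ?thesis by (simp add: axis_def eq_commute)
  qed
  then have BW: "?B ** ?W = mat 1"
    by (simp add: matrix_matrix_mult_def mat_def)
  have "det ?B * det ?W = 1"
    unfolding det_mul[symmetric] BW by (rule det_I)
  then show ?thesis by (metis mult_zero_right zero_neq_one)
qed

lemma oriented_orthonormal_chartI:
  assumes e: "orthonormal_at p e" and c: "(V, \<phi>) \<in> atlas M" "p \<in> V"
    and pos: "det (\<chi> i j. e i (\<lambda>q. \<phi> q $ j)) > 0"
  shows "oriented_orthonormal M g p e"
  using orientation_chart_independent[OF orthonormal_tangent[OF e] c _ _ pos] e
  unfolding oriented_orthonormal_def orthonormal_at_def by blast

text \<open>The transition matrix lies in SO(4): orthonormality leaves the determinants 1 and -1,
  and the common orientation selects 1.\<close>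

lemma frame_change:
  assumes e: "oriented_orthonormal M g p e" and e': "oriented_orthonormal M g p e'"
  defines "A \<equiv> (\<chi> i j. g p (e' i) (e j)) :: real^4^4"
  shows "e' i = lincomb (\<lambda>j. A $ i $ j) e" and "A ** transpose A = mat 1" and "det A = 1"
proof -
  note o = oriented_orthonormal_at[OF e] and o' = oriented_orthonormal_at[OF e']
  show exp: "e' i = lincomb (\<lambda>j. A $ i $ j) e" for i
    unfolding A_def vec_lambda_beta by (rule frame_expansion[OF o orthonormal_tangent[OF o']])
  have "(\<Oplus>k. A $ i $ k * A $ j $ k) = (if i = j then 1 else 0)" for i j
    using metric_frame[OF o orthonormal_tangent[OF o'] orthonormal_tangent[OF o'], of i j]
      orthonormal_metric[OF o', of i j]
    by (simp add: A_def)
  then show AA: "A ** transpose A = mat 1"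
    by (simp add: matrix_matrix_mult_def mat_def transpose_def)
  obtain V \<phi> where c: "(V, \<phi>) \<in> atlas M" "p \<in> V" using chart_at[OF orthonormal_point[OF o]] .
  let ?W = "\<lambda>e :: 4 \<Rightarrow> 'm tvec. (\<chi> i j. e i (\<lambda>q. \<phi> q $ j)) :: real^4^4"
  have pos: "det (?W e) > 0" "det (?W e') > 0"
    using e e' c unfolding oriented_orthonormal_def by blast+
  have "e' i h = (\<Oplus>j. A $ i $ j * e j h)" for i h
    by (rule fun_cong[OF exp[unfolded lincomb_def]])
  then have "?W e' = A ** ?W e" by (simp add: matrix_matrix_mult_def)
  then have "det (?W e') = det A * det (?W e)" by (simp add: det_mul)
  then have "det A > 0" using pos by (simp add: zero_less_mult_iff)
  moreover have "det A * det A = 1" using arg_cong[OF AA, of det] by (simp add: det_mul det_transpose)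
  ultimately show "det A = 1" by (metis abs_of_pos real_sqrt_abs2 real_sqrt_one)
qed

end

context levi_civita4
begin

text \<open>If the parallel orthonormal frame has the wrong orientation, reversing one member
  corrects it and preserves the other properties.\<close>

lemma adapted_frame_exists:
  assumes p: "p \<in> points M"
  obtains U E where "orthonormal_frame M g U E" "p \<in> U" "oriented_orthonormal M g p (\<lambda>i. E i p)"
    "\<And>i v. v \<in> T p \<Longrightarrow> D p v (E i) = tzero"
proof -
  obtain U E where UE: "openin (topo M) U \<and> p \<in> U \<and> (\<forall>i\<in>UNIV. vector_field M U (E i)) \<and>
    (\<forall>i\<in>UNIV. \<forall>v\<in>T p. D p v (E i) = tzero) \<and>
    (\<forall>q\<in>U. \<forall>i\<in>UNIV. \<forall>j\<in>UNIV. g q (E i q) (E j q) = (if (i::4) = j then 1 else 0))"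
    using orthonormal_fields_exist[OF p, of UNIV] by (elim exE)
  have U: "openin (topo M) U" "p \<in> U" and E: "\<And>i. vector_field M U (E i)"
    and par: "\<And>i v. v \<in> T p \<Longrightarrow> D p v (E i) = tzero"
    and on: "\<And>q i j. q \<in> U \<Longrightarrow> g q (E i q) (E j q) = (if i = j then 1 else 0)"
    using UE by blast+
  have ET: "E i q \<in> T q" if "q \<in> U" for i q using vector_field_tangent[OF E that] .
  have "orthonormal_at p (\<lambda>i. E i p)" unfolding orthonormal_at_def using ET on U by blast
  obtain V \<phi> where c: "(V, \<phi>) \<in> atlas M" "p \<in> V" using chart_at[OF p] .
  \<comment> \<open>The frame with its first member reversed; the determinant in the chart changes
    sign, so one of the two frames is oriented.\<close>
  define F where "F = (\<lambda>i q. if i = 1 then tscale (-1) (E 1 q) else E i q)"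
  have F: "vector_field M U (F i)" for i
    using vector_field_scale[OF smooth_fun_const[OF U(1)] E] E
    by (cases "i = 1") (simp_all add: F_def)
  have FF: "g q (F i q) (F j q) = (if i = j then 1 else 0)" if q: "q \<in> U" for q i j
    using on[OF q] ET[OF q] tangent_scale[OF tangent_point ET[OF q], OF ET[OF q]]
    by (auto simp: F_def metric_scale_left metric_scale_right)
  have parF: "D p v (F i) = tzero" if v: "v \<in> T p" for v i
    using cov_leibniz[OF U(1) E smooth_fun_const[OF U(1)] U(2) v, of "-1"] par[OF v] tangent_deriv_const[OF v]
    by (cases "i = 1") (simp_all add: F_def tadd_def tscale_def tzero_def)
  have fE: "orthonormal_frame M g U E" "orthonormal_frame M g U F"
    by unfold_locales (use U E F ET on FF vector_field_tangent[OF F] in \<open>auto simp: orthonormal_at_def\<close>)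
  have oE: "orthonormal_at p (\<lambda>i. E i p)" "orthonormal_at p (\<lambda>i. F i p)"
    using orthonormal_frame.frame_orthonormal[OF fE(1) U(2)] orthonormal_frame.frame_orthonormal[OF fE(2) U(2)] .
  let ?W = "\<lambda>e :: 4 \<Rightarrow> 'm tvec. (\<chi> i j. e i (\<lambda>q. \<phi> q $ j)) :: real^4^4"
  have "?W (\<lambda>i. F i p) = (\<chi> i. if i = 1 then (-1) *s (?W (\<lambda>i. E i p) $ i) else ?W (\<lambda>i. E i p) $ i)"
    by (simp add: vec_eq_iff F_def tscale_def)
  then have "det (?W (\<lambda>i. F i p)) = - det (?W (\<lambda>i. E i p))"
    by (simp add: det_row_mul)
  then consider "det (?W (\<lambda>i. E i p)) > 0" | "det (?W (\<lambda>i. F i p)) > 0"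
    using frame_chart_det_nonzero[OF oE(1) c] by linarith
  then show ?thesis
  proof cases
    case 1
    show ?thesis by (rule that[OF fE(1) U(2) oriented_orthonormal_chartI[OF oE(1) c 1] par])
  next
    case 2
    show ?thesis by (rule that[OF fE(2) U(2) oriented_orthonormal_chartI[OF oE(2) c 2] parF])
  qed
qed

end

section \<open>Algebra of curvature tensors\<close>

lemma det_4:
  fixes A :: "'a::comm_ring_1^4^4"
  shows "det A =
    A$1$1 * A$2$2 * A$3$3 * A$4$4 - A$1$1 * A$2$2 * A$3$4 * A$4$3 - A$1$1 * A$2$3 * A$3$2 * A$4$4
  + A$1$1 * A$2$3 * A$3$4 * A$4$2 + A$1$1 * A$2$4 * A$3$2 * A$4$3 - A$1$1 * A$2$4 * A$3$3 * A$4$2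
  - A$1$2 * A$2$1 * A$3$3 * A$4$4 + A$1$2 * A$2$1 * A$3$4 * A$4$3 + A$1$2 * A$2$3 * A$3$1 * A$4$4
  - A$1$2 * A$2$3 * A$3$4 * A$4$1 - A$1$2 * A$2$4 * A$3$1 * A$4$3 + A$1$2 * A$2$4 * A$3$3 * A$4$1
  + A$1$3 * A$2$1 * A$3$2 * A$4$4 - A$1$3 * A$2$1 * A$3$4 * A$4$2 - A$1$3 * A$2$2 * A$3$1 * A$4$4
  + A$1$3 * A$2$2 * A$3$4 * A$4$1 + A$1$3 * A$2$4 * A$3$1 * A$4$2 - A$1$3 * A$2$4 * A$3$2 * A$4$1
  - A$1$4 * A$2$1 * A$3$2 * A$4$3 + A$1$4 * A$2$1 * A$3$3 * A$4$2 + A$1$4 * A$2$2 * A$3$1 * A$4$3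
  - A$1$4 * A$2$2 * A$3$3 * A$4$1 - A$1$4 * A$2$3 * A$3$1 * A$4$2 + A$1$4 * A$2$3 * A$3$2 * A$4$1"
proof -
  have f: "finite {2::4, 3, 4}" "1 \<notin> {2::4, 3, 4}" "finite {3::4, 4}" "2 \<notin> {3::4, 4}"
    "finite {4::4}" "3 \<notin> {4::4}" by simp_all
  have s: "sum h {p. p permutes {4::4}} = h id" for h :: "(4 \<Rightarrow> 4) \<Rightarrow> 'a"
    by (simp add: permutes_sing)
  show ?thesis
    unfolding det_def UNIV_4
    unfolding sum_over_permutations_insert[OF f(1,2)] sum_over_permutations_insert[OF f(3,4)]
      sum_over_permutations_insert[OF f(5,6)] s
    by (simp add: sign_swap_id permutation_swap_id sign_compose sign_id swap_id_eq permutation_compose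
        transpose_def algebra_simps)
qed

text \<open>The sum over (2,2)-shuffles with their signs, for any array with four indices: it serves
  the arguments of a wedge product and also the frame indices in the Euler form.\<close>

definition shuffle_sum :: "(4 \<Rightarrow> 4 \<Rightarrow> 4 \<Rightarrow> 4 \<Rightarrow> real) \<Rightarrow> real" where
  "shuffle_sum F = F 1 2 3 4 - F 1 3 2 4 + F 1 4 2 3 + F 2 3 1 4 - F 2 4 1 3 + F 3 4 1 2"

lemma antisym_sum_4:
  fixes G :: "4 \<Rightarrow> 4 \<Rightarrow> real"
  assumes "\<And>a b. G a b = - G b a"
  shows "(\<Oplus>a b. x a * y b * G a b) =
    (x 1 * y 2 - x 2 * y 1) * G 1 2 + (x 1 * y 3 - x 3 * y 1) * G 1 3 + (x 1 * y 4 - x 4 * y 1) * G 1 4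
  + (x 2 * y 3 - x 3 * y 2) * G 2 3 + (x 2 * y 4 - x 4 * y 2) * G 2 4 + (x 3 * y 4 - x 4 * y 3) * G 3 4"
proof -
  have "G a a = 0" for a using assms[of a a] by simp
  moreover have "G 2 1 = - G 1 2" "G 3 1 = - G 1 3" "G 4 1 = - G 1 4" "G 3 2 = - G 2 3"
    "G 4 2 = - G 2 4" "G 4 3 = - G 3 4" using assms by blast+
  ultimately show ?thesis by (simp add: sum_4 algebra_simps)
qed

text \<open>Laplace expansion of a determinant along pairs of rows, with repeated columns allowed.\<close>

lemma shuffle_sum_det:
  fixes F :: "4 \<Rightarrow> 4 \<Rightarrow> 4 \<Rightarrow> 4 \<Rightarrow> real" and A :: "real^4^4"
  assumes F1: "\<And>a b c d. F a b c d = - F b a c d" and F2: "\<And>a b c d. F a b c d = - F a b d c"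
  shows "shuffle_sum (\<lambda>i j k l. \<Oplus>a b. A$i$a * A$j$b * (\<Oplus>c d. A$k$c * A$l$d * F a b c d))
    = det A * shuffle_sum F"
proof -
  define P where "P = (\<lambda>i j a b. A$i$a * A$j$b - A$i$b * A$j$a)"
  define L where "L = (\<lambda>a b c d. P 1 2 a b * P 3 4 c d - P 1 3 a b * P 2 4 c d + P 1 4 a b * P 2 3 c d
    + P 2 3 a b * P 1 4 c d - P 2 4 a b * P 1 3 c d + P 3 4 a b * P 1 2 c d)"
  define Q where "Q = (\<lambda>k l a b. P k l 1 2 * F a b 1 2 + P k l 1 3 * F a b 1 3 + P k l 1 4 * F a b 1 4
        + P k l 2 3 * F a b 2 3 + P k l 2 4 * F a b 2 4 + P k l 3 4 * F a b 3 4)"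
  have inner: "(\<Oplus>a b. A$i$a * A$j$b * (\<Oplus>c d. A$k$c * A$l$d * F a b c d)) =
      P i j 1 2 * Q k l 1 2 + P i j 1 3 * Q k l 1 3 + P i j 1 4 * Q k l 1 4
        + P i j 2 3 * Q k l 2 3 + P i j 2 4 * Q k l 2 4 + P i j 3 4 * Q k l 3 4" for i j k l
  proof -
    have Q: "(\<Oplus>c d. A$k$c * A$l$d * F a b c d) = Q k l a b" for a b
      unfolding Q_def P_def by (rule antisym_sum_4[OF F2])
    have "Q k l a b = - Q k l b a" for a b
      unfolding Q_def using F1[of a b] by simp
    then show ?thesis unfolding Q P_def by (rule antisym_sum_4)
  qed
  \<comment> \<open>With a repeated column \<open>L\<close> is a Laplace expansion with two equal
    columns. This kills 30 of the 36 terms listed below; the other six carry the determinant up to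
    sign.\<close>
  have z: "L a b a d = 0" "L a b b d = 0" "L a b c a = 0" "L a b c b = 0" for a b c d
    by (simp_all add: L_def P_def algebra_simps)
  have dt: "L 1 2 3 4 = det A" "L 1 3 2 4 = - det A" "L 1 4 2 3 = det A" "L 2 3 1 4 = det A"
    "L 2 4 1 3 = - det A" "L 3 4 1 2 = det A"
    unfolding det_4 by (simp_all add: L_def P_def algebra_simps)
  let ?t = "\<lambda>a b c d. L a b c d * F a b c d"
  have "shuffle_sum (\<lambda>i j k l. \<Oplus>a b. A$i$a * A$j$b * (\<Oplus>c d. A$k$c * A$l$d * F a b c d))
    = ?t 1 2 1 2 + ?t 1 2 1 3 + ?t 1 2 1 4 + ?t 1 2 2 3 + ?t 1 2 2 4 + ?t 1 2 3 4
    + ?t 1 3 1 2 + ?t 1 3 1 3 + ?t 1 3 1 4 + ?t 1 3 2 3 + ?t 1 3 2 4 + ?t 1 3 3 4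
    + ?t 1 4 1 2 + ?t 1 4 1 3 + ?t 1 4 1 4 + ?t 1 4 2 3 + ?t 1 4 2 4 + ?t 1 4 3 4
    + ?t 2 3 1 2 + ?t 2 3 1 3 + ?t 2 3 1 4 + ?t 2 3 2 3 + ?t 2 3 2 4 + ?t 2 3 3 4
    + ?t 2 4 1 2 + ?t 2 4 1 3 + ?t 2 4 1 4 + ?t 2 4 2 3 + ?t 2 4 2 4 + ?t 2 4 3 4
    + ?t 3 4 1 2 + ?t 3 4 1 3 + ?t 3 4 1 4 + ?t 3 4 2 3 + ?t 3 4 2 4 + ?t 3 4 3 4"
    unfolding shuffle_sum_def inner Q_def L_def by (simp add: algebra_simps)
  also have "\<dots> = det A * shuffle_sum F"
    unfolding z dt shuffle_sum_def by (simp add: algebra_simps)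
  finally show ?thesis .
qed

text \<open>The coefficients of the Euler and Pontrjagin forms with respect to the volume form, up to
  the factor \<open>4 * pi\<^sup>2\<close>, for a curvature tensor with components \<open>R\<close> in an oriented orthonormal
  basis.\<close>

definition euler_coeff :: "(4 \<Rightarrow> 4 \<Rightarrow> 4 \<Rightarrow> 4 \<Rightarrow> real) \<Rightarrow> real" where
  "euler_coeff R = wedge (\<lambda>a b. R a b 1 2) (\<lambda>a b. R a b 3 4) id
     - wedge (\<lambda>a b. R a b 1 3) (\<lambda>a b. R a b 2 4) id + wedge (\<lambda>a b. R a b 1 4) (\<lambda>a b. R a b 2 3) id"

definition pontrjagin_coeff :: "(4 \<Rightarrow> 4 \<Rightarrow> 4 \<Rightarrow> 4 \<Rightarrow> real) \<Rightarrow> real" where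
  "pontrjagin_coeff R = wedge (\<lambda>a b. R a b 1 2) (\<lambda>a b. R a b 1 2) id
     + wedge (\<lambda>a b. R a b 1 3) (\<lambda>a b. R a b 1 3) id + wedge (\<lambda>a b. R a b 1 4) (\<lambda>a b. R a b 1 4) id
     + wedge (\<lambda>a b. R a b 2 3) (\<lambda>a b. R a b 2 3) id + wedge (\<lambda>a b. R a b 2 4) (\<lambda>a b. R a b 2 4) id
     + wedge (\<lambda>a b. R a b 3 4) (\<lambda>a b. R a b 3 4) id"

definition delta :: "4 \<Rightarrow> 4 \<Rightarrow> real" where
  "delta i j = (if i = j then 1 else 0)"

text \<open>For \<open>\<sigma> = delta / 2\<close> this is the curvature tensor of the unit sphere
  in the present sign convention.\<close>

definition kulkarni_nomizu :: "(4 \<Rightarrow> 4 \<Rightarrow> real) \<Rightarrow> 4 \<Rightarrow> 4 \<Rightarrow> 4 \<Rightarrow> 4 \<Rightarrow> real" where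
  "kulkarni_nomizu \<sigma> i j k l =
     \<sigma> i k * delta j l + \<sigma> j l * delta i k - \<sigma> i l * delta j k - \<sigma> j k * delta i l"

section \<open>Tensors with the skew symmetries of curvature\<close>

locale algebraic_curvature =
  fixes R :: "4 \<Rightarrow> 4 \<Rightarrow> 4 \<Rightarrow> 4 \<Rightarrow> real"
  assumes skew1: "R i j k l = - R j i k l"
    and skew2: "R i j k l = - R i j l k"
begin

lemma skew_diag: "R i i k l = 0" "R i j k k = 0"
  using skew1[of i i k l] skew2[of i j k k] by simp_all

text \<open>Instances that sort each index pair increasingly; the general equations would make the
  simplifier loop.\<close>

lemmas skew_order =
  skew1[of 2 1] skew1[of 3 1] skew1[of 4 1] skew1[of 3 2] skew1[of 4 2] skew1[of 4 3]
  skew2[of _ _ 2 1] skew2[of _ _ 3 1] skew2[of _ _ 4 1] skew2[of _ _ 3 2] skew2[of _ _ 4 2] skew2[of _ _ 4 3]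

definition ric :: "4 \<Rightarrow> 4 \<Rightarrow> real" where
  "ric i j = (\<Oplus>k. R i k j k)"

definition scal :: real where
  "scal = (\<Oplus>i. ric i i)"

text \<open>The Euler coefficient is quadratic. Its cross term with the product of \<sigma> and the
  metric sees \<open>R\<close> only through the Einstein tensor, as
  \<open>- <ric - scal / 2 * delta, \<sigma>>\<close>; the pure term is twice the second elementary
  symmetric function of the eigenvalues of \<sigma>.\<close>

lemma euler_coeff_kulkarni_nomizu:
  assumes \<sigma>: "\<And>i j. \<sigma> i j = \<sigma> j i"
  shows "euler_coeff (\<lambda>i j k l. R i j k l + kulkarni_nomizu \<sigma> i j k l) = euler_coeff R
    + 1/2 * (scal * (\<Oplus>i. \<sigma> i i) - 2 * (\<Oplus>i j. ric i j * \<sigma> i j))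
    + (\<Oplus>i. \<sigma> i i)\<^sup>2 - (\<Oplus>i j. (\<sigma> i j)\<^sup>2)"
proof -
  have s: "\<sigma> 2 1 = \<sigma> 1 2" "\<sigma> 3 1 = \<sigma> 1 3" "\<sigma> 4 1 = \<sigma> 1 4" "\<sigma> 3 2 = \<sigma> 2 3" "\<sigma> 4 2 = \<sigma> 2 4" "\<sigma> 4 3 = \<sigma> 3 4"
    using \<sigma> by blast+
  show ?thesis
    by (simp add: euler_coeff_def wedge_def kulkarni_nomizu_def delta_def scal_def ric_def sum_4
        s skew_order skew_diag) (simp add: field_simps power2_eq_square)
qed

text \<open>Combine the four cyclic rotations of the Bianchi identity; skew symmetry cancels all but
  the two terms compared.\<close>

lemma pair_symmetry:
  assumes bianchi: "\<And>i j k l. R i j k l + R j k i l + R k i j l = 0"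
  shows "R k l i j = R i j k l"
proof -
  have "R j k l i = - R j k i l" "R k l j i = - R k l i j" "R l j k i = - R j l k i"
    "R l i k j = - R l i j k" "R i k l j = R k i j l" "R i j l k = - R i j k l" "R j l i k = - R j l k i"
    using skew1 skew2 by (metis minus_minus)+
  then show ?thesis
    using bianchi[of i j k l] bianchi[of j k l i] bianchi[of k l i j] bianchi[of l i j k] by linarith
qed

text \<open>For a tensor with the Bianchi identity the Pontrjagin coefficient depends on the Weyl
  part alone, and a Kulkarni-Nomizu product with the metric has no Weyl part. The code verifies this
  by expansion.\<close>

lemma pontrjagin_coeff_kulkarni_nomizu:
  assumes \<sigma>: "\<And>i j. \<sigma> i j = \<sigma> j i" and bianchi: "\<And>i j k l. R i j k l + R j k i l + R k i j l = 0"
  shows "pontrjagin_coeff (\<lambda>i j k l. R i j k l + kulkarni_nomizu \<sigma> i j k l) = pontrjagin_coeff R"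
proof -
  have s: "\<sigma> 2 1 = \<sigma> 1 2" "\<sigma> 3 1 = \<sigma> 1 3" "\<sigma> 4 1 = \<sigma> 1 4" "\<sigma> 3 2 = \<sigma> 2 3" "\<sigma> 4 2 = \<sigma> 2 4" "\<sigma> 4 3 = \<sigma> 3 4"
    using \<sigma> by blast+
  note p = pair_symmetry[OF bianchi]
  \<comment> \<open>Among components with four distinct indices only two are independent; this one
    is eliminated in favour of the other two.\<close>
  have b: "R 1 2 3 4 = R 1 3 2 4 - R 1 4 2 3"
    using bianchi[of 1 2 3 4] p[of 1 4 2 3] skew1[of 3 1 2 4] by linarith
  have p': "R 1 3 1 2 = R 1 2 1 3" "R 1 4 1 2 = R 1 2 1 4" "R 2 3 1 2 = R 1 2 2 3" "R 2 4 1 2 = R 1 2 2 4"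
    "R 3 4 1 2 = R 1 2 3 4" "R 1 4 1 3 = R 1 3 1 4" "R 2 3 1 3 = R 1 3 2 3" "R 2 4 1 3 = R 1 3 2 4"
    "R 3 4 1 3 = R 1 3 3 4" "R 2 3 1 4 = R 1 4 2 3" "R 2 4 1 4 = R 1 4 2 4" "R 3 4 1 4 = R 1 4 3 4"
    "R 2 4 2 3 = R 2 3 2 4" "R 3 4 2 3 = R 2 3 3 4" "R 3 4 2 4 = R 2 4 3 4"
    by (rule p)+
  show ?thesis
    by (simp add: pontrjagin_coeff_def wedge_def kulkarni_nomizu_def delta_def
        s skew_order skew_diag p' b) (simp add: algebra_simps)
qed

text \<open>Inserting the \<sigma> of a conformal change: the terms \<open>N\<^sup>2\<close> and
  \<open>scal * N\<close> cancel, and what remains is the expression in \<open>divergence_P\<close>,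
  with factor 1/8.\<close>

lemma schouten_substitution:
  fixes f :: "4 \<Rightarrow> real" and h :: "4 \<Rightarrow> 4 \<Rightarrow> real"
  assumes h: "\<And>i j. h i j = h j i"
  defines "N \<equiv> \<Oplus>i. (f i)\<^sup>2" and "H \<equiv> \<Oplus>i. h i i"
  defines "\<sigma> \<equiv> \<lambda>i j. - h i j / 2 + f i * f j / 4 - N * delta i j / 8"
  shows "1/2 * (scal * (\<Oplus>i. \<sigma> i i) - 2 * (\<Oplus>i j. ric i j * \<sigma> i j))
    + (\<Oplus>i. \<sigma> i i)\<^sup>2 - (\<Oplus>i j. (\<sigma> i j)\<^sup>2) =
    1/8 * (2 * H\<^sup>2 - 2 * (\<Oplus>i j. (h i j)\<^sup>2) + 2 * (\<Oplus>i j. h i j * f i * f j)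
      + N * H - 2 * scal * H + 4 * (\<Oplus>i j. ric i j * h i j)
      - 2 * (\<Oplus>i j. ric i j * f i * f j))"
proof -
  have tr: "(\<Oplus>i. \<sigma> i i) = - H / 2 - N / 4"
    by (simp add: \<sigma>_def H_def N_def delta_def sum_4 power2_eq_square) (simp add: field_simps)
  have contr: "(\<Oplus>i j. c i j * \<sigma> i j) = - (\<Oplus>i j. c i j * h i j) / 2
      + (\<Oplus>i j. c i j * f i * f j) / 4 - N * (\<Oplus>i. c i i) / 8" for c :: "4 \<Rightarrow> 4 \<Rightarrow> real"
    by (simp add: \<sigma>_def delta_def sum_4) (simp add: field_simps)
  \<comment> \<open>The square is a contraction of \<sigma> with itself, so \<open>contr\<close> is
    applied with \<open>c\<close> equal to \<sigma> and then once more.\<close>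
  have sq: "(\<Oplus>i j. (\<sigma> i j)\<^sup>2) = - (\<Oplus>i j. \<sigma> i j * h i j) / 2
      + (\<Oplus>i j. \<sigma> i j * f i * f j) / 4 - N * (\<Oplus>i. \<sigma> i i) / 8"
    unfolding power2_eq_square by (rule contr)
  have sh: "(\<Oplus>i j. \<sigma> i j * h i j) = - (\<Oplus>i j. (h i j)\<^sup>2) / 2
      + (\<Oplus>i j. h i j * f i * f j) / 4 - N * H / 8"
    using contr[of h] by (simp add: mult.commute power2_eq_square H_def)
  have NN: "(\<Oplus>i. f i * f i) = N"
    by (simp add: N_def power2_eq_square)
  have ff: "(\<Oplus>i j. f i * f j * f i * f j) = N\<^sup>2"
    by (simp add: N_def sum_4 power2_eq_square) (simp add: algebra_simps)
  have sf: "(\<Oplus>i j. \<sigma> i j * f i * f j) = - (\<Oplus>i j. h i j * f i * f j) / 2 + N\<^sup>2 / 8"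
    using contr[of "\<lambda>i j. f i * f j"] ff NN
    by (simp add: mult_ac power2_eq_square)
  show ?thesis
    unfolding tr contr sq sh sf scal_def[symmetric] by (simp add: field_simps power2_eq_square)
qed

end

lemma sum_delta_left: "(\<Oplus>m. delta k m * x m) = x k" "(\<Oplus>m. delta m k * x m) = x k"
  by (simp_all add: delta_def if_distrib[of "\<lambda>c. c * _"] cong: if_cong)

lemma delta_commute: "delta i j = delta j i"
  by (simp add: delta_def eq_commute)

text \<open>The Levi-Civita connections of \<open>g\<close> and of \<open>exp f * g\<close> differ by
  \<open>(X f * Y + Y f * X - g(X,Y) * grad f) / 2\<close>; in an orthonormal basis this is the tensor \<open>A\<close> below.\<close>

lemma conformal_curvature_algebra:
  fixes f :: "4 \<Rightarrow> real" and h :: "4 \<Rightarrow> 4 \<Rightarrow> real"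
  assumes h: "\<And>i j. h i j = h j i"
  defines "A \<equiv> \<lambda>j k l. (f j * delta k l + f k * delta j l - delta j k * f l) / 2"
    and "B \<equiv> \<lambda>i j k l. (h i j * delta k l + h i k * delta j l - delta j k * h i l) / 2"
  shows "- B i j k l + B j i k l - (\<Oplus>m. A j k m * A i m l - A i k m * A j m l) =
    kulkarni_nomizu (\<lambda>i j. - h i j / 2 + f i * f j / 4 - (\<Oplus>i. (f i)\<^sup>2) * delta i j / 8) i j k l"
proof -
  let ?N = "\<Oplus>i. (f i)\<^sup>2"
  have AA: "(\<Oplus>m. A j k m * A i m l) =
    (f j * f i * delta k l + f j * f k * delta i l - f j * f l * delta i k
     + f k * f i * delta j l + f k * f j * delta i l - f k * f l * delta i j
     - delta j k * delta i l * ?N) / 4" for i j k l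
  proof -
    \<comment> \<open>Arranged so that each summand has a delta in \<open>m\<close> in front, ready
      for \<open>sum_delta_left\<close>, or else contains \<open>(f m)\<^sup>2\<close>.\<close>
    have "4 * (A j k m * A i m l) =
      delta k m * (f j * (f i * delta m l + f m * delta i l - delta i m * f l))
      + delta j m * (f k * (f i * delta m l + f m * delta i l - delta i m * f l))
      - delta m l * (delta j k * f i * f m) - delta j k * delta i l * (f m)\<^sup>2 + delta i m * (delta j k * f l * f m)" for m
      by (simp add: A_def field_simps power2_eq_square)
    then have "4 * (\<Oplus>m. A j k m * A i m l) =
      f j * (f i * delta k l + f k * delta i l - delta i k * f l)
      + f k * (f i * delta j l + f j * delta i l - delta i j * f l)
      - delta j k * f i * f l - delta j k * delta i l * ?N + delta j k * f l * f i"
      by (simp add: sum_distrib_left sum.distrib sum_subtractf sum_delta_left)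
    then show ?thesis by (simp add: algebra_simps)
  qed
  show ?thesis
    unfolding sum_subtractf AA B_def kulkarni_nomizu_def
    using h[of i j] delta_commute[of i j] delta_commute[of i k] delta_commute[of i l]
      delta_commute[of j k] delta_commute[of j l] delta_commute[of k l]
    by (simp add: field_simps)
qed

section \<open>Ricci curvature, gradient and divergence in a frame\<close>

context riemannian4
begin

text \<open>Linearity of \<open>L\<close> follows from the component formula itself, so the Ricci
  tensor, the scalar curvature and the divergence are read off directly.\<close>

lemma tangent_trace_components:
  assumes e: "orthonormal_at p e"
    and L: "\<And>z. z \<in> T p \<Longrightarrow> L z = lincomb (\<lambda>l. \<Oplus>j. g p z (e j) * c j l) e"
  shows "tangent_trace M p L = (\<Oplus>j. c j j)"
proof -
  have eT: "e i \<in> T p" for i by (rule orthonormal_tangent[OF e])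
  have p: "p \<in> points M" by (rule orthonormal_point[OF e])
  have "tangent_linear p L"
    unfolding tangent_linear_def
  proof (intro conjI ballI allI impI)
    show "L u \<in> T p" if "u \<in> T p" for u
      unfolding L[OF that] by (rule lincomb_tangent[OF p eT])
    fix a :: "4 \<Rightarrow> real" and b :: "4 \<Rightarrow> 'm tvec" assume "\<forall>i. b i \<in> T p"
    then have b: "b i \<in> T p" for i by blast
    have Lb: "(\<lambda>i. L (b i)) = (\<lambda>i. lincomb (\<lambda>l. \<Oplus>j. g p (b i) (e j) * c j l) e)"
      by (rule ext, rule L[OF b])
    have "(\<Oplus>j. g p (lincomb a b) (e j) * c j l) =
        (\<Oplus>i. a i * (\<Oplus>j. g p (b i) (e j) * c j l))" for l
      unfolding metric_lincomb_left[OF eT b] sum_distrib_left sum_distrib_right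
      by (subst sum.swap) (simp add: mult.assoc)
    then show "L (lincomb a b) = lincomb a (\<lambda>i. L (b i))"
      unfolding L[OF lincomb_tangent[OF p b]] Lb lincomb_lincomb by simp
  qed
  from tangent_trace_frame[OF e this] show ?thesis
    unfolding L[OF eT] metric_lincomb_frame[OF e] orthonormal_metric[OF e]
    by (simp add: if_distrib[of "\<lambda>x. x * _"] cong: if_cong)
qed

end

lemma (in torsion_free_frame) curv_skew1: "curv i j k l q = - curv j i k l q"
  by (simp add: curv_def sum_subtractf left_diff_distrib)

locale levi_civita_frame = levi_civita4 M g D + orthonormal_frame M g U E
  for M :: "'m manifold" and g D U E

sublocale levi_civita_frame \<subseteq> torsion_free_frame M g U E D ..

context levi_civita_frame
begin

section \<open>Symmetries of the Levi-Civita connection and curvature components\<close>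

lemma frame_near: "smooth_fun M U h \<Longrightarrow> q \<in> U \<Longrightarrow> smooth_near M q h"
  using smooth_nearI[OF domain_open] .

lemma frame_derivative_smooth: "smooth_fun M U h \<Longrightarrow> smooth_fun M U (\<lambda>q. E i q h)"
  by (rule vector_field_smooth[OF frame_field domain_open subset_refl])

text \<open>Differentiate the constant function \<open>g (E k) (E l)\<close> by metric
  compatibility.\<close>

lemma conn_skew:
  assumes q: "q \<in> U"
  shows "conn j k l q = - conn j l k q"
proof -
  have "E j q (\<lambda>r. g r (E k r) (E l r)) = E j q (\<lambda>r. if k = l then 1 else 0)"
    by (rule tangent_cong[OF frame_tangent[OF q] domain_open q]) (rule orthonormal_metric[OF frame_orthonormal])
  then have "0 = E j q (\<lambda>r. g r (E k r) (E l r))"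
    using tangent_deriv_const[OF frame_tangent[OF q]] by simp
  also have "\<dots> = g q (D q (E j q) (E k)) (E l q) + g q (E k q) (D q (E j q) (E l))"
    by (rule metric_derivative[OF domain_open frame_field frame_field q frame_tangent[OF q]])
  finally show ?thesis
    using metric_commute[OF frame_tangent[OF q, of k] cov_tangent[OF domain_open frame_field q frame_tangent[OF q]], of j l]
    by (simp add: conn_def)
qed

lemma curv_skew2:
  assumes q: "q \<in> U"
  shows "curv i j k l q = - curv i j l k q"
proof -
  have d: "E i q (conn j k l) = - E i q (conn j l k)" for i j
  proof -
    have "E i q (conn j k l) = E i q (\<lambda>r. - conn j l k r)"
      by (rule tangent_cong[OF frame_tangent[OF q] domain_open q]) (rule conn_skew)
    then show ?thesis
      using tangent_deriv_uminus[OF frame_tangent[OF q] frame_near[OF conn_smooth q]] by simp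
  qed
  have s1: "(\<Oplus>m. (conn i j m q - conn j i m q) * conn m k l q) =
      - (\<Oplus>m. (conn i j m q - conn j i m q) * conn m l k q)"
    unfolding sum_negf[symmetric] by (rule sum.cong[OF refl]) (simp add: conn_skew[OF q, of _ k l])
  \<comment> \<open>Reversing both factors exchanges the two products under the sum, so the
    quadratic term is skew in \<open>k\<close>, \<open>l\<close> as well.\<close>
  have "conn j k m q * conn i m l q = conn i l m q * conn j m k q" for i j m
    unfolding conn_skew[OF q, of j k m] conn_skew[OF q, of i m l] by simp
  then have s2: "(\<Oplus>m. conn j k m q * conn i m l q - conn i k m q * conn j m l q) =
      - (\<Oplus>m. conn j l m q * conn i m k q - conn i l m q * conn j m k q)"
    by (simp add: sum_subtractf)
  show ?thesis unfolding curv_def d s1 s2 by simp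
qed

lemma curv_smooth: "smooth_fun M U (curv i j k l)"
proof -
  have "curv i j k l = (\<lambda>q. - E i q (conn j k l) + E j q (conn i k l)
     + (\<Oplus>m. (conn i j m q - conn j i m q) * conn m k l q)
     - (\<Oplus>m. conn j k m q * conn i m l q - conn i k m q * conn j m l q))"
    by (rule ext) (rule curv_def)
  then show ?thesis
    by (simp only:) (intro smooth_intros
      frame_derivative_smooth conn_smooth domain_open)
qed

definition ric :: "4 \<Rightarrow> 4 \<Rightarrow> 'm \<Rightarrow> real" where
  "ric i j q = (\<Oplus>k. curv i k j k q)"

definition scal :: "'m \<Rightarrow> real" where
  "scal q = (\<Oplus>i. ric i i q)"

lemma ric_smooth: "smooth_fun M U (ric i j)"
proof -
  have "ric i j = (\<lambda>q. \<Oplus>k. curv i k j k q)" by (rule ext) (rule ric_def)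
  then show ?thesis by (simp only:) (intro smooth_fun_sum curv_smooth domain_open)
qed

lemma scal_smooth: "smooth_fun M U scal"
proof -
  have "scal = (\<lambda>q. \<Oplus>i. ric i i q)" by (rule ext) (rule scal_def)
  then show ?thesis by (simp only:) (intro smooth_fun_sum ric_smooth domain_open)
qed

lemma ricci_frame:
  assumes q: "q \<in> U" and u: "u \<in> T q" and v: "v \<in> T q"
  shows "ricci M D q u v = (\<Oplus>j. g q v (E j q) * (\<Oplus>i. g q u (E i q) * ric i j q))"
proof -
  let ?c = "\<lambda>j l. \<Oplus>k. g q v (E k q) * (\<Oplus>i. g q u (E i q) * curv i j k l q)"
  have "(\<Oplus>k. g q v (E k q) * (\<Oplus>i j. g q u (E i q) * g q z (E j q) * curv i j k l q)) =
      (\<Oplus>j. g q z (E j q) * ?c j l)" for z l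
  proof -
    have 1: "(\<Oplus>i j. g q u (E i q) * g q z (E j q) * curv i j k l q) =
        (\<Oplus>j. g q z (E j q) * (\<Oplus>i. g q u (E i q) * curv i j k l q))" for k
      by (subst sum.swap) (simp add: sum_distrib_left mult_ac)
    show ?thesis unfolding 1 sum_distrib_left by (subst sum.swap) (simp only: mult_ac)
  qed
  then have L: "curvature M D q u z v = lincomb (\<lambda>l. \<Oplus>j. g q z (E j q) * ?c j l) (\<lambda>l. E l q)"
    if "z \<in> T q" for z
    using curvature_frame[OF q u that v] by simp
  have "ricci M D q u v = (\<Oplus>j. ?c j j)"
    unfolding ricci_def by (rule tangent_trace_components[OF frame_orthonormal[OF q] L])
  also have "\<dots> = (\<Oplus>k j. g q v (E k q) * (\<Oplus>i. g q u (E i q) * curv i j k j q))"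
    by (rule sum.swap)
  also have "\<dots> = (\<Oplus>k. g q v (E k q) * (\<Oplus>i. g q u (E i q) * ric i k q))"
  proof (rule sum.cong[OF refl])
    fix k
    have "(\<Oplus>j i. g q u (E i q) * curv i j k j q) = (\<Oplus>i. g q u (E i q) * ric i k q)"
      unfolding ric_def sum_distrib_left by (rule sum.swap)
    then show "(\<Oplus>j. g q v (E k q) * (\<Oplus>i. g q u (E i q) * curv i j k j q)) =
        g q v (E k q) * (\<Oplus>i. g q u (E i q) * ric i k q)"
      unfolding sum_distrib_left[symmetric] by simp
  qed
  finally show ?thesis .
qed

lemma ricci_sharp_frame:
  assumes q: "q \<in> U" and u: "u \<in> T q"
  shows "ricci_sharp M g D q u = lincomb (\<lambda>j. \<Oplus>i. g q u (E i q) * ric i j q) (\<lambda>i. E i q)"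
proof -
  have r: "ricci M D q u (E j q) = (\<Oplus>i. g q u (E i q) * ric i j q)" for j
    using ricci_frame[OF q u frame_tangent[OF q, of j]] orthonormal_metric[OF frame_orthonormal[OF q]]
    by (simp add: if_distrib[of "\<lambda>x. x * _"] cong: if_cong)
  have "sharp M g q (ricci M D q u) = lincomb (\<lambda>j. ricci M D q u (E j q)) (\<lambda>i. E i q)"
    by (rule sharp_frame[OF frame_orthonormal[OF q]]) (unfold r, rule ricci_frame[OF q u])
  then show ?thesis unfolding ricci_sharp_def r .
qed

lemma scalar_curvature_frame:
  assumes q: "q \<in> U"
  shows "scalar_curvature M g D q = scal q"
  unfolding scalar_curvature_def scal_def
  by (rule tangent_trace_components[OF frame_orthonormal[OF q] ricci_sharp_frame[OF q]])

lemma gradient_frame: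
  assumes q: "q \<in> U"
  shows "gradient M g h q = lincomb (\<lambda>i. E i q h) (\<lambda>i. E i q)"
  unfolding gradient_def by (rule sharp_frame[OF frame_orthonormal[OF q]]) (rule expand_apply[OF q])

lemma divergence_frame:
  assumes Y: "vector_field M U Y" and q: "q \<in> U"
  shows "divergence M D Y q = (\<Oplus>i. E i q (comp Y i) + (\<Oplus>k. comp Y k q * conn i k i q))"
proof -
  let ?c = "\<lambda>j l. E j q (comp Y l) + (\<Oplus>k. comp Y k q * conn j k l q)"
  have "D q z Y = lincomb (\<lambda>l. \<Oplus>j. g q z (E j q) * ?c j l) (\<lambda>l. E l q)" if z: "z \<in> T q" for z
  proof -
    have "g q (D q z Y) (E l q) = (\<Oplus>j. g q z (E j q) * ?c j l)" for l
    proof -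
      have 1: "(\<Oplus>k. comp Y k q * (\<Oplus>j. g q z (E j q) * conn j k l q)) =
          (\<Oplus>j. g q z (E j q) * (\<Oplus>k. comp Y k q * conn j k l q))"
        unfolding sum_distrib_left by (subst sum.swap) (simp only: mult_ac)
      show ?thesis
        unfolding comp_cov_tangent[OF domain_open subset_refl Y q z] 1 expand_apply[OF q z, of "comp Y l"]
        by (simp only: distrib_left sum.distrib)
    qed
    then show ?thesis
      using frame_expansion[OF frame_orthonormal[OF q] cov_tangent[OF domain_open Y q z]] by simp
  qed
  then show ?thesis
    unfolding divergence_def by (rule tangent_trace_components[OF frame_orthonormal[OF q]])
qed

lemma frame_field_lincomb:
  "(\<And>i. smooth_fun M U (a i)) \<Longrightarrow> vector_field M U (\<lambda>q. lincomb (\<lambda>i. a i q) (\<lambda>i. E i q))"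
  unfolding lincomb_def by (intro vector_field_lincomb domain_open frame_field)

lemma lincomb_field:
  assumes a: "\<And>i. smooth_fun M U (a i)"
    and Y: "\<And>q. q \<in> U \<Longrightarrow> Y q = lincomb (\<lambda>i. a i q) (\<lambda>i. E i q)"
  shows "vector_field M U Y" and "q \<in> U \<Longrightarrow> comp Y i q = a i q"
proof -
  show "vector_field M U Y"
    by (rule vector_field_cong[OF frame_field_lincomb[OF a]]) (simp add: Y)
  show "comp Y i q = a i q" if "q \<in> U"
    unfolding comp_def Y[OF that] by (rule metric_lincomb_E[OF that])
qed

lemma divergence_lincomb:
  assumes a: "\<And>i. smooth_fun M U (a i)"
    and Y: "\<And>q. q \<in> U \<Longrightarrow> Y q = lincomb (\<lambda>i. a i q) (\<lambda>i. E i q)"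
    and q: "q \<in> U"
  shows "divergence M D Y q = (\<Oplus>i. E i q (a i) + (\<Oplus>k. a k q * conn i k i q))"
proof -
  have 1: "E i q (comp Y i) = E i q (a i)" for i
    by (rule tangent_cong[OF frame_tangent[OF q] domain_open q lincomb_field(2)[OF a Y]])
  have 2: "comp Y k q = a k q" for k
    by (rule lincomb_field(2)[OF a Y q])
  have "vector_field M U Y"
    by (rule lincomb_field(1)[OF a Y])
  from divergence_frame[OF this q] show ?thesis
    unfolding 1 2 .
qed

end

text \<open>A frame that is parallel at \<open>p\<close>: there its connection coefficients vanish and its members
  commute as derivations, so that covariant derivatives at \<open>p\<close> are derivatives of components.\<close>

locale adapted_frame = levi_civita_frame M g D U E
  for M :: "'m manifold" and g D U E +
  fixes p :: 'm and f :: "'m \<Rightarrow> real"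
  assumes base_point: "p \<in> U"
    and parallel: "\<And>i v. v \<in> T p \<Longrightarrow> D p v (E i) = tzero"
    and f_smooth: "smooth_fun M U f"
begin

definition df :: "4 \<Rightarrow> 'm \<Rightarrow> real" where
  "df i q = E i q f"

text \<open>The components of the covariant derivative of the gradient. The connection term is kept
  because \<open>hess\<close> is itself differentiated at \<open>p\<close>.\<close>

definition hess :: "4 \<Rightarrow> 4 \<Rightarrow> 'm \<Rightarrow> real" where
  "hess i j q = E i q (df j) + (\<Oplus>k. df k q * conn i k j q)"

lemma df_smooth: "smooth_fun M U (df i)"
proof -
  have "df i = (\<lambda>q. E i q f)" by (rule ext) (rule df_def)
  then show ?thesis using frame_derivative_smooth[OF f_smooth] by simp
qed

lemma hess_smooth: "smooth_fun M U (hess i j)"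
proof -
  have "hess i j = (\<lambda>q. E i q (df j) + (\<Oplus>k. df k q * conn i k j q))" by (rule ext) (rule hess_def)
  then show ?thesis
    by (simp only:) (intro smooth_intros
        frame_derivative_smooth conn_smooth df_smooth domain_open)
qed

lemma frame_commutator:
  assumes q: "q \<in> U" and h: "smooth_near M q h"
  shows "E i q (\<lambda>r. E j r h) - E j q (\<lambda>r. E i r h) = (\<Oplus>l. (conn i j l q - conn j i l q) * E l q h)"
proof -
  have D: "D q (E i q) (E j) h = (\<Oplus>l. conn i j l q * E l q h)" for i j
    using expand_apply[OF q cov_tangent[OF domain_open frame_field q frame_tangent[OF q]]]
    by (simp add: conn_def)
  have "E i q (\<lambda>r. E j r h) - E j q (\<lambda>r. E i r h) = lie_bracket M (E i) (E j) q h"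
    using h by (simp add: lie_bracket_def)
  also have "\<dots> = D q (E i q) (E j) h - D q (E j q) (E i) h"
    by (rule fun_cong[OF lie_bracket_eq[OF domain_open frame_field frame_field q]])
  finally show ?thesis unfolding D by (simp add: left_diff_distrib sum_subtractf)
qed

lemma hess_commute:
  assumes q: "q \<in> U"
  shows "hess i j q = hess j i q"
proof -
  have d: "df j = (\<lambda>r. E j r f)" for j by (rule ext) (rule df_def)
  \<comment> \<open>By skewness the connection terms take the form in which the bracket of
    \<open>E i\<close> and \<open>E j\<close> acts on \<open>f\<close>.\<close>
  have s: "(\<Oplus>k. df k q * conn i k j q) = - (\<Oplus>k. conn i j k q * df k q)" for i j
    unfolding sum_negf[symmetric] by (rule sum.cong[OF refl]) (simp add: conn_skew[OF q, of i _ j])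
  have "E i q (df j) - E j q (df i) = (\<Oplus>k. conn i j k q * df k q) - (\<Oplus>k. conn j i k q * df k q)"
    using frame_commutator[OF q frame_near[OF f_smooth q], of i j]
    by (simp add: d left_diff_distrib sum_subtractf)
  then show ?thesis unfolding hess_def s by simp
qed

lemma gradient_f: "q \<in> U \<Longrightarrow> gradient M g f q = lincomb (\<lambda>i. df i q) (\<lambda>i. E i q)"
  unfolding df_def by (rule gradient_frame)

lemma laplacian_frame: "q \<in> U \<Longrightarrow> laplacian M g D f q = (\<Oplus>i. hess i i q)"
  unfolding laplacian_def hess_def by (rule divergence_lincomb[OF df_smooth gradient_f])

lemma sq_norm_frame:
  assumes q: "q \<in> U"
  shows "sq_norm g (gradient M g f) q = (\<Oplus>i. (df i q)\<^sup>2)"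
proof -
  have "g q (lincomb a (\<lambda>i. E i q)) (lincomb a (\<lambda>i. E i q)) = (\<Oplus>i. a i * a i)" for a
    using metric_frame[OF frame_orthonormal[OF q] lincomb_E_tangent[OF q] lincomb_E_tangent[OF q], of a a]
    by (simp only: metric_lincomb_E[OF q])
  then show ?thesis
    unfolding sq_norm_def gradient_f[OF q] power2_eq_square .
qed

lemma deriv_sq_norm:
  assumes q: "q \<in> U"
  shows "E i q (sq_norm g (gradient M g f)) = 2 * (\<Oplus>j. df j q * hess i j q)"
proof -
  \<comment> \<open>A product symmetric in \<open>j\<close>, \<open>k\<close> contracted with the
    skew \<open>conn\<close>: it vanishes, so plain derivatives of \<open>df\<close> may be replaced
    by \<open>hess\<close>.\<close>
  let ?S = "\<Oplus>j k. df j q * df k q * conn i k j q"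
  have "?S = (\<Oplus>k j. df j q * df k q * conn i k j q)"
    by (rule sum.swap)
  also have "\<dots> = - ?S"
    unfolding sum_negf[symmetric] by (intro sum.cong refl, subst conn_skew[OF q]) simp
  finally have S: "?S = 0" by simp
  have "E i q (sq_norm g (gradient M g f)) = E i q (\<lambda>r. \<Oplus>j. (df j r)\<^sup>2)"
    by (rule tangent_cong[OF frame_tangent[OF q] domain_open q sq_norm_frame])
  also have "\<dots> = 2 * (\<Oplus>j. df j q * E i q (df j))"
    unfolding power2_eq_square using frame_near[OF df_smooth q]
    by (simp add: tangent_deriv_sum[OF frame_tangent[OF q]] tangent_deriv_mult[OF frame_tangent[OF q]]
        smooth_near_mult sum_distrib_left mult.commute)
  also have "\<dots> = 2 * (\<Oplus>j. df j q * hess i j q)"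
    using S by (simp add: hess_def distrib_left sum.distrib sum_distrib_left mult.assoc)
  finally show ?thesis .
qed

definition P_comp :: "4 \<Rightarrow> 'm \<Rightarrow> real" where
  "P_comp i q = (2 * (\<Oplus>k. hess k k q) + (\<Oplus>k. (df k q)\<^sup>2) - 2 * scal q) * df i q
    + 4 * (\<Oplus>j. df j q * ric j i q) - 2 * (\<Oplus>j. df j q * hess i j q)"

lemma P_field_frame:
  assumes q: "q \<in> U"
  shows "P_field M g D f q = lincomb (\<lambda>i. P_comp i q) (\<lambda>i. E i q)"
proof -
  have "ricci_sharp M g D q (gradient M g f q) = lincomb (\<lambda>i. \<Oplus>j. df j q * ric j i q) (\<lambda>i. E i q)"
    unfolding gradient_f[OF q] ricci_sharp_frame[OF q lincomb_E_tangent[OF q]] metric_lincomb_E[OF q] ..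
  moreover have "gradient M g (sq_norm g (gradient M g f)) q =
      lincomb (\<lambda>i. 2 * (\<Oplus>j. df j q * hess i j q)) (\<lambda>i. E i q)"
    unfolding gradient_frame[OF q] deriv_sq_norm[OF q] ..
  ultimately show ?thesis
    unfolding P_field_def Let_def laplacian_frame[OF q] sq_norm_frame[OF q] scalar_curvature_frame[OF q]
    by (simp only: gradient_f[OF q] tscale_lincomb tadd_lincomb P_comp_def) (simp add: algebra_simps)
qed

lemma P_comp_smooth: "smooth_fun M U (P_comp i)"
proof -
  have "P_comp i = (\<lambda>q. (2 * (\<Oplus>k. hess k k q) + (\<Oplus>k. df k q * df k q) - 2 * scal q) * df i q
    + 4 * (\<Oplus>j. df j q * ric j i q) - 2 * (\<Oplus>j. df j q * hess i j q))"
    by (rule ext) (simp only: P_comp_def power2_eq_square)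
  then show ?thesis
    by (simp only:) (intro smooth_intros
        hess_smooth df_smooth scal_smooth ric_smooth domain_open)
qed

section \<open>Derivatives at the base point\<close>

abbreviation "dp i h \<equiv> E i p h"

lemma p_frame_tangent: "E i p \<in> T p"
  by (rule frame_tangent[OF base_point])

lemma near: "smooth_fun M U h \<Longrightarrow> smooth_near M p h"
  by (rule frame_near[OF _ base_point])

lemma conn_zero: "conn j k l p = 0"
  unfolding conn_def parallel[OF p_frame_tangent] by (rule metric_zero_left[OF p_frame_tangent])

lemma partial_commute: "smooth_fun M U h \<Longrightarrow> dp i (\<lambda>q. E j q h) = dp j (\<lambda>q. E i q h)"
  using frame_commutator[OF base_point near, of h i j] by (simp add: conn_zero)

lemma curv_p: "curv i j k l p = - dp i (conn j k l) + dp j (conn i k l)"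
  by (simp add: curv_def conn_zero)

text \<open>In the quadratic terms of \<open>curv\<close> both factors vanish at \<open>p\<close>,
  so their first derivatives vanish too.\<close>

lemma partial_curv:
  "dp m (curv i j k l) = - dp m (\<lambda>q. E i q (conn j k l)) + dp m (\<lambda>q. E j q (conn i k l))"
proof -
  let ?A = "\<lambda>q. \<Oplus>n. (conn i j n q - conn j i n q) * conn n k l q"
  let ?B = "\<lambda>q. \<Oplus>n. conn j k n q * conn i n l q - conn i k n q * conn j n l q"
  have c: "smooth_fun M U (conn a b c)" for a b c by (rule conn_smooth)
  have A: "smooth_fun M U ?A" and B: "smooth_fun M U ?B"
    by (intro smooth_intros conn_smooth domain_open)+
  have "dp m ?A = (\<Oplus>n. dp m (\<lambda>q. (conn i j n q - conn j i n q) * conn n k l q))"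
    by (rule tangent_deriv_sum[OF p_frame_tangent near])
      (intro smooth_intros conn_smooth domain_open)
  also have "\<dots> = 0"
    by (rule sum.neutral, rule ballI, subst tangent_deriv_mult[OF p_frame_tangent near near])
      (auto intro: smooth_fun_diff conn_smooth domain_open simp: conn_zero)
  finally have dA: "dp m ?A = 0" .
  have "dp m ?B = (\<Oplus>n. dp m (\<lambda>q. conn j k n q * conn i n l q - conn i k n q * conn j n l q))"
    by (rule tangent_deriv_sum[OF p_frame_tangent near])
      (intro smooth_intros conn_smooth domain_open)
  also have "\<dots> = 0"
  proof (rule sum.neutral, rule ballI)
    fix n
    have "dp m (\<lambda>q. conn a b c q * conn a' b' c' q) = 0" for a b c a' b' c'
      by (simp add: tangent_deriv_mult[OF p_frame_tangent near[OF conn_smooth] near[OF conn_smooth]] conn_zero)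
    then show "dp m (\<lambda>q. conn j k n q * conn i n l q - conn i k n q * conn j n l q) = 0"
      by (subst tangent_deriv_diff[OF p_frame_tangent near near])
        (auto intro: smooth_fun_mult conn_smooth domain_open)
  qed
  finally have dB: "dp m ?B = 0" .
  have i: "smooth_fun M U (\<lambda>q. E i q (conn j k l))" for i j k l
    by (rule frame_derivative_smooth[OF conn_smooth])
  have "curv i j k l = (\<lambda>q. - E i q (conn j k l) + E j q (conn i k l) + ?A q - ?B q)"
    by (rule ext) (rule curv_def)
  then have 1: "dp m (curv i j k l) = dp m (\<lambda>q. - E i q (conn j k l) + E j q (conn i k l) + ?A q - ?B q)"
    by simp
  have 2: "dp m (\<lambda>q. - E i q (conn j k l) + E j q (conn i k l) + ?A q - ?B q) =
      dp m (\<lambda>q. - E i q (conn j k l) + E j q (conn i k l) + ?A q) - dp m ?B"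
    by (rule tangent_deriv_diff[OF p_frame_tangent near near])
      (intro smooth_intros i A B domain_open)+
  have 3: "dp m (\<lambda>q. - E i q (conn j k l) + E j q (conn i k l) + ?A q) =
      dp m (\<lambda>q. - E i q (conn j k l) + E j q (conn i k l)) + dp m ?A"
    by (rule tangent_deriv_add[OF p_frame_tangent near near])
      (intro smooth_intros i A B domain_open)+
  have 4: "dp m (\<lambda>q. - E i q (conn j k l) + E j q (conn i k l)) =
     dp m (\<lambda>q. - E i q (conn j k l)) + dp m (\<lambda>q. E j q (conn i k l))"
    by (rule tangent_deriv_add[OF p_frame_tangent near near])
      (intro smooth_fun_uminus i domain_open)+
  have 5: "dp m (\<lambda>q. - E i q (conn j k l)) = - dp m (\<lambda>q. E i q (conn j k l))"
    by (rule tangent_deriv_uminus[OF p_frame_tangent near[OF i]])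
  show ?thesis unfolding 1 2 3 4 5 dA dB by simp
qed

text \<open>At \<open>p\<close> the covariant derivatives of curvature are plain ones and frame
  derivatives commute, so the six second derivatives of \<open>conn\<close> cancel in pairs.\<close>

lemma second_bianchi:
  "dp m (curv i j k l) + dp i (curv j m k l) + dp j (curv m i k l) = 0"
  unfolding partial_curv
  using partial_commute[OF conn_smooth, of m i j k l] partial_commute[OF conn_smooth, of i j m k l]
    partial_commute[OF conn_smooth, of j m i k l] by simp

text \<open>The Jacobi identity for the frame fields at \<open>p\<close>: the curvature sum is the
  cyclic sum of derivatives of the structure functions, up to sign.\<close>

lemma first_bianchi: "curv i j k l p + curv j k i l p + curv k i j l p = 0"
proof -
  \<comment> \<open>The structure functions of the frame: by torsion-freeness these are the
    components of the brackets of its members.\<close>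
  define c where "c = (\<lambda>j k l q. conn j k l q - conn k j l q)"
  have c: "smooth_fun M U (c j k l)" for j k l
    unfolding c_def by (intro smooth_fun_diff conn_smooth domain_open)
  have dc: "dp i (c j k l) = dp i (conn j k l) - dp i (conn k j l)" for i j k l
    unfolding c_def by (rule tangent_deriv_diff[OF p_frame_tangent near near]) (rule conn_smooth)+
  have cz: "c j k l p = 0" for j k l by (simp add: c_def conn_zero)
  define \<gamma> where "\<gamma> = (\<lambda>l. dp i (c j k l) + dp j (c k i l) + dp k (c i j l))"
  have jac: "dp i (\<lambda>q. E j q (\<lambda>r. E k r h)) - dp i (\<lambda>q. E k q (\<lambda>r. E j r h)) = (\<Oplus>l. dp i (c j k l) * dp l h)"
    if h: "smooth_fun M W h" and W: "openin (topo M) W" "p \<in> W" "W \<subseteq> U" for h W i j k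
  proof -
    have EW: "smooth_fun M W (\<lambda>r. E j r h)" if "smooth_fun M W h" for j h
      by (rule vector_field_smooth[OF frame_field W(1,3) that])
    have n: "smooth_fun M W h \<Longrightarrow> smooth_near M p h" for h by (rule smooth_nearI[OF W(1,2)])
    have cW: "smooth_fun M W (c j k l)" for j k l by (rule smooth_fun_subset[OF c W(3)])
    have "dp i (\<lambda>q. E j q (\<lambda>r. E k r h)) - dp i (\<lambda>q. E k q (\<lambda>r. E j r h)) =
        dp i (\<lambda>q. E j q (\<lambda>r. E k r h) - E k q (\<lambda>r. E j r h))"
      by (rule tangent_deriv_diff[OF p_frame_tangent n n, symmetric]) (intro EW h)+
    also have "\<dots> = dp i (\<lambda>q. \<Oplus>l. c j k l q * E l q h)"
    proof (rule tangent_cong[OF p_frame_tangent W(1,2)])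
      show "E j q (\<lambda>r. E k r h) - E k q (\<lambda>r. E j r h) = (\<Oplus>l. c j k l q * E l q h)" if "q \<in> W" for q
        unfolding c_def by (rule frame_commutator) (use that W(3) smooth_nearI[OF W(1) that h] in auto)
    qed
    also have "\<dots> = (\<Oplus>l. dp i (\<lambda>q. c j k l q * E l q h))"
      by (rule tangent_deriv_sum[OF p_frame_tangent n]) (intro smooth_fun_mult W(1) cW EW h)
    also have "\<dots> = (\<Oplus>l. dp i (c j k l) * dp l h)"
      by (rule sum.cong[OF refl], subst tangent_deriv_mult[OF p_frame_tangent n n])
        (simp_all add: cz cW EW h)
    finally show ?thesis .
  qed
  have "lincomb \<gamma> (\<lambda>l. E l p) h = 0" for h
  proof (cases "smooth_near M p h")
    case True
    then obtain W where W: "openin (topo M) W" "p \<in> W" "smooth_fun M W h" unfolding smooth_near_def by blast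
    define W' where "W' = W \<inter> U"
    have W': "openin (topo M) W'" "p \<in> W'" "W' \<subseteq> U" "smooth_fun M W' h"
      using W domain_open base_point smooth_fun_subset[OF W(3)] by (auto simp: W'_def)
    have n: "smooth_near M p (\<lambda>r. E j r h)" for j
      by (rule smooth_nearI[OF W'(1,2) vector_field_smooth[OF frame_field W'(1,3,4)]])
    \<comment> \<open>The outer two derivations commute at \<open>p\<close>, which cancels the six
      third derivatives of \<open>h\<close> in the cyclic sum.\<close>
    have com: "dp i (\<lambda>q. E j q (\<lambda>r. E k r h)) = dp j (\<lambda>q. E i q (\<lambda>r. E k r h))" for i j k
      using frame_commutator[OF base_point n, of i j] by (simp add: conn_zero)
    have "(\<Oplus>l. \<gamma> l * dp l h) = (\<Oplus>l. dp i (c j k l) * dp l h)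
        + (\<Oplus>l. dp j (c k i l) * dp l h) + (\<Oplus>l. dp k (c i j l) * dp l h)"
      by (simp only: \<gamma>_def distrib_right sum.distrib)
    also have "\<dots> = 0"
      unfolding jac[OF W'(4,1,2,3), symmetric]
      using com[of i j k] com[of j k i] com[of k i j] by simp
    finally show ?thesis by (simp add: lincomb_apply)
  next
    case False
    then show ?thesis by (simp add: lincomb_apply tangent_not_smooth[OF p_frame_tangent])
  qed
  then have z: "lincomb \<gamma> (\<lambda>l. E l p) = tzero" unfolding tzero_def by blast
  have "\<gamma> l = 0"
    using metric_lincomb_E[OF base_point, of \<gamma> l] metric_zero_left[OF p_frame_tangent, of l] unfolding z by simp
  then show ?thesis unfolding curv_p \<gamma>_def dc by simp
qed

end

section \<open>Bianchi identities and the divergence of the field P\<close>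

context adapted_frame
begin

lemma partial_cong: "(\<And>q. q \<in> U \<Longrightarrow> h q = k q) \<Longrightarrow> dp i h = dp i k"
  by (rule tangent_cong[OF p_frame_tangent domain_open base_point])

lemma partial_sum: "(\<And>k. smooth_fun M U (a k)) \<Longrightarrow> dp i (\<lambda>q. \<Oplus>k. a k q) = (\<Sum>k\<in>(UNIV :: 4 set). dp i (a k))"
  by (rule tangent_deriv_sum[OF p_frame_tangent near])

lemma partial_mult: "smooth_fun M U a \<Longrightarrow> smooth_fun M U b \<Longrightarrow> dp i (\<lambda>q. a q * b q) = dp i a * b p + a p * dp i b"
  by (rule tangent_deriv_mult[OF p_frame_tangent near near])

lemma partial_ric: "dp m (ric i j) = (\<Oplus>k. dp m (curv i k j k))"
  using partial_cong[of "ric i j" "\<lambda>q. \<Oplus>k. curv i k j k q" m]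
  by (simp add: ric_def partial_sum[OF curv_smooth])

lemma partial_scal: "dp m scal = (\<Oplus>j k. dp m (curv j k j k))"
  using partial_cong[of scal "\<lambda>q. \<Oplus>k. ric k k q" m]
  by (simp add: scal_def partial_sum[OF ric_smooth] partial_ric)

lemma partial_curv_skew: "dp m (curv i j k l) = - dp m (curv j i k l)" "dp m (curv i j k l) = - dp m (curv i j l k)"
proof -
  have "dp m (curv i j k l) = dp m (\<lambda>q. - curv j i k l q)"
    by (rule partial_cong) (rule curv_skew1)
  then show "dp m (curv i j k l) = - dp m (curv j i k l)"
    using tangent_deriv_uminus[OF p_frame_tangent near[OF curv_smooth]] by simp
  have "dp m (curv i j k l) = dp m (\<lambda>q. - curv i j l k q)"
    by (rule partial_cong) (rule curv_skew2)
  then show "dp m (curv i j k l) = - dp m (curv i j l k)"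
    using tangent_deriv_uminus[OF p_frame_tangent near[OF curv_smooth]] by simp
qed

text \<open>The second Bianchi identity traced over two index pairs; it says that the Einstein
  tensor is divergence-free at \<open>p\<close>.\<close>

lemma contracted_bianchi: "2 * (\<Oplus>m. dp m (ric i m)) = dp i scal"
proof -
  have "dp m (curv i j m j) + dp j (curv i m j m) = dp i (curv j m j m)" for m j
    using second_bianchi[of m i j m j] partial_curv_skew(2)[of i j m m j]
      partial_curv_skew(1)[of j m i m j] partial_curv_skew(2)[of j i m m j] by linarith
  then have "(\<Oplus>j m. dp m (curv i j m j) + dp j (curv i m j m)) =
      (\<Oplus>j m. dp i (curv j m j m))"
    by simp
  moreover have "(\<Oplus>j m. dp m (curv i j m j)) = (\<Oplus>m j. dp m (curv i j m j))"
    by (rule sum.swap)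
  ultimately show ?thesis unfolding partial_ric partial_scal sum.distrib by linarith
qed

lemma partial_df: "dp i (df j) = hess i j p"
  by (simp add: hess_def conn_zero)

lemma partial_hess: "dp i (hess k l) = dp i (\<lambda>q. E k q (df l)) + (\<Oplus>j. df j p * dp i (conn k j l))"
proof -
  have s: "smooth_fun M U (\<lambda>q. E k q (df l))" "smooth_fun M U (\<lambda>q. \<Oplus>j. df j q * conn k j l q)"
    by (intro frame_derivative_smooth df_smooth smooth_intros conn_smooth domain_open)+
  have "dp i (\<lambda>q. \<Oplus>j. df j q * conn k j l q) = (\<Oplus>j. dp i (\<lambda>q. df j q * conn k j l q))"
    by (rule partial_sum) (intro smooth_fun_mult df_smooth conn_smooth domain_open)
  moreover have "dp i (hess k l) = dp i (\<lambda>q. E k q (df l) + (\<Oplus>j. df j q * conn k j l q))"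
    by (rule partial_cong) (rule hess_def)
  ultimately show ?thesis
    by (simp add: tangent_deriv_add[OF p_frame_tangent near[OF s(1)] near[OF s(2)]]
        partial_mult[OF df_smooth conn_smooth] conn_zero)
qed

text \<open>Second derivatives of \<open>df\<close> commute at \<open>p\<close>, so only derivatives
  of \<open>conn\<close> remain, and these form the curvature.\<close>

lemma ricci_identity: "dp i (hess k l) - dp k (hess i l) = - (\<Oplus>j. df j p * curv i k j l p)"
  using partial_commute[OF df_smooth, of i k l]
  by (simp add: partial_hess curv_p distrib_left right_diff_distrib sum.distrib sum_subtractf sum_negf)

text \<open>P splits into three parts. The Einstein tensor part contributes its contraction with the
  Hessian; \<open>2 * laplacian * grad f - grad |grad f|\<^sup>2\<close> contributes
  \<open>2 H\<^sup>2 - 2 |hess|\<^sup>2 - 2 Ric (grad f, grad f)\<close> by the Bochner formula;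
  \<open>|grad f|\<^sup>2 * grad f\<close> contributes the terms cubic in \<open>f\<close>.\<close>

lemma divergence_P:
  "divergence M D (P_field M g D f) p =
     2 * (\<Oplus>i. hess i i p)\<^sup>2 - 2 * (\<Oplus>i j. (hess i j p)\<^sup>2)
     + 2 * (\<Oplus>i j. hess i j p * df i p * df j p)
     + (\<Oplus>i. (df i p)\<^sup>2) * (\<Oplus>i. hess i i p) - 2 * scal p * (\<Oplus>i. hess i i p)
     + 4 * (\<Oplus>i j. ric i j p * hess i j p)
     - 2 * (\<Oplus>i j. ric i j p * df i p * df j p)"
proof -
  define H where "H = (\<lambda>q. \<Oplus>k. hess k k q)"
  define N where "N = (\<lambda>q. \<Oplus>k. (df k q)\<^sup>2)"
  have Hs: "smooth_fun M U H" unfolding H_def by (intro smooth_fun_sum hess_smooth domain_open)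
  have Ns: "smooth_fun M U N"
    unfolding N_def power2_eq_square by (intro smooth_intros df_smooth domain_open)
  have dH: "dp i H = (\<Oplus>k. dp i (hess k k))" for i
    unfolding H_def by (rule partial_sum[OF hess_smooth])
  have dN: "dp i N = 2 * (\<Oplus>j. df j p * hess i j p)" for i
    using deriv_sq_norm[OF base_point, of i] partial_cong[OF sq_norm_frame] by (simp add: N_def)
  have dP: "dp i (P_comp i) = (2 * dp i H + dp i N - 2 * dp i scal) * df i p + (2 * H p + N p - 2 * scal p) * hess i i p
      + 4 * (\<Oplus>j. hess i j p * ric j i p + df j p * dp i (ric j i))
      - 2 * (\<Oplus>j. hess i j p * hess i j p + df j p * dp i (hess i j))" for i
  proof -
    let ?a = "\<lambda>q. 2 * H q + N q - 2 * scal q" and ?b = "\<lambda>q. \<Oplus>j. df j q * ric j i q"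
      and ?c = "\<lambda>q. \<Oplus>j. df j q * hess i j q"
    have s: "smooth_fun M U (\<lambda>q. 2 * H q)" "smooth_fun M U (\<lambda>q. 2 * scal q)" "smooth_fun M U (\<lambda>q. 2 * H q + N q)"
      "smooth_fun M U ?a" "smooth_fun M U ?b" "smooth_fun M U ?c"
      "smooth_fun M U (\<lambda>q. ?a q * df i q)" "smooth_fun M U (\<lambda>q. 4 * ?b q)" "smooth_fun M U (\<lambda>q. 2 * ?c q)"
      "smooth_fun M U (\<lambda>q. ?a q * df i q + 4 * ?b q)"
      by (intro smooth_intros
          Hs Ns scal_smooth df_smooth ric_smooth hess_smooth domain_open)+
    have b: "dp i ?b = (\<Oplus>j. hess i j p * ric j i p + df j p * dp i (ric j i))"
    proof -
      have "dp i ?b = (\<Oplus>j. dp i (\<lambda>q. df j q * ric j i q))"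
        by (rule partial_sum) (intro smooth_fun_mult df_smooth ric_smooth domain_open)
      then show ?thesis by (simp add: partial_mult[OF df_smooth ric_smooth] partial_df)
    qed
    have c: "dp i ?c = (\<Oplus>j. hess i j p * hess i j p + df j p * dp i (hess i j))"
    proof -
      have "dp i ?c = (\<Oplus>j. dp i (\<lambda>q. df j q * hess i j q))"
        by (rule partial_sum) (intro smooth_fun_mult df_smooth hess_smooth domain_open)
      then show ?thesis by (simp add: partial_mult[OF df_smooth hess_smooth] partial_df)
    qed
    have a: "dp i ?a = 2 * dp i H + dp i N - 2 * dp i scal"
      by (simp add: tangent_deriv_diff[OF p_frame_tangent near[OF s(3)] near[OF s(2)]]
          tangent_deriv_add[OF p_frame_tangent near[OF s(1)] near[OF Ns]]
          tangent_deriv_cmult[OF p_frame_tangent near[OF Hs]] tangent_deriv_cmult[OF p_frame_tangent near[OF scal_smooth]])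
    have "dp i (P_comp i) = dp i (\<lambda>q. ?a q * df i q + 4 * ?b q - 2 * ?c q)"
      by (rule partial_cong) (simp only: P_comp_def H_def N_def)
    then show ?thesis
      by (simp only: tangent_deriv_diff[OF p_frame_tangent near[OF s(10)] near[OF s(9)]]
          tangent_deriv_add[OF p_frame_tangent near[OF s(7)] near[OF s(8)]]
          tangent_deriv_cmult[OF p_frame_tangent near[OF s(5)]] tangent_deriv_cmult[OF p_frame_tangent near[OF s(6)]]
          partial_mult[OF s(4) df_smooth] a b c partial_df)
  qed
  have hc: "dp k (hess i j) = dp k (hess j i)" for i j k
    by (rule partial_cong) (rule hess_commute)
  have "(\<Oplus>k. dp i (hess k k)) - (\<Oplus>k. dp k (hess i k)) = - (\<Oplus>j. df j p * ric i j p)" for i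
  proof -
    have "(\<Oplus>k. dp i (hess k k)) - (\<Oplus>k. dp k (hess i k)) =
        (\<Oplus>k. - (\<Oplus>j. df j p * curv i k j k p))"
      unfolding ricci_identity[symmetric] sum_subtractf ..
    also have "\<dots> = - (\<Oplus>j. df j p * ric i j p)"
      unfolding ric_def sum_distrib_left sum_negf by (subst sum.swap) (rule refl)
    finally show ?thesis .
  qed
  \<comment> \<open>The traced Ricci identity: the gradient of the Laplacian against the divergence
    of the Hessian.\<close>
  then have bochner: "dp i H = (\<Oplus>k. dp k (hess i k)) - (\<Oplus>j. df j p * ric i j p)" for i
    unfolding dH by (simp add: algebra_simps)
  \<comment> \<open>Symmetry of the Hessian matches these third derivatives with those in
    \<open>bochner\<close>, so that they cancel below.\<close>
  have S: "(\<Oplus>i j. df j p * dp i (hess i j)) = (\<Oplus>i k. df i p * dp k (hess i k))"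
    unfolding hc[of _ _ _] by (subst sum.swap) (simp add: hc)
  \<comment> \<open>The divergence of the Ricci tensor becomes half the derivative of
    \<open>scal\<close> and cancels the derivative of the summand \<open>- 2 * scal\<close>.\<close>
  have R: "(\<Oplus>i j. df j p * dp i (ric j i)) = (\<Oplus>i. dp i scal * df i p) / 2"
  proof -
    have "(\<Oplus>i j. df j p * dp i (ric j i)) = (\<Oplus>j. df j p * (\<Oplus>i. dp i (ric j i)))"
      unfolding sum_distrib_left by (rule sum.swap)
    also have "\<dots> = (\<Oplus>j. dp j scal * df j p) / 2"
      unfolding contracted_bianchi[symmetric] by (simp add: sum_divide_distrib mult.commute)
    finally show ?thesis .
  qed
  have "divergence M D (P_field M g D f) p = (\<Oplus>i. dp i (P_comp i))"
    using divergence_lincomb[where a = P_comp, OF P_comp_smooth P_field_frame base_point]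
    by (simp add: conn_zero)
  also have "\<dots> = 2 * (\<Oplus>i. dp i H * df i p) + (\<Oplus>i. dp i N * df i p) - 2 * (\<Oplus>i. dp i scal * df i p)
      + (2 * H p + N p - 2 * scal p) * H p
      + 4 * (\<Oplus>i j. hess i j p * ric j i p) + 4 * (\<Oplus>i j. df j p * dp i (ric j i))
      - 2 * (\<Oplus>i j. hess i j p * hess i j p) - 2 * (\<Oplus>i j. df j p * dp i (hess i j))"
    unfolding dP by (simp add: sum.distrib sum_subtractf distrib_right left_diff_distrib
        sum_distrib_left[symmetric] mult.assoc H_def)
  finally have E: "divergence M D (P_field M g D f) p = \<dots>" .
  have h1: "(\<Oplus>i. dp i H * df i p) = (\<Oplus>i k. df i p * dp k (hess i k))
      - (\<Oplus>i j. ric i j p * df i p * df j p)"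
    unfolding bochner left_diff_distrib sum_subtractf by (simp add: sum_distrib_left mult_ac)
  have h2: "(\<Oplus>i. dp i N * df i p) = 2 * (\<Oplus>i j. hess i j p * df i p * df j p)"
    unfolding dN by (simp add: sum_distrib_right sum_distrib_left mult_ac)
  have h3: "(\<Oplus>i j. hess i j p * ric j i p) = (\<Oplus>i j. ric i j p * hess i j p)"
    by (subst sum.swap) (simp add: hess_commute[OF base_point, of _ _] mult.commute)
  show ?thesis
    unfolding E h1 h2 h3 S R by (simp add: H_def N_def power2_eq_square algebra_simps)
qed

end

section \<open>Conformal change\<close>

context torsion_free_frame
begin

text \<open>The right-hand side does not mention the connection, so two torsion-free connections
  differ by a tensor symmetric in \<open>j\<close>, \<open>k\<close>.\<close>

lemma conn_torsion:
  assumes q: "q \<in> U"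
  shows "conn j k l q - conn k j l q = comp (lie_bracket M (E j) (E k)) l q"
proof -
  have "D q (E j q) (E k) = tadd (D q (E k q) (E j)) (lie_bracket M (E j) (E k) q)"
    by (rule torsion_free[OF domain_open frame_field frame_field q])
  moreover have "D q (E k q) (E j) \<in> T q"
    by (rule cov_tangent[OF domain_open frame_field q frame_tangent[OF q]])
  moreover have "lie_bracket M (E j) (E k) q \<in> T q"
    by (rule vector_field_tangent[OF lie_bracket_field[OF domain_open frame_field frame_field] q])
  ultimately show ?thesis
    by (simp add: conn_def comp_def metric_add_left[OF _ _ frame_tangent[OF q]])
qed

end

text \<open>A tensor symmetric in its first two indices is determined by its symmetrisation in the
  last two, by the alternation known from the Koszul formula.\<close>

lemma koszul_trick:
  fixes B :: "'i \<Rightarrow> 'i \<Rightarrow> 'i \<Rightarrow> real"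
  assumes sym: "\<And>j k l. B j k l = B k j l" and polar: "\<And>j k l. B j k l + B j l k = S j k l"
  shows "B j k l = (S j k l + S k j l - S l j k) / 2"
  unfolding polar[symmetric] sym[of k j l] sym[of k l j] sym[of l j k] by simp

lemma levi_civita4I:
  assumes "oriented_4_manifold M" "riemannian_metric M g" "levi_civita M g D"
  shows "levi_civita4 M g D"
proof
  show "oriented_4_manifold M" "riemannian_metric M g" by fact+
  show "affine_connection M D" using assms(3) unfolding levi_civita_def by (rule conjunct1)
  show "D p (X p) Y = tadd (D p (Y p) X) (lie_bracket M X Y p)"
    if "openin (topo M) U" "vector_field M U X" "vector_field M U Y" "p \<in> U" for U X Y p
    using assms(3)[unfolded levi_civita_def, THEN conjunct2, THEN conjunct1] that by blast
  show "X p (\<lambda>q. g q (Y q) (Z q)) = g p (D p (X p) Y) (Z p) + g p (Y p) (D p (X p) Z)"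
    if "openin (topo M) U" "vector_field M U X" "vector_field M U Y" "vector_field M U Z" "p \<in> U" for U X Y Z p
    using assms(3)[unfolded levi_civita_def, THEN conjunct2, THEN conjunct2] that by blast
qed

lemma (in riemannian4) conformal_riemannian_metric:
  assumes f: "smooth_fun M (points M) f"
  shows "riemannian_metric M (conformal f g)"
  unfolding riemannian_metric_def
proof (intro conjI ballI allI impI)
  fix p u v w a assume T: "u \<in> T p" "v \<in> T p" "w \<in> T p"
  show "conformal f g p u v = conformal f g p v u"
    using metric_commute[OF T(1,2)] by (simp add: conformal_def)
  show "conformal f g p (tadd u v) w = conformal f g p u w + conformal f g p v w"
    using metric_add_left[OF T] by (simp add: conformal_def distrib_left)
  show "conformal f g p (tscale a u) v = a * conformal f g p u v"
    using metric_scale_left[OF T(1,2)] by (simp add: conformal_def)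
  show "conformal f g p u u > 0" if "u \<noteq> tzero"
    using metric_pos[OF T(1) that] by (simp add: conformal_def)
next
  fix U X Y assume *: "openin (topo M) U \<and> vector_field M U X \<and> vector_field M U Y"
  then have U: "openin (topo M) U" by blast
  have "smooth_fun M U (\<lambda>p. exp (f p) * g p (X p) (Y p))"
    using * by (intro smooth_fun_mult smooth_fun_exp metric_smooth smooth_fun_subset[OF f openin_points[OF U]]) blast+
  then show "smooth_fun M U (\<lambda>p. conformal f g p (X p) (Y p))" by (simp add: conformal_def)
qed

locale conformal_frame = adapted_frame M g D U E p f
  for M :: "'m manifold" and g D U E p f +
  fixes D' :: "'m connection"
  assumes conformal_levi_civita: "levi_civita4 M (conformal f g) D'"

text \<open>The \<open>hat\<close> components expand \<open>D'\<close> in the frame that is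
  orthonormal for \<open>g\<close>, so that both connections share one frame.\<close>

sublocale conformal_frame \<subseteq> hat: torsion_free_frame M g U E D'
proof -
  interpret h: levi_civita4 M "conformal f g" D' by (rule conformal_levi_civita)
  show "torsion_free_frame M g U E D'" ..
qed

context conformal_frame
begin

text \<open>The function \<open>exp f * delta k l\<close> is differentiated by compatibility of
  \<open>D'\<close> with \<open>exp f * g\<close>; the factor \<open>exp f\<close> cancels.\<close>

lemma hat_compatible:
  assumes q: "q \<in> U"
  shows "hat.conn j k l q + hat.conn j l k q = df j q * delta k l"
proof -
  interpret h: levi_civita4 M "conformal f g" D' by (rule conformal_levi_civita)
  have DT: "D' q (E j q) (E k) \<in> T q" for k
    by (rule hat.cov_tangent[OF domain_open frame_field q frame_tangent[OF q]])
  have "E j q (\<lambda>r. conformal f g r (E k r) (E l r)) = E j q (\<lambda>r. delta k l * exp (f r))"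
    by (rule tangent_cong[OF frame_tangent[OF q] domain_open q])
      (use orthonormal_metric[OF frame_orthonormal] in \<open>simp add: conformal_def delta_def\<close>)
  also have "\<dots> = delta k l * (exp (f q) * df j q)"
    by (simp add: tangent_deriv_cmult[OF frame_tangent[OF q] smooth_near_exp[OF frame_near[OF f_smooth q]]]
        tangent_deriv_exp[OF frame_tangent[OF q] frame_near[OF f_smooth q]] df_def)
  finally have "exp (f q) * (df j q * delta k l) = E j q (\<lambda>r. conformal f g r (E k r) (E l r))"
    by simp
  also have "\<dots> = conformal f g q (D' q (E j q) (E k)) (E l q) + conformal f g q (E k q) (D' q (E j q) (E l))"
    by (rule h.metric_derivative[OF domain_open frame_field frame_field q frame_tangent[OF q]])
  also have "\<dots> = exp (f q) * (hat.conn j k l q + hat.conn j l k q)"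
    using metric_commute[OF frame_tangent[OF q] DT]
    by (simp add: conformal_def hat.conn_def distrib_left)
  finally show ?thesis by simp
qed

lemma hat_conn:
  assumes q: "q \<in> U"
  shows "hat.conn j k l q = conn j k l q
    + (df j q * delta k l + df k q * delta j l - delta j k * df l q) / 2"
proof -
  have t: "hat.conn j k l q - conn j k l q = hat.conn k j l q - conn k j l q" for j k l
    using conn_torsion[OF q, of j k l] hat.conn_torsion[OF q, of j k l] by linarith
  have c: "(hat.conn j k l q - conn j k l q) + (hat.conn j l k q - conn j l k q) = df j q * delta k l" for j k l
    using hat_compatible[OF q, of j k l] conn_skew[OF q, of j k l] by linarith
  show ?thesis
    using koszul_trick[of "\<lambda>j k l. hat.conn j k l q - conn j k l q" "\<lambda>j k l. df j q * delta k l" j k l, OF t c]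
    by (simp add: field_simps)
qed

lemma partial_hat_conn:
  "dp i (hat.conn j k l) = dp i (conn j k l)
    + (hess i j p * delta k l + hess i k p * delta j l - delta j k * hess i l p) / 2"
proof -
  \<comment> \<open>The difference tensor is linear in \<open>df\<close> with constant coefficients,
    so its derivative at \<open>p\<close> is the same expression in \<open>hess\<close>.\<close>
  have s: "smooth_fun M U (\<lambda>q. delta k l / 2 * df j q)" for j k l
    by (intro smooth_fun_cmult df_smooth domain_open)
  have d: "dp i (\<lambda>q. delta k l / 2 * df j q) = delta k l / 2 * hess i j p" for j k l
    by (simp only: tangent_deriv_cmult[OF p_frame_tangent near[OF df_smooth]] partial_df)
  have "dp i (hat.conn j k l) = dp i (\<lambda>q. conn j k l q + (delta k l / 2 * df j q + delta j l / 2 * df k q - delta j k / 2 * df l q))"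
    by (rule partial_cong) (simp add: hat_conn algebra_simps add_divide_distrib diff_divide_distrib)
  also have "\<dots> = dp i (conn j k l) + dp i (\<lambda>q. delta k l / 2 * df j q + delta j l / 2 * df k q - delta j k / 2 * df l q)"
    by (rule tangent_deriv_add[OF p_frame_tangent near near])
      (intro conn_smooth smooth_intros s domain_open)+
  finally have 1: "dp i (hat.conn j k l) = \<dots>" .
  have 2: "dp i (\<lambda>q. delta k l / 2 * df j q + delta j l / 2 * df k q - delta j k / 2 * df l q) =
      dp i (\<lambda>q. delta k l / 2 * df j q + delta j l / 2 * df k q) - dp i (\<lambda>q. delta j k / 2 * df l q)"
    by (rule tangent_deriv_diff[OF p_frame_tangent near near]) (intro smooth_fun_add s domain_open)+
  have 3: "dp i (\<lambda>q. delta k l / 2 * df j q + delta j l / 2 * df k q) =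
      dp i (\<lambda>q. delta k l / 2 * df j q) + dp i (\<lambda>q. delta j l / 2 * df k q)"
    by (rule tangent_deriv_add[OF p_frame_tangent near near]) (rule s)+
  show ?thesis unfolding 1 2 3 d by (simp add: field_simps)
qed

text \<open>The change of the Schouten tensor under the passage from \<open>g\<close> to
  \<open>exp f * g\<close>.\<close>

definition schouten :: "4 \<Rightarrow> 4 \<Rightarrow> real" where
  "schouten i j = - hess i j p / 2 + df i p * df j p / 4 - (\<Oplus>i. (df i p)\<^sup>2) * delta i j / 8"

lemma hat_curv: "hat.curv i j k l p = curv i j k l p + kulkarni_nomizu schouten i j k l"
proof -
  \<comment> \<open>Torsion-free connections share their skew part, and that of \<open>D\<close>
    vanishes at \<open>p\<close>.\<close>
  have t: "(\<Oplus>m. (hat.conn i j m p - hat.conn j i m p) * hat.conn m k l p) = 0"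
    by (rule sum.neutral) (use hat.conn_torsion[OF base_point] conn_torsion[OF base_point] conn_zero in simp)
  have c: "hat.conn j k l p = (df j p * delta k l + df k p * delta j l - delta j k * df l p) / 2" for j k l
    by (simp add: hat_conn[OF base_point] conn_zero)
  have s: "schouten = (\<lambda>i j. - hess i j p / 2 + df i p * df j p / 4 - (\<Oplus>i. (df i p)\<^sup>2) * delta i j / 8)"
    by (intro ext) (rule schouten_def)
  have "hat.curv i j k l p = curv i j k l p
    + (- ((hess i j p * delta k l + hess i k p * delta j l - delta j k * hess i l p) / 2)
    + (hess j i p * delta k l + hess j k p * delta i l - delta i k * hess j l p) / 2
    - (\<Oplus>m. (df j p * delta k m + df k p * delta j m - delta j k * df m p) / 2 *
        ((df i p * delta m l + df m p * delta i l - delta i m * df l p) / 2) -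
        (df i p * delta k m + df k p * delta i m - delta i k * df m p) / 2 *
        ((df j p * delta m l + df m p * delta j l - delta j m * df l p) / 2)))"
    (is "_ = _ + ?X")
    unfolding hat.curv_def t unfolding partial_hat_conn c curv_p by simp
  moreover have "?X = kulkarni_nomizu schouten i j k l"
    unfolding s by (rule conformal_curvature_algebra) (rule hess_commute[OF base_point])
  ultimately show ?thesis by (simp only:)
qed

lemma algebraic_curvature_p: "algebraic_curvature (\<lambda>i j k l. curv i j k l p)"
  by unfold_locales (rule curv_skew1, rule curv_skew2[OF base_point])

lemma schouten_commute: "schouten i j = schouten j i"
  by (simp add: schouten_def hess_commute[OF base_point, of i j] delta_commute[of i j] mult.commute)

text \<open>The quadratic increment from \<open>schouten_substitution\<close> and the divergence of
  P are both reduced to the same contractions of \<open>hess\<close>, \<open>df\<close> and Ricci,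
  with ratio 1/8.\<close>

lemma hat_euler_coeff:
  "euler_coeff (\<lambda>i j k l. hat.curv i j k l p) = euler_coeff (\<lambda>i j k l. curv i j k l p)
     + 1/8 * divergence M D (P_field M g D f) p"
proof -
  interpret R: algebraic_curvature "\<lambda>i j k l. curv i j k l p" by (rule algebraic_curvature_p)
  have r: "R.ric i j = ric i j p" for i j by (simp add: R.ric_def ric_def)
  have s: "R.scal = scal p" by (simp add: R.scal_def scal_def r)
  show ?thesis
    unfolding hat_curv R.euler_coeff_kulkarni_nomizu[OF schouten_commute] divergence_P
    unfolding schouten_def
    using R.schouten_substitution[where f = "\<lambda>i. df i p" and h = "\<lambda>i j. hess i j p", OF hess_commute[OF base_point]]
    unfolding r s by linarith
qed

lemma hat_pontrjagin_coeff:
  "pontrjagin_coeff (\<lambda>i j k l. hat.curv i j k l p) = pontrjagin_coeff (\<lambda>i j k l. curv i j k l p)"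
proof -
  interpret R: algebraic_curvature "\<lambda>i j k l. curv i j k l p" by (rule algebraic_curvature_p)
  show ?thesis
    unfolding hat_curv by (rule R.pontrjagin_coeff_kulkarni_nomizu[OF schouten_commute first_bianchi])
qed

text \<open>Since \<open>D'\<close> is not compatible with \<open>g\<close>, the argument of
  \<open>curv_skew2\<close> is replaced by reading the symmetry off \<open>hat_curv\<close>.\<close>

lemma hat_curv_skew: "hat.curv i j k l p = - hat.curv i j l k p"
  unfolding hat_curv using curv_skew2[OF base_point, of i j k l]
  by (simp add: kulkarni_nomizu_def)

end

section \<open>Characteristic forms in a frame\<close>

lemma wedge_shuffle_sum:
  "wedge \<alpha> \<beta> X = shuffle_sum (\<lambda>i j k l. \<alpha> (X i) (X j) * \<beta> (X k) (X l))"
  by (simp add: wedge_def shuffle_sum_def)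

lemma wedge_commute: "wedge \<alpha> \<beta> X = wedge \<beta> \<alpha> X"
  by (simp add: wedge_def mult.commute)

lemma wedge_uminus_left: "wedge (\<lambda>u v. - \<alpha> u v) \<beta> X = - wedge \<alpha> \<beta> X"
  by (simp add: wedge_def)

lemma bilinear_sum_product:
  fixes P Q :: "4 \<Rightarrow> 4 \<Rightarrow> real"
  shows "(\<Oplus>a b. x a * y b * P a b) * (\<Oplus>c d. z c * w d * Q c d) =
    (\<Oplus>a b. x a * y b * (\<Oplus>c d. z c * w d * (P a b * Q c d)))"
proof -
  have "(\<Oplus>c d. z c * w d * (P a b * Q c d)) =
      P a b * (\<Oplus>c d. z c * w d * Q c d)" for a b
    unfolding sum_distrib_left by (intro sum.cong refl) (simp add: mult_ac)
  then show ?thesis by (simp add: sum_distrib_right mult.assoc)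
qed

lemma wedge_bilinear:
  fixes \<alpha> \<beta> :: "4 \<Rightarrow> 4 \<Rightarrow> 'v \<Rightarrow> 'v \<Rightarrow> real"
  shows "wedge (\<lambda>u v. \<Oplus>a b. x a * y b * \<alpha> a b u v)
      (\<lambda>u v. \<Oplus>c d. z c * w d * \<beta> c d u v) X =
    (\<Oplus>a b. x a * y b * (\<Oplus>c d. z c * w d * wedge (\<alpha> a b) (\<beta> c d) X))"
  unfolding wedge_def bilinear_sum_product
  by (simp only: distrib_left right_diff_distrib sum.distrib sum_subtractf)

lemma sum_swap_pairs:
  "(\<Sum>i\<in>I. \<Sum>j\<in>J. \<Sum>a\<in>A. \<Sum>b\<in>B. h i j a b) = (\<Sum>a\<in>A. \<Sum>b\<in>B. \<Sum>i\<in>I. \<Sum>j\<in>J. h i j a b)"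
proof -
  have "(\<Sum>i\<in>I. \<Sum>j\<in>J. \<Sum>a\<in>A. \<Sum>b\<in>B. h i j a b) = (\<Sum>i\<in>I. \<Sum>a\<in>A. \<Sum>j\<in>J. \<Sum>b\<in>B. h i j a b)"
    by (rule sum.cong[OF refl], rule sum.swap)
  also have "\<dots> = (\<Sum>a\<in>A. \<Sum>i\<in>I. \<Sum>j\<in>J. \<Sum>b\<in>B. h i j a b)"
    by (rule sum.swap)
  also have "\<dots> = (\<Sum>a\<in>A. \<Sum>i\<in>I. \<Sum>b\<in>B. \<Sum>j\<in>J. h i j a b)"
    by (rule sum.cong[OF refl], rule sum.cong[OF refl], rule sum.swap)
  also have "\<dots> = (\<Sum>a\<in>A. \<Sum>b\<in>B. \<Sum>i\<in>I. \<Sum>j\<in>J. h i j a b)"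
    by (rule sum.cong[OF refl], rule sum.swap)
  finally show ?thesis .
qed

text \<open>A full contraction of two index pairs is invariant under O(4), because the columns of
  \<open>A\<close> are orthonormal.\<close>

lemma orthogonal_contraction:
  fixes A :: "real^4^4" and F :: "4 \<Rightarrow> 4 \<Rightarrow> 4 \<Rightarrow> 4 \<Rightarrow> real"
  assumes A: "transpose A ** A = mat 1"
  shows "(\<Oplus>i j. \<Oplus>a b. A$i$a * A$j$b *
      (\<Oplus>c d. A$i$c * A$j$d * F a b c d)) = (\<Oplus>a b. F a b a b)"
proof -
  have C: "(\<Oplus>i. A$i$a * A$i$c) = delta a c" for a c
    using arg_cong[OF A, of "\<lambda>B. B $ a $ c"]
    by (simp add: matrix_matrix_mult_def transpose_def mat_def delta_def)
  have "(\<Oplus>i j. A$i$a * A$j$b * (\<Oplus>c d. A$i$c * A$j$d * F a b c d)) = F a b a b" for a b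
  proof -
    have "(\<Oplus>i j. A$i$a * A$j$b * (\<Oplus>c d. A$i$c * A$j$d * F a b c d)) =
      (\<Oplus>i j. \<Oplus>c d. (A$i$a * A$i$c) * (A$j$b * A$j$d) * F a b c d)"
      unfolding sum_distrib_left by (intro sum.cong refl) (simp add: mult_ac)
    also have "\<dots> = (\<Oplus>c d. \<Oplus>i j. (A$i$a * A$i$c) * (A$j$b * A$j$d) * F a b c d)"
      by (rule sum_swap_pairs)
    also have "\<dots> = (\<Oplus>c d. delta a c * (delta b d * F a b c d))"
      unfolding C[symmetric] sum_product sum_distrib_right mult.assoc[symmetric]
      by (simp add: sum_distrib_left sum_distrib_right mult_ac)
    also have "\<dots> = F a b a b"
      unfolding sum_distrib_left[symmetric] sum_delta_left ..
    finally show ?thesis .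
  qed
  then show ?thesis by (subst sum_swap_pairs) simp
qed

context riemannian4
begin

lemma volume_form_frame:
  assumes e: "oriented_orthonormal M g p e" and X: "\<And>i. X i \<in> T p"
  shows "volume_form M g p X = det (\<chi> i j. g p (X i) (e j))"
  unfolding volume_form_def
proof (rule common_valueI[where P = "oriented_orthonormal M g p", OF e])
  fix e' assume e': "oriented_orthonormal M g p e'"
  define A :: "real^4^4" where "A = (\<chi> i j. g p (e' i) (e j))"
  note o = oriented_orthonormal_at[OF e] and o' = oriented_orthonormal_at[OF e']
  have "g p (X i) (e' j) = (\<Oplus>k. g p (X i) (e k) * A $ j $ k)" for i j
    unfolding A_def using metric_frame[OF o X orthonormal_tangent[OF o']] by simp
  then have "(\<chi> i j. g p (X i) (e' j)) = (\<chi> i j. g p (X i) (e j)) ** transpose A"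
    by (simp add: matrix_matrix_mult_def transpose_def)
  then show "det (\<chi> i j. g p (X i) (e' j)) = det (\<chi> i j. g p (X i) (e j))"
    using frame_change(3)[OF e e'] by (simp add: det_mul A_def)
qed

end

text \<open>The data at a single point, so that it applies both to \<open>g\<close> with the frame
  \<open>E\<close> and to \<open>exp f * g\<close> with the rescaled frame.\<close>

locale curvature_components = riemannian4 M g + algebraic_curvature R
  for M :: "'m manifold" and g and R +
  fixes D :: "'m connection" and p :: 'm and e :: "4 \<Rightarrow> 'm tvec"
  assumes oriented: "oriented_orthonormal M g p e"
    and curvature_components: "\<And>u v w. u \<in> T p \<Longrightarrow> v \<in> T p \<Longrightarrow> w \<in> T p \<Longrightarrow>
      curvature M D p u v w = lincomb (\<lambda>l. \<Oplus>k. g p w (e k) *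
        (\<Oplus>i j. g p u (e i) * g p v (e j) * R i j k l)) e"
begin

text \<open>The curvature 2-forms of the frame \<open>e\<close> by components; bilinear manipulation
  of these sums then carries no side conditions on tangency.\<close>

definition form :: "4 \<Rightarrow> 4 \<Rightarrow> 'm tvec \<Rightarrow> 'm tvec \<Rightarrow> real" where
  "form k l u v = (\<Oplus>i j. g p u (e i) * g p v (e j) * R i j k l)"

lemma form_skew: "form k l u v = - form l k u v"
  unfolding form_def sum_negf[symmetric] by (intro sum.cong refl) (simp add: skew2[of _ _ k l])

lemma wedge_form_skew: "wedge (form i j) (form k l) X = - wedge (form j i) (form k l) X"
  "wedge (form i j) (form k l) X = - wedge (form i j) (form l k) X"
proof -
  have f: "form i j = (\<lambda>u v. - form j i u v)" for i j
    by (intro ext) (rule form_skew)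
  show 1: "wedge (form i j) (form k l) X = - wedge (form j i) (form k l) X" for i j k l
    using wedge_uminus_left[of "form j i" "form k l" X] f[of i j] by simp
  show "wedge (form i j) (form k l) X = - wedge (form i j) (form l k) X"
    using 1[of k l i j] wedge_commute by metis
qed

text \<open>In dimension four a 4-form is a multiple of the volume form;
  \<open>shuffle_sum_det\<close> extracts the determinant from the components of
  \<open>X\<close>.\<close>

lemma wedge_form:
  "wedge (form a b) (form c d) X =
    det (\<chi> i j. g p (X i) (e j)) * wedge (\<lambda>i j. R i j a b) (\<lambda>i j. R i j c d) id"
proof -
  let ?x = "(\<chi> i j. g p (X i) (e j)) :: real^4^4"
  have "wedge (form a b) (form c d) X = shuffle_sum (\<lambda>i j k l. \<Oplus>s t. ?x$i$s * ?x$j$t *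
      (\<Oplus>m n. ?x$k$m * ?x$l$n * (R s t a b * R m n c d)))"
    unfolding wedge_shuffle_sum form_def bilinear_sum_product by simp
  also have "\<dots> = det ?x * shuffle_sum (\<lambda>s t m n. R s t a b * R m n c d)"
    by (rule shuffle_sum_det) (use skew1 in \<open>metis mult_minus_left mult_minus_right\<close>)+
  finally show ?thesis by (simp add: wedge_shuffle_sum)
qed

lemma curvature_form_frame_change:
  assumes e': "oriented_orthonormal M g p e'" and uv: "u \<in> T p" "v \<in> T p"
  defines "A \<equiv> (\<chi> i j. g p (e' i) (e j)) :: real^4^4"
  shows "curvature_form M g D p e' i j u v = (\<Oplus>k l. A$i$k * A$j$l * form k l u v)"
proof -
  note o = oriented_orthonormal_at[OF oriented] and o' = oriented_orthonormal_at[OF e']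
  have T: "e i \<in> T p" "e' i \<in> T p" for i using orthonormal_tangent o o' by blast+
  have "curvature_form M g D p e' i j u v =
      (\<Oplus>l. (\<Oplus>k. A$i$k * form k l u v) * A$j$l)"
    unfolding curvature_form_def curvature_components[OF uv T(2)] form_def A_def
    using metric_lincomb_left[OF T(2) T(1)] metric_commute[OF T] by simp
  also have "\<dots> = (\<Oplus>k l. A$i$k * A$j$l * form k l u v)"
    unfolding sum_distrib_right by (subst sum.swap) (simp only: mult_ac)
  finally show ?thesis .
qed

lemma wedge_curvature_form:
  assumes e': "oriented_orthonormal M g p e'" and X: "\<And>i. X i \<in> T p"
  defines "A \<equiv> (\<chi> i j. g p (e' i) (e j)) :: real^4^4"
  shows "wedge (curvature_form M g D p e' i j) (curvature_form M g D p e' k l) X =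
    (\<Oplus>a b. A$i$a * A$j$b * (\<Oplus>c d. A$k$c * A$l$d * wedge (form a b) (form c d) X))"
proof -
  have c: "curvature_form M g D p e' i j (X m) (X n) =
      (\<Oplus>k l. A$i$k * A$j$l * form k l (X m) (X n))" for i j m n
    unfolding A_def by (rule curvature_form_frame_change[OF e' X X])
  have "wedge (curvature_form M g D p e' i j) (curvature_form M g D p e' k l) X =
    wedge (\<lambda>u v. \<Oplus>a b. A$i$a * A$j$b * form a b u v)
      (\<lambda>u v. \<Oplus>c d. A$k$c * A$l$d * form c d u v) X"
    unfolding wedge_def c ..
  then show ?thesis unfolding wedge_bilinear .
qed

text \<open>The Euler form is a Pfaffian in the frame indices: a change of frame multiplies it by
  \<open>det A\<close>, which is 1 for oriented frames. \<open>shuffle_sum_det\<close> is used here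
  on the frame indices, and in \<open>wedge_form\<close> on the arguments.\<close>

lemma euler_form_frame:
  assumes X: "\<And>i. X i \<in> T p"
  shows "euler_form M g D p X = 1 / (4 * pi\<^sup>2) * (det (\<chi> i j. g p (X i) (e j)) * euler_coeff R)"
  unfolding euler_form_def
proof (rule common_valueI[where P = "oriented_orthonormal M g p", OF oriented])
  fix e' assume e': "oriented_orthonormal M g p e'"
  define A :: "real^4^4" where "A = (\<chi> i j. g p (e' i) (e j))"
  let ?R = "curvature_form M g D p e'"
  \<comment> \<open>2-forms commute under the wedge product, so the three terms are half of the six
    in \<open>shuffle_sum\<close>.\<close>
  have half: "\<alpha> 1 2 3 4 - \<alpha> 1 3 2 4 + \<alpha> 1 4 2 3 = 1/2 * shuffle_sum \<alpha>"
    if "\<And>i j k l. \<alpha> i j k l = \<alpha> k l i j" for \<alpha> :: "4 \<Rightarrow> 4 \<Rightarrow> 4 \<Rightarrow> 4 \<Rightarrow> real"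
    unfolding shuffle_sum_def using that[of 1 2 3 4] that[of 1 3 2 4] that[of 1 4 2 3] by simp
  have 1: "wedge (?R 1 2) (?R 3 4) X - wedge (?R 1 3) (?R 2 4) X + wedge (?R 1 4) (?R 2 3) X =
      1/2 * shuffle_sum (\<lambda>i j k l. wedge (?R i j) (?R k l) X)"
    by (rule half) (rule wedge_commute)
  have 2: "shuffle_sum (\<lambda>i j k l. wedge (?R i j) (?R k l) X) =
      det A * shuffle_sum (\<lambda>i j k l. wedge (form i j) (form k l) X)"
    unfolding wedge_curvature_form[OF e' X] A_def
    by (rule shuffle_sum_det) (rule wedge_form_skew)+
  have 3: "det A = 1"
    using frame_change(3)[OF oriented e'] by (simp add: A_def)
  have 4: "1/2 * shuffle_sum (\<lambda>i j k l. wedge (form i j) (form k l) X) =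
      wedge (form 1 2) (form 3 4) X - wedge (form 1 3) (form 2 4) X + wedge (form 1 4) (form 2 3) X"
    by (rule half[symmetric]) (rule wedge_commute)
  have 5: "wedge (form 1 2) (form 3 4) X - wedge (form 1 3) (form 2 4) X + wedge (form 1 4) (form 2 3) X =
      det (\<chi> i j. g p (X i) (e j)) * euler_coeff R"
    unfolding wedge_form euler_coeff_def by (simp add: algebra_simps)
  show "(let R = ?R in 1 / (4 * pi\<^sup>2) *
      (wedge (R 1 2) (R 3 4) X - wedge (R 1 3) (R 2 4) X + wedge (R 1 4) (R 2 3) X)) =
      1 / (4 * pi\<^sup>2) * (det (\<chi> i j. g p (X i) (e j)) * euler_coeff R)"
    unfolding Let_def 1 2 3 mult_1 4 5 ..
qed

text \<open>The sum over \<open>i < j\<close> is half a full contraction over ordered pairs, which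
  orthogonal changes of frame preserve.\<close>

lemma pontrjagin_form_frame:
  assumes X: "\<And>i. X i \<in> T p"
  shows "pontrjagin_form M g D p X = 1 / (4 * pi\<^sup>2) * (det (\<chi> i j. g p (X i) (e j)) * pontrjagin_coeff R)"
  unfolding pontrjagin_form_def
proof (rule common_valueI[where P = "oriented_orthonormal M g p", OF oriented])
  fix e' assume e': "oriented_orthonormal M g p e'"
  define A :: "real^4^4" where "A = (\<chi> i j. g p (e' i) (e j))"
  let ?R = "curvature_form M g D p e'"
  have half: "\<alpha> 1 2 1 2 + \<alpha> 1 3 1 3 + \<alpha> 1 4 1 4 + \<alpha> 2 3 2 3 + \<alpha> 2 4 2 4 + \<alpha> 3 4 3 4 =
      1/2 * (\<Oplus>i j. \<alpha> i j i j)"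
    if "\<And>i j k l. \<alpha> i j k l = - \<alpha> j i k l" "\<And>i j k l. \<alpha> i j k l = - \<alpha> i j l k"
    for \<alpha> :: "4 \<Rightarrow> 4 \<Rightarrow> 4 \<Rightarrow> 4 \<Rightarrow> real"
  proof -
    have z: "\<alpha> i i i i = 0" for i using that(1)[of i i i i] by simp
    have s: "\<alpha> j i j i = \<alpha> i j i j" for i j using that(1)[of j i j i] that(2)[of i j j i] by simp
    show ?thesis
      by (simp add: sum_4 z s[of 1 2] s[of 1 3] s[of 1 4] s[of 2 3] s[of 2 4] s[of 3 4])
  qed
  have sk: "?R i j (X m) (X n) = - ?R j i (X m) (X n)" for i j m n
  proof -
    have "(\<Oplus>k l. A$i$k * A$j$l * form k l (X m) (X n)) =
        - (\<Oplus>l k. A$j$l * A$i$k * form l k (X m) (X n))"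
      unfolding sum_negf[symmetric]
      by (subst sum.swap, intro sum.cong refl, subst form_skew) simp
    then show ?thesis
      using curvature_form_frame_change[OF e' X X, of i j m n] curvature_form_frame_change[OF e' X X, of j i m n]
      by (simp add: A_def)
  qed
  have "wedge (?R i j) (?R k l) X = - wedge (?R j i) (?R k l) X" for i j k l
    unfolding wedge_def sk[of i j] by simp
  moreover have "wedge (?R i j) (?R k l) X = - wedge (?R i j) (?R l k) X" for i j k l
    unfolding wedge_def sk[of k l] by simp
  ultimately have 1: "wedge (?R 1 2) (?R 1 2) X + wedge (?R 1 3) (?R 1 3) X + wedge (?R 1 4) (?R 1 4) X
       + wedge (?R 2 3) (?R 2 3) X + wedge (?R 2 4) (?R 2 4) X + wedge (?R 3 4) (?R 3 4) X =
      1/2 * (\<Oplus>i j. wedge (?R i j) (?R i j) X)"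
    by (rule half[of "\<lambda>i j k l. wedge (?R i j) (?R k l) X"])
  have 2: "(\<Oplus>i j. wedge (?R i j) (?R i j) X) =
      (\<Oplus>i j. wedge (form i j) (form i j) X)"
    unfolding wedge_curvature_form[OF e' X]
    by (rule orthogonal_contraction) (use frame_change(2)[OF oriented e'] matrix_left_right_inverse in blast)
  have 3: "1/2 * (\<Oplus>i j. wedge (form i j) (form i j) X) =
      wedge (form 1 2) (form 1 2) X + wedge (form 1 3) (form 1 3) X + wedge (form 1 4) (form 1 4) X
       + wedge (form 2 3) (form 2 3) X + wedge (form 2 4) (form 2 4) X + wedge (form 3 4) (form 3 4) X"
    by (rule half[of "\<lambda>i j k l. wedge (form i j) (form k l) X", symmetric]) (rule wedge_form_skew)+
  have 4: "wedge (form 1 2) (form 1 2) X + wedge (form 1 3) (form 1 3) X + wedge (form 1 4) (form 1 4) X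
       + wedge (form 2 3) (form 2 3) X + wedge (form 2 4) (form 2 4) X + wedge (form 3 4) (form 3 4) X = det (\<chi> i j. g p (X i) (e j)) * pontrjagin_coeff R"
    unfolding wedge_form pontrjagin_coeff_def by (simp only: distrib_left)
  show "(let R = ?R in 1 / (4 * pi\<^sup>2) *
      (wedge (R 1 2) (R 1 2) X + wedge (R 1 3) (R 1 3) X + wedge (R 1 4) (R 1 4) X
       + wedge (R 2 3) (R 2 3) X + wedge (R 2 4) (R 2 4) X + wedge (R 3 4) (R 3 4) X)) =
      1 / (4 * pi\<^sup>2) * (det (\<chi> i j. g p (X i) (e j)) * pontrjagin_coeff R)"
    unfolding Let_def 1 2 3 4 ..
qed

end

section \<open>Conformal weights and conclusion\<close>

lemma euler_coeff_scale: "euler_coeff (\<lambda>i j k l. c * R i j k l) = c\<^sup>2 * euler_coeff R"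
  by (simp add: euler_coeff_def wedge_def power2_eq_square algebra_simps)

lemma pontrjagin_coeff_scale: "pontrjagin_coeff (\<lambda>i j k l. c * R i j k l) = c\<^sup>2 * pontrjagin_coeff R"
  by (simp add: pontrjagin_coeff_def wedge_def power2_eq_square algebra_simps)

lemma det_scale_4: "det (\<chi> i j. c * A i j :: real^4^4) = c ^ 4 * det (\<chi> i j. A i j)"
  unfolding det_4 by (simp add: algebra_simps power4_eq_xxxx)

context conformal_frame
begin

lemma conformal_forms:
  assumes o: "oriented_orthonormal M g p (\<lambda>i. E i p)" and X: "\<And>i. X i \<in> T p"
  shows "euler_form M (conformal f g) D' p X = euler_form M g D p X
      + 1 / (32 * pi\<^sup>2) * divergence M D (P_field M g D f) p * volume_form M g p X"
    and "pontrjagin_form M (conformal f g) D' p X = pontrjagin_form M g D p X"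
proof -
  let ?d = "det (\<chi> i j. g p (X i) (E j p))"
  let ?R = "\<lambda>i j k l. curv i j k l p" and ?R' = "\<lambda>i j k l. hat.curv i j k l p"
  interpret C: curvature_components M g ?R D p "\<lambda>i. E i p"
    by unfold_locales (rule curv_skew1, rule curv_skew2[OF base_point], rule o, rule curvature_frame[OF base_point])
  interpret h: levi_civita4 M "conformal f g" D' by (rule conformal_levi_civita)
  \<comment> \<open>The length of \<open>E i p\<close> in the metric \<open>exp f * g\<close>;
    dividing by it makes the frame orthonormal for that metric.\<close>
  define c where "c = exp (f p / 2)"
  have c: "c > 0" "exp (f p) = c\<^sup>2"
    by (simp_all add: c_def power2_eq_square flip: exp_add)
  \<comment> \<open>The four rescaled frame vectors contribute \<open>1 / c ^ 4\<close> and lowering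
    an index with the new metric contributes \<open>c\<^sup>2\<close>, which leaves
    \<open>1 / c\<^sup>2\<close> per component.\<close>
  let ?e = "\<lambda>i. tscale (1 / c) (E i p)" and ?K = "\<lambda>i j k l. 1 / c\<^sup>2 * hat.curv i j k l p"
  have e: "?e i \<in> T p" for i
    by (rule tangent_scale[OF tangent_point[OF p_frame_tangent] p_frame_tangent])
  have ge: "conformal f g p u (?e i) = c * g p u (E i p)" if "u \<in> T p" for u i
    using metric_scale_right[OF p_frame_tangent that] c by (simp add: conformal_def power2_eq_square)
  have e_on: "h.orthonormal_at p ?e"
    unfolding h.orthonormal_at_def
    using e ge[OF e] metric_scale_left[OF p_frame_tangent p_frame_tangent] c
      orthonormal_metric[OF frame_orthonormal[OF base_point]] by simp
  obtain V \<phi> where chart: "(V, \<phi>) \<in> atlas M" "p \<in> V"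
    using chart_at[OF tangent_point[OF p_frame_tangent]] .
  have "det (\<chi> i j. ?e i (\<lambda>q. \<phi> q $ j)) = (1 / c) ^ 4 * det (\<chi> i j. E i p (\<lambda>q. \<phi> q $ j))"
    unfolding tscale_def by (rule det_scale_4)
  moreover have "det (\<chi> i j. E i p (\<lambda>q. \<phi> q $ j)) > 0"
    using o chart unfolding oriented_orthonormal_def by blast
  ultimately have e_or: "oriented_orthonormal M (conformal f g) p ?e"
    using h.oriented_orthonormal_chartI[OF e_on chart] c by simp
  have K: "curvature M D' p u v w = lincomb (\<lambda>l. \<Oplus>k. conformal f g p w (?e k) *
        (\<Oplus>i j. conformal f g p u (?e i) * conformal f g p v (?e j) * ?K i j k l)) ?e"
    if T: "u \<in> T p" "v \<in> T p" "w \<in> T p" for u v w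
  proof -
    let ?S = "\<lambda>l. \<Oplus>k. g p w (E k p) * (\<Oplus>i j. g p u (E i p) * g p v (E j p) * hat.curv i j k l p)"
    have "(\<Oplus>k. conformal f g p w (?e k) *
        (\<Oplus>i j. conformal f g p u (?e i) * conformal f g p v (?e j) * ?K i j k l)) = c * ?S l" for l
      unfolding ge[OF T(1)] ge[OF T(2)] ge[OF T(3)] sum_distrib_left
      by (intro sum.cong refl) (use c in \<open>simp add: power2_eq_square\<close>)
    then have "lincomb (\<lambda>l. \<Oplus>k. conformal f g p w (?e k) *
        (\<Oplus>i j. conformal f g p u (?e i) * conformal f g p v (?e j) * ?K i j k l)) ?e =
        lincomb ?S (\<lambda>l. E l p)"
      using c by (simp add: lincomb_def tscale_def)
    then show ?thesis using hat.curvature_frame[OF base_point T] by simp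
  qed
  interpret C': curvature_components M "conformal f g" ?K D' p ?e
  proof
    show "?K i j k l = - ?K j i k l" for i j k l using hat.curv_skew1[of i j k l p] by simp
    show "?K i j k l = - ?K i j l k" for i j k l using hat_curv_skew[of i j k l] by simp
  qed (rule e_or, rule K)
  have d: "det (\<chi> i j. conformal f g p (X i) (?e j)) = c ^ 4 * ?d"
    unfolding ge[OF X] by (rule det_scale_4)
  \<comment> \<open>The coefficients are quadratic in the curvature, so their weight cancels that of
    the volume form.\<close>
  have k: "c ^ 4 * (1 / c\<^sup>2)\<^sup>2 = 1" using c by (simp add: power_divide flip: power_mult)
  have "euler_form M (conformal f g) D' p X = 1 / (4 * pi\<^sup>2) * ((c ^ 4 * (1 / c\<^sup>2)\<^sup>2) * (?d * euler_coeff ?R'))"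
    unfolding C'.euler_form_frame[OF X] d euler_coeff_scale by (simp only: mult_ac)
  then show "euler_form M (conformal f g) D' p X = euler_form M g D p X
      + 1 / (32 * pi\<^sup>2) * divergence M D (P_field M g D f) p * volume_form M g p X"
    unfolding k C.euler_form_frame[OF X] hat_euler_coeff volume_form_frame[OF o X]
    by (simp add: field_simps)
  have "pontrjagin_form M (conformal f g) D' p X = 1 / (4 * pi\<^sup>2) * ((c ^ 4 * (1 / c\<^sup>2)\<^sup>2) * (?d * pontrjagin_coeff ?R'))"
    unfolding C'.pontrjagin_form_frame[OF X] d pontrjagin_coeff_scale by (simp only: mult_ac)
  then show "pontrjagin_form M (conformal f g) D' p X = pontrjagin_form M g D p X"
    unfolding k C.pontrjagin_form_frame[OF X] hat_pontrjagin_coeff by simp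
qed

end

theorem proposition1p1:
  fixes M :: "'m manifold" and g :: "'m metric" and f :: "'m \<Rightarrow> real"
    and D D' :: "'m connection"
  assumes "oriented_4_manifold M"
    and "riemannian_metric M g"
    and "smooth_fun M (points M) f"
    and "levi_civita M g D"
    and "levi_civita M (conformal f g) D'"
  shows "(\<forall>p\<in>points M. \<forall>X. (\<forall>i. X i \<in> tangent_space M p) \<longrightarrow>
            euler_form M (conformal f g) D' p X =
              euler_form M g D p X
              + 1 / (32 * pi\<^sup>2) * divergence M D (P_field M g D f) p * volume_form M g p X)
       \<and> (\<forall>p\<in>points M. \<forall>X. (\<forall>i. X i \<in> tangent_space M p) \<longrightarrow>
            pontrjagin_form M (conformal f g) D' p X = pontrjagin_form M g D p X)"
proof -
  interpret levi_civita4 M g D by (rule levi_civita4I) fact+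
  have hat: "levi_civita4 M (conformal f g) D'"
    by (rule levi_civita4I[OF assms(1) conformal_riemannian_metric[OF assms(3)] assms(5)])
  have "euler_form M (conformal f g) D' p X = euler_form M g D p X
      + 1 / (32 * pi\<^sup>2) * divergence M D (P_field M g D f) p * volume_form M g p X
    \<and> pontrjagin_form M (conformal f g) D' p X = pontrjagin_form M g D p X"
    if p: "p \<in> points M" and X: "\<forall>i. X i \<in> T p" for p X
  proof -
    obtain U E where E: "orthonormal_frame M g U E" "p \<in> U" "oriented_orthonormal M g p (\<lambda>i. E i p)"
      "\<And>i v. v \<in> T p \<Longrightarrow> D p v (E i) = tzero"
      by (rule adapted_frame_exists[OF p]) blast
    interpret orthonormal_frame M g U E by (rule E(1))
    interpret conformal_frame M g D U E p f D'
    proof (rule conformal_frame.intro)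
      show "adapted_frame M g D U E p f"
        by unfold_locales (use E smooth_fun_subset[OF assms(3) openin_points[OF domain_open]] in auto)
      show "conformal_frame_axioms M g f D'"
        by (rule conformal_frame_axioms.intro[OF hat])
    qed
    show ?thesis
      using conformal_forms[OF E(3)] X by blast
  qed
  then show ?thesis by blast
qed

end
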